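(* Let $K$ be a non-archimedean field, and let $\phi\in K(z)$ be a rational function of degree $d\geq 2$ with a totally invariant type II point $\xi\in\mathbb{P}^1_{\mathrm{Berk}}$. Let $U$ and $V$ be distinct components of $\mathbb{P}^1_{\mathrm{Berk}}\setminus\{\xi\}$ that both contain points of $\mathbb{P}^1(K)$. If at least one of the following holds: (a) $U$ and $V$ are both fixed, or (b) $U$ is an attracting fixed component, then there is a point $\alpha\in\mathbb{P}^1(\overline{K})\setminus(U\cup V)$ such that $[K(\alpha):K]\leq d-1$.
   Context: $K$ is a field, $\overline{K}$ an algebraic closure, $|\cdot|$ a non-archimedean absolute value on $\overline{K}$, $\mathbb{C}_v$ the completion of $\overline{K}$. $\mathbb{P}^1_{\mathrm{Berk}}$ is the Berkovich projective line over $\mathbb{C}_v$, a compact Hausdorff uniquely path-connected space containing $\mathbb{P}^1(\mathbb{C}_v)$, with a point $\zeta(a,r)$ for each closed disk $\bar D(a,r)\subseteq\mathbb{C}_v$, type II when $r\in|\mathbb{C}_v^\times|$; the components of $\mathbb{P}^1_{\mathrm{Berk}}\setminus\{\zeta(a,r)\}$ meet $\mathbb{P}^1(\mathbb{C}_v)$ in $\mathbb{P}^1(\mathbb{C}_v)\setminus\bar D(a,r)$ and in the open disks $D(b,r)$, $b\in\bar D(a,r)$. Rational functions extend uniquely to continuous self-maps of $\mathbb{P}^1_{\mathrm{Berk}}$. $\xi$ is totally invariant if $\phi^{-1}(\xi)=\{\xi\}$. A component $U$ is fixed if $\phi(U)\subseteq U$; a fixed component is indifferent if $\phi:U\to U$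 is one-to-one, attracting otherwise. *)

theory Defs
  imports "HOL-Analysis.Analysis" "HOL-Algebra.Algebraic_Closure_Type" "HOL-Algebra.Generated_Fields"
begin

section \<open>Non-archimedean absolute values and completions\<close>

locale nonarch_abs =
  fixes v :: "'a::field \<Rightarrow> real"
  assumes abs_nonneg: "v x \<ge> 0"
    and abs_eq_0_iff: "v x = 0 \<longleftrightarrow> x = 0"
    and abs_mult: "v (x * y) = v x * v y"
    and abs_add_le_max: "v (x + y) \<le> max (v x) (v y)"
begin

lemma abs_one: "v 1 = 1"
proof -
  have "v 1 * v 1 = v 1 * 1" using abs_mult[of 1 1] by simp
  moreover have "v 1 \<noteq> 0" by (simp add: abs_eq_0_iff)
  ultimately show ?thesis by (metis mult_cancel_left)
qed

lemma abs_minus: "v (- x) = v x"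
proof -
  have "(v (- 1))\<^sup>2 = 1"
    using abs_mult[of "- 1" "- 1"] abs_one by (simp add: power2_eq_square)
  then have "v (- 1) = 1" using abs_nonneg[of "- 1"] by (simp add: power2_eq_1_iff)
  then show ?thesis using abs_mult[of "- 1" x] by simp
qed

lemma Metric_space_abs: "Metric_space UNIV (\<lambda>x y. v (x - y))"
proof
  fix x y z :: 'a
  show "0 \<le> v (x - y)" by (rule abs_nonneg)
  show "v (x - y) = v (y - x)" using abs_minus[of "x - y"] by simp
  show "v (x - y) = 0 \<longleftrightarrow> x = y" by (simp add: abs_eq_0_iff)
  show "v (x - z) \<le> v (x - y) + v (y - z)"
    using abs_add_le_max[of "x - y" "y - z"] abs_nonneg[of "x - y"] abs_nonneg[of "y - z"]
    by simp
qed

end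

text \<open>The field \<^typ>\<open>'c\<close> with absolute value \<open>w\<close> is the completion of \<^typ>\<open>'b\<close> with absolute
  value \<open>v\<close>, along the embedding \<open>\<iota>\<close>.\<close>

locale nonarch_completion =
  base: nonarch_abs v + compl: nonarch_abs w
  for v :: "'b::field \<Rightarrow> real" and w :: "'c::field \<Rightarrow> real" +
  fixes \<iota> :: "'b \<Rightarrow> 'c"
  assumes emb_one: "\<iota> 1 = 1"
    and emb_add: "\<iota> (x + y) = \<iota> x + \<iota> y"
    and emb_mult: "\<iota> (x * y) = \<iota> x * \<iota> y"
    and emb_abs: "w (\<iota> x) = v x"
    and complete: "Metric_space.mcomplete UNIV (\<lambda>x y. w (x - y))"
    and dense: "Metric_space.mtopology UNIV (\<lambda>x y. w (x - y)) closure_of range \<iota> = UNIV"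

section \<open>The Berkovich projective line\<close>

text \<open>Here \<open>w\<close> is the absolute value of the complete algebraically closed field. A point of the
  Berkovich affine line is a multiplicative seminorm on the polynomial ring extending \<open>w\<close>; the
  topology is the weakest one making all evaluations continuous. The projective line is its
  one-point compactification. Throughout, \<^const>\<open>None\<close> is the point at infinity, both in
  the classical projective line \<^typ>\<open>'a option\<close> over a field and in the Berkovich one.\<close>

type_synonym 'c berk = "('c poly \<Rightarrow> real) option"

definition mult_seminorm :: "('c::field \<Rightarrow> real) \<Rightarrow> ('c poly \<Rightarrow> real) \<Rightarrow> bool" where
  "mult_seminorm w p \<longleftrightarrow>
     (\<forall>h. p h \<ge> 0) \<and> (\<forall>c. p [:c:] = w c) \<and>
     (\<forall>h k. p (h + k) \<le> p h + p k) \<and> (\<forall>h k. p (h * k) = p h * p k)"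

definition A1_Berk :: "('c::field \<Rightarrow> real) \<Rightarrow> ('c poly \<Rightarrow> real) topology" where
  "A1_Berk w = subtopology (product_topology (\<lambda>_. euclideanreal) UNIV) {p. mult_seminorm w p}"

definition P1_Berk :: "('c::field \<Rightarrow> real) \<Rightarrow> 'c berk topology" where
  "P1_Berk w = Alexandroff_compactification (A1_Berk w)"

definition classical_point :: "('c::field \<Rightarrow> real) \<Rightarrow> 'c option \<Rightarrow> 'c berk" where
  "classical_point w = map_option (\<lambda>a h. w (poly h a))"

text \<open>The point \<open>\<zeta>(a,r)\<close>: the supremum seminorm on the closed disk of radius \<open>r\<close> about \<open>a\<close>.\<close>

definition disk_point :: "('c::field \<Rightarrow> real) \<Rightarrow> 'c \<Rightarrow> real \<Rightarrow> 'c berk" where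
  "disk_point w a r = Some (\<lambda>h. SUP z\<in>{z. w (z - a) \<le> r}. w (poly h z))"

definition type_II :: "('c::field \<Rightarrow> real) \<Rightarrow> 'c berk \<Rightarrow> bool" where
  "type_II w \<xi> \<longleftrightarrow> (\<exists>a r. r \<in> w ` (UNIV - {0}) \<and> \<xi> = disk_point w a r)"

definition components_off :: "('c::field \<Rightarrow> real) \<Rightarrow> 'c berk \<Rightarrow> 'c berk set set" where
  "components_off w \<xi> =
     connected_components_of (subtopology (P1_Berk w) (topspace (P1_Berk w) - {\<xi>}))"

section \<open>Rational functions\<close>

text \<open>The self-map of the classical projective line given by \<open>f / g\<close>, for coprime \<open>f\<close> and \<open>g\<close>
  with \<open>g \<noteq> 0\<close>. At infinity, if \<open>degree f \<le> degree g\<close>, the value is the quotient of the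
  coefficients of index \<open>degree g\<close>.\<close>

definition rat_map :: "'c::field poly \<Rightarrow> 'c poly \<Rightarrow> 'c option \<Rightarrow> 'c option" where
  "rat_map f g x =
     (case x of
        Some z \<Rightarrow> if poly g z = 0 then None else Some (poly f z / poly g z)
      | None \<Rightarrow> if Polynomial.degree f > Polynomial.degree g then None
                else Some (Polynomial.coeff f (Polynomial.degree g)
                           / Polynomial.coeff g (Polynomial.degree g)))"

text \<open>\<open>\<Phi>\<close> is a continuous extension of \<open>\<phi>\<close> to the Berkovich line. For rational \<open>\<phi>\<close>
  (and nontrivial \<open>w\<close>) it exists and is unique as a map on \<^term>\<open>topspace (P1_Berk w)\<close>.\<close>

definition berk_extension ::
  "('c::field \<Rightarrow> real) \<Rightarrow> ('c option \<Rightarrow> 'c option) \<Rightarrow> ('c berk \<Rightarrow> 'c berk) \<Rightarrow> bool" where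
  "berk_extension w \<phi> \<Phi> \<longleftrightarrow>
     continuous_map (P1_Berk w) (P1_Berk w) \<Phi> \<and>
     (\<forall>x. \<Phi> (classical_point w x) = classical_point w (\<phi> x))"

definition totally_invariant ::
  "('c::field \<Rightarrow> real) \<Rightarrow> ('c berk \<Rightarrow> 'c berk) \<Rightarrow> 'c berk \<Rightarrow> bool" where
  "totally_invariant w \<Phi> \<xi> \<longleftrightarrow> {x \<in> topspace (P1_Berk w). \<Phi> x = \<xi>} = {\<xi>}"

definition fixed_component :: "('x \<Rightarrow> 'x) \<Rightarrow> 'x set \<Rightarrow> bool" where
  "fixed_component \<Phi> U \<longleftrightarrow> \<Phi> ` U \<subseteq> U"

definition indifferent_component :: "('x \<Rightarrow> 'x) \<Rightarrow> 'x set \<Rightarrow> bool" where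
  "indifferent_component \<Phi> U \<longleftrightarrow> fixed_component \<Phi> U \<and> inj_on \<Phi> U"

definition attracting_component :: "('x \<Rightarrow> 'x) \<Rightarrow> 'x set \<Rightarrow> bool" where
  "attracting_component \<Phi> U \<longleftrightarrow> fixed_component \<Phi> U \<and> \<not> indifferent_component \<Phi> U"

section \<open>Degrees of points over the base field\<close>

text \<open>\<open>[K(\<alpha>) : K]\<close> for a point \<open>\<alpha>\<close> of the projective line over the algebraic closure of
  \<open>K\<close>. For \<open>\<alpha> = \<infinity>\<close> nothing is adjoined, so that \<open>K(\<infinity>) = K\<close>.\<close>

definition point_field :: "'k::field alg_closure option \<Rightarrow> 'k alg_closure set" where
  "point_field \<alpha> = generate_field ring_of_type_algebra (range to_ac \<union> set_option \<alpha>)"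

definition point_degree :: "'k::field alg_closure option \<Rightarrow> nat" where
  "point_degree \<alpha> =
     ring.dim (ring_of_type_algebra :: 'k alg_closure ring) (range to_ac) (point_field \<alpha>)"

end

(* A type II point xi = zeta(a,r) is the same as a norm N on the plane over the algebraic closure,
   and the components of the complement of xi are the balls of radius < 1 for the chordal distance
   that N defines. The points of K in U and V give a K-rational N-orthogonal basis u, u'; in the
   coordinates s u + t u' the map is a pair of binary forms (P, Q) of degree d over K, and xi is the
   Gauss point for |s| = rho |t| with rho = N(u') / N(u). Total invariance forces good reduction:
   otherwise values from infinitely many residue classes are taken on one closed ball inside a class,
   and compactness yields a second preimage of xi. Good reduction, together with (a) or (b), makes two
   coefficients of P and Q of the same weighted size, that is |c| = rho^n for some c in K and
   1 <= n <= d - 1. If s^n = c, then s u + u' lies in neither component and has degree at most n.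
   In case (b) the only obstruction is a reduction of degree one at the class of u; there the map is
   a chordal isometry on classical points, hence, by density, injective on U. Density fails for the
   trivial absolute value, but then rho = 1 and n = 1, c = 1 will do. *)

theory Submission
  imports Defs
begin

section \<open>Degrees of algebraic points\<close>

text \<open>Total invariance enters through two facts only: \<xi> is fixed, and no other point is
  sent to \<xi>. Apart from the arcs that join points inside one class, Berkovich points are handled
  through their chordal distances to classical points. These are continuous and separate points, and
  \<xi> is the only point at distance 1 from all classical points. A closed set is therefore shown
  to contain \<xi> by exhibiting in it, for each finite set of classical points, a point at distance
  1 from that set. Roots enter because \<rho> need not be a value of K. In the coordinate normalized
  at \<xi> the coefficient P_i has size |P_i| \<rho>^i and Q_i has size |Q_i| \<rho>^(i+1), the
  extra factor being N(u') / N(u). Comparing P_d with Q_k gives the exponent n = d - 1 - k. The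
  index k = 0 accounts for the bound d - 1 of the theorem; k = d - 1 gives n = 0, which says nothing
  about \<rho>, and this is why that index needs a separate argument.\<close>

lemma ring_of_type_algebra_simps [simp]:
  "carrier ring_of_type_algebra = UNIV" "x \<otimes>\<^bsub>ring_of_type_algebra\<^esub> y = x * y"
  "x \<oplus>\<^bsub>ring_of_type_algebra\<^esub> y = x + y" "\<zero>\<^bsub>ring_of_type_algebra\<^esub> = 0" "\<one>\<^bsub>ring_of_type_algebra\<^esub> = 1"
  by (simp_all add: ring_of_type_algebra_def)

lemma subfield_range_to_ac:
  "subfield (range to_ac) (ring_of_type_algebra :: 'k::field alg_closure ring)"
proof -
  let ?R = "ring_of_type_algebra :: 'k alg_closure ring"
  let ?K = "range to_ac :: 'k alg_closure set"
  interpret R: field ?R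
    by rule
  have minus: "\<ominus>\<^bsub>?R\<^esub> y = - y" for y
    using R.minus_equality[of "- y" y] by simp
  have inv: "inv\<^bsub>?R\<^esub> y = inverse y" if "y \<noteq> 0" for y
    using R.inv_unique'[of y "inverse y"] that by simp
  show "subfield ?K ?R"
  proof (rule R.subfieldI')
    show "subring ?K ?R"
    proof (rule R.subringI)
      show "\<one>\<^bsub>?R\<^esub> \<in> ?K" by (metis rangeI ring_of_type_algebra_simps(5) to_ac_1)
    next
      fix h1 h2 assume "h1 \<in> ?K" "h2 \<in> ?K"
      then show "h1 \<otimes>\<^bsub>?R\<^esub> h2 \<in> ?K" "h1 \<oplus>\<^bsub>?R\<^esub> h2 \<in> ?K"
        by (auto simp flip: to_ac_mult to_ac_add)
    qed (auto simp: minus simp flip: to_ac_minus)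
    show "inv\<^bsub>?R\<^esub> k \<in> ?K" if "k \<in> ?K - {\<zero>\<^bsub>?R\<^esub>}" for k
      using that by (auto simp: inv simp flip: to_ac_inverse)
  qed
qed

lemma point_degree_infinity: "point_degree (None :: 'k::field alg_closure option) = 1"
proof -
  let ?R = "ring_of_type_algebra :: 'k alg_closure ring"
  let ?K = "range to_ac :: 'k alg_closure set"
  interpret R: field ?R
    by rule
  have "point_field (None :: 'k alg_closure option) = ?K"
    unfolding point_field_def
    by (rule sym, rule R.generate_fieldI) (use subfield_range_to_ac in auto)
  then show ?thesis
    using R.dimI[OF subfield_range_to_ac R.dimension_one[OF subfield_range_to_ac]]
    by (simp add: point_degree_def over_def)
qed

text \<open>The minimal polynomial \<open>R.Irr\<close> has the dimension of the simple extension as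
  its degree, and it divides every polynomial over the image of K that vanishes at \<open>x\<close>.
  As \<open>p\<close> may be reducible, an upper bound is what comes out.\<close>

lemma point_degree_le:
  fixes p :: "'k::field poly" and x :: "'k alg_closure"
  assumes "p \<noteq> 0" "poly (map_poly to_ac p) x = 0"
  shows "point_degree (Some x) \<le> Polynomial.degree p"
proof -
  let ?R = "ring_of_type_algebra :: 'k alg_closure ring"
  let ?K = "range to_ac :: 'k alg_closure set"
  interpret R: field ?R
    by rule
  have K: "subfield ?K ?R"
    by (rule subfield_range_to_ac)
  \<comment> \<open>On the algebraic side polynomials are coefficient lists with the leading
    coefficient first.\<close>
  define q where "q = rev (coeffs (map_poly to_ac p))"
  have q: "q \<in> carrier (?K[X]\<^bsub>?R\<^esub>)"
  proof -
    have "set q \<subseteq> ?K"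
      using range_coeff[of "map_poly to_ac p"] by (auto simp: q_def coeff_map_poly)
    moreover have "hd q \<noteq> 0" if "q \<noteq> []"
      using that by (simp add: q_def hd_rev last_coeffs_eq_coeff_degree)
    ultimately show ?thesis
      by (auto simp: univ_poly_def polynomial_def)
  qed
  have pow: "y [^]\<^bsub>?R\<^esub> n = y ^ n" for y and n :: nat
    by (induction n) (simp_all add: mult.commute)
  have "R.eval q x = poly (map_poly to_ac p) x"
  proof -
    have "R.eval xs x = poly (Poly (rev xs)) x" for xs
      by (induction xs) (auto simp: Poly_append poly_monom pow algebra_simps)
    from this[of q] show ?thesis by (simp add: q_def)
  qed
  with assms have ev: "R.eval q x = \<zero>\<^bsub>?R\<^esub>" by simp
  have deg: "Polynomial.degree (map_poly to_ac p) = Polynomial.degree p"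
    by (rule degree_map_poly) simp
  have nz: "map_poly to_ac p \<noteq> 0"
    using assms(1) by (metis coeff_0 coeff_map_poly leading_coeff_0_iff to_ac_0 to_ac_eq_0_iff)
  then have "q \<noteq> []" by (simp add: q_def)
  have alg: "(R.algebraic over ?K) x"
    using R.algebraicI[OF q \<open>q \<noteq> []\<close> ev] .
  have "point_field (Some x) = R.simple_extension ?K x"
    unfolding point_field_def
  proof (rule sym, rule R.generate_fieldI)
    show "subfield (R.simple_extension ?K x) ?R"
      using R.simple_extension_is_subfield[OF K] alg by simp
    show "?K \<union> set_option (Some x) \<subseteq> R.simple_extension ?K x"
      using R.simple_extension_incl[of ?K x] R.simple_extension_mem[OF subfieldE(1)[OF K], of x] by simp
    show "R.simple_extension ?K x \<subseteq> K'" if "subfield K' ?R" "?K \<union> set_option (Some x) \<subseteq> K'" for K'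
      using R.simple_extension_subring_incl[OF subfieldE(1)[OF that(1)], of ?K x] that(2) by simp
  qed simp
  then have "point_degree (Some x) = Polynomials.degree (R.Irr ?K x)"
    using R.simple_extension_dim[OF K _ alg] by (simp add: point_degree_def over_def)
  also have "\<dots> \<le> Polynomials.degree q"
    using R.pdivides_imp_degree_le[OF subfieldE(1)[OF K] R.IrrE(1)[OF K _ alg] q \<open>q \<noteq> []\<close>]
      R.Irr_minimal[OF K _ alg q ev] by simp
  also have "\<dots> = Polynomial.degree p"
    using deg by (simp add: q_def degree_eq_length_coeffs)
  finally show ?thesis .
qed

section \<open>Non-archimedean absolute values\<close>

text \<open>Instantiated for both embeddings: \<open>to_ac\<close> into the algebraic closure and
  \<open>\<iota>\<close> into the completion.\<close>

locale field_hom =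
  fixes h :: "'a::field \<Rightarrow> 'b::field"
  assumes one: "h 1 = 1" and add: "h (x + y) = h x + h y" and mult: "h (x * y) = h x * h y"
begin

lemma zero [simp]: "h 0 = 0"
  using add[of 0 0] by (metis add.right_neutral add_left_cancel)

lemma minus: "h (- x) = - h x"
  using add[of x "- x"] by (simp add: eq_neg_iff_add_eq_0 add.commute)

lemma diff: "h (x - y) = h x - h y"
  using add[of x "- y"] by (simp add: minus)

lemma eq_0_iff [simp]: "h x = 0 \<longleftrightarrow> x = 0"
  using mult[of x "inverse x"] one by (cases "x = 0") auto

lemma inverse: "h (inverse x) = inverse (h x)"
proof (cases "x = 0")
  case False
  then have "h x * h (inverse x) = 1" by (simp flip: mult add: one)
  then show ?thesis by (metis inverse_unique)
qed simp

lemma divide: "h (x / y) = h x / h y"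
  by (simp add: divide_inverse mult inverse)

lemma sum: "h (\<Sum>i\<in>A. f i) = (\<Sum>i\<in>A. h (f i))"
  by (induction A rule: infinite_finite_induct) (simp_all add: add)

lemma map_poly_diff: "map_poly h (p - q) = map_poly h p - map_poly h q"
  by (rule poly_eqI) (simp add: coeff_map_poly diff)

lemma map_poly_smult: "map_poly h (Polynomial.smult c p) = Polynomial.smult (h c) (map_poly h p)"
  by (rule poly_eqI) (simp add: coeff_map_poly mult)

lemma map_poly_mult: "map_poly h (p * q) = map_poly h p * map_poly h q"
  by (rule poly_eqI) (simp add: coeff_map_poly coeff_mult sum mult)

lemma map_poly_power: "map_poly h (p ^ n) = map_poly h p ^ n"
  by (induction n) (simp_all add: map_poly_mult map_poly_1' one)

lemma degree_map_poly: "Polynomial.degree (map_poly h p) = Polynomial.degree p"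
  by (rule Polynomial.degree_map_poly) simp

lemma poly_map_poly: "poly (map_poly h p) (h x) = h (poly p x)"
  by (induction p) (simp_all add: map_poly_pCons add mult)

end

context nonarch_abs
begin

lemma abs_zero [simp]: "v 0 = 0"
  by (simp add: abs_eq_0_iff)

lemma abs_pos_iff: "0 < v x \<longleftrightarrow> x \<noteq> 0"
  using abs_nonneg[of x] abs_eq_0_iff[of x] by linarith

lemma abs_diff_le_max: "v (x - y) \<le> max (v x) (v y)"
  using abs_add_le_max[of x "- y"] by (simp add: abs_minus)

lemma abs_diff_commute: "v (x - y) = v (y - x)"
  using abs_minus[of "x - y"] by simp

lemma abs_add_eq_right:
  assumes "v x < v y" shows "v (x + y) = v y"
  using assms abs_add_le_max[of x y] abs_diff_le_max[of "x + y" x] by (simp add: max_def split: if_splits)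

lemma abs_diff_eq_right: "v x < v y \<Longrightarrow> v (x - y) = v y"
  using abs_add_eq_right[of x "- y"] by (simp add: abs_minus)

lemma abs_power: "v (x ^ n) = v x ^ n"
  by (induction n) (simp_all add: abs_one abs_mult)

lemma abs_inverse: "v (inverse x) = inverse (v x)"
proof (cases "x = 0")
  case False
  then have "v x * v (inverse x) = 1"
    by (simp flip: abs_mult add: abs_one)
  then show ?thesis by (metis inverse_unique)
qed simp

lemma abs_divide: "v (x / y) = v x / v y"
  by (simp add: divide_inverse abs_mult abs_inverse)

lemma abs_power_int: "v (x powi k) = v x powi k"
  by (simp add: power_int_def abs_power abs_inverse)

lemma abs_prod: "v (\<Prod>i\<in>A. f i) = (\<Prod>i\<in>A. v (f i))"
  by (induction A rule: infinite_finite_induct) (simp_all add: abs_one abs_mult)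

lemma abs_prod_mset: "v (\<Prod>x\<in>#A. f x) = (\<Prod>x\<in>#A. v (f x))"
  by (induction A) (simp_all add: abs_one abs_mult)

lemma abs_sum_le:
  assumes "\<And>i. i \<in> A \<Longrightarrow> v (f i) \<le> B" "0 \<le> B"
  shows "v (\<Sum>i\<in>A. f i) \<le> B"
  using assms(1)
proof (induction A rule: infinite_finite_induct)
  case (insert x A)
  then have "v (f x) \<le> B" "v (\<Sum>i\<in>A. f i) \<le> B" by auto
  with abs_add_le_max[of "f x" "\<Sum>i\<in>A. f i"] insert.hyps show ?case by simp
qed (use assms(2) in auto)

lemma abs_sum_less:
  assumes "\<And>i. i \<in> A \<Longrightarrow> v (f i) < B" "0 < B"
  shows "v (\<Sum>i\<in>A. f i) < B"
  using assms(1)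
proof (induction A rule: infinite_finite_induct)
  case (insert x A)
  then have "v (f x) < B" "v (\<Sum>i\<in>A. f i) < B" by auto
  with abs_add_le_max[of "f x" "\<Sum>i\<in>A. f i"] insert.hyps show ?case by simp
qed (use assms(2) in auto)

lemma abs_of_nat_le_one: "v (of_nat n) \<le> 1"
proof (induction n)
  case (Suc n)
  then show ?case using abs_add_le_max[of 1 "of_nat n"] abs_one by simp
qed simp

text \<open>The factor z - x has Gauss norm \<open>max R (v x)\<close> on radius \<open>R\<close>,
  and Gauss norms are submultiplicative. The bound \<open>m\<close> is free because it is the
  constant \<open>R\<close> in one use and the distance of a point to the root \<open>x\<close> in
  the other.\<close>

lemma abs_coeff_prod_linear_le:
  assumes "0 \<le> R" "\<And>x. x \<in># A \<Longrightarrow> max R (v x) \<le> m x"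
  shows "v (Polynomial.coeff (\<Prod>x\<in>#A. [:- x, 1:]) i) * R ^ i \<le> (\<Prod>x\<in>#A. m x)"
  using assms(2)
proof (induction A arbitrary: i)
  case empty
  show ?case by (cases i) (simp_all add: abs_one)
next
  case (add x A)
  define q where "q = (\<Prod>x\<in>#A. [:- x, 1:])"
  define M where "M = (\<Prod>x\<in>#A. m x)"
  have IH: "v (Polynomial.coeff q j) * R ^ j \<le> M" for j
    unfolding q_def M_def by (rule add.IH) (use add.prems in auto)
  have M: "0 \<le> M" using IH[of 0] abs_nonneg[of "Polynomial.coeff q 0"] by simp
  have m: "R \<le> m x" "v x \<le> m x" using add.prems[of x] by auto
  have eq: "(\<Prod>x\<in>#add_mset x A. [:- x, 1:]) = Polynomial.smult (- x) q + pCons 0 q"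
    by (simp add: q_def)
  have 1: "v (- x * Polynomial.coeff q i) * R ^ i \<le> m x * M"
  proof -
    have "v x * (v (Polynomial.coeff q i) * R ^ i) \<le> m x * M"
      by (rule mult_mono[OF m(2) IH]) (use m assms(1) abs_nonneg in auto)
    then show ?thesis by (simp add: abs_mult abs_minus mult_ac)
  qed
  have 2: "v (Polynomial.coeff (pCons 0 q) i) * R ^ i \<le> m x * M"
  proof (cases i)
    case 0
    then show ?thesis using M m assms(1) by simp
  next
    case (Suc j)
    have "R * (v (Polynomial.coeff q j) * R ^ j) \<le> m x * M"
      by (rule mult_mono[OF m(1) IH]) (use m assms(1) abs_nonneg in auto)
    then show ?thesis by (simp add: Suc mult_ac)
  qed
  have "v (- x * Polynomial.coeff q i + Polynomial.coeff (pCons 0 q) i) * R ^ i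
      \<le> max (v (- x * Polynomial.coeff q i)) (v (Polynomial.coeff (pCons 0 q) i)) * R ^ i"
    by (intro mult_right_mono abs_add_le_max) (use assms(1) in simp)
  also have "\<dots> \<le> m x * M" using 1 2 by (simp add: max_def)
  finally show ?case by (simp only: eq M_def) (simp add: M_def)
qed

end

locale nonarch_abs_ac = nonarch_abs v for v :: "'b::alg_closed_field \<Rightarrow> real"
begin

text \<open>When all roots lie in the disk of radius \<open>R\<close>, each linear factor has Gauss
  norm \<open>R\<close>, so the leading term realizes the Gauss norm. Read backwards, a small
  leading coefficient forces a large root.\<close>

lemma abs_coeff_le_lead_coeff:
  assumes "p \<noteq> 0" "0 \<le> R" "\<And>z. poly p z = 0 \<Longrightarrow> v z \<le> R"
  shows "v (Polynomial.coeff p i) * R ^ i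
    \<le> v (Polynomial.coeff p (Polynomial.degree p)) * R ^ Polynomial.degree p"
proof -
  obtain A where A: "size A = Polynomial.degree p"
    "p = Polynomial.smult (Polynomial.lead_coeff p) (\<Prod>x\<in>#A. [:- x, 1:])"
    using alg_closed_imp_factorization[OF assms(1)] by blast
  have root: "poly p z = 0" if "z \<in># A" for z
    by (subst A(2)) (use that in \<open>auto simp: poly_prod_mset prod_mset_zero_iff\<close>)
  have "v (Polynomial.coeff (\<Prod>x\<in>#A. [:- x, 1:]) i) * R ^ i \<le> (\<Prod>x\<in>#A. R)"
    by (rule abs_coeff_prod_linear_le) (use assms root in auto)
  then have "v (Polynomial.lead_coeff p) * (v (Polynomial.coeff (\<Prod>x\<in>#A. [:- x, 1:]) i) * R ^ i)
    \<le> v (Polynomial.lead_coeff p) * R ^ Polynomial.degree p"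
    using A(1) abs_nonneg by (intro mult_left_mono) auto
  moreover have "v (Polynomial.coeff p i)
      = v (Polynomial.lead_coeff p) * v (Polynomial.coeff (\<Prod>x\<in>#A. [:- x, 1:]) i)"
    by (subst A(2)) (simp add: abs_mult)
  ultimately show ?thesis by (simp add: mult_ac)
qed

text \<open>The condition on \<open>s\<close> amounts to v (s - z) = max (v s) (v z) for each root
  z, so the value at \<open>s\<close> reaches the Gauss norm of radius \<open>v s\<close>.\<close>

lemma abs_coeff_le_poly:
  assumes "p \<noteq> 0" "\<And>z. poly p z = 0 \<Longrightarrow> v s \<le> v (s - z)"
  shows "v (Polynomial.coeff p i) * v s ^ i \<le> v (poly p s)"
proof -
  obtain A where A: "size A = Polynomial.degree p"
    "p = Polynomial.smult (Polynomial.lead_coeff p) (\<Prod>x\<in>#A. [:- x, 1:])"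
    using alg_closed_imp_factorization[OF assms(1)] by blast
  have root: "poly p z = 0" if "z \<in># A" for z
    by (subst A(2)) (use that in \<open>auto simp: poly_prod_mset prod_mset_zero_iff\<close>)
  have "v (Polynomial.coeff (\<Prod>x\<in>#A. [:- x, 1:]) i) * v s ^ i \<le> (\<Prod>x\<in>#A. v (s - x))"
  proof (rule abs_coeff_prod_linear_le)
    fix x assume "x \<in># A"
    then have "v s \<le> v (s - x)" using assms(2) root by blast
    then show "max (v s) (v x) \<le> v (s - x)"
      using abs_diff_le_max[of s "s - x"] by simp
  qed (rule abs_nonneg)
  then have "v (Polynomial.lead_coeff p) * (v (Polynomial.coeff (\<Prod>x\<in>#A. [:- x, 1:]) i) * v s ^ i)
    \<le> v (Polynomial.lead_coeff p) * (\<Prod>x\<in>#A. v (s - x))"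
    using abs_nonneg by (intro mult_left_mono) auto
  moreover have "v (Polynomial.coeff p i)
      = v (Polynomial.lead_coeff p) * v (Polynomial.coeff (\<Prod>x\<in>#A. [:- x, 1:]) i)"
    by (subst A(2)) (simp add: abs_mult)
  moreover have "v (poly p s) = v (Polynomial.lead_coeff p) * (\<Prod>x\<in>#A. v (s - x))"
    by (subst A(2)) (simp add: abs_mult abs_prod_mset poly_prod_mset)
  ultimately show ?thesis by (simp add: mult_ac)
qed

text \<open>A root \<open>s\<close> of \<open>\<Prod>b. (z - b) = c ^ n\<close> avoids all the given residue classes at once.\<close>

lemma exists_generic:
  assumes "finite B" "c \<noteq> 0"
  shows "\<exists>s. v s = v c \<and> (\<forall>b\<in>B. v c \<le> v (s - b))"
proof -
  \<comment> \<open>Points of larger absolute value keep their distance from \<open>s\<close>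
    anyway. The point 0 is added so that the factor s - 0 gives \<open>v c \<le> v s\<close> and the
    product is never empty.\<close>
  define B' where "B' = insert 0 {b \<in> B. v b \<le> v c}"
  define n where "n = card B'"
  have fin: "finite B'" using assms(1) by (simp add: B'_def)
  then have n: "n > 0" by (auto simp: n_def B'_def card_gt_0_iff)
  have c: "0 < v c" using assms(2) by (simp add: abs_pos_iff)
  have small: "v b \<le> v c" if "b \<in> B'" for b
    using that c by (auto simp: B'_def)
  define q where "q = (\<Prod>b\<in>B'. [:- b, 1:]) - [:c ^ n:]"
  have "Polynomial.degree (\<Prod>b\<in>B'. [:- b, 1:]) = n"
    by (subst degree_prod_eq_sum_degree) (simp_all add: n_def)
  then have "Polynomial.degree q = n"
    using n unfolding q_def diff_conv_add_uminus by (subst degree_add_eq_left) simp_all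
  with n obtain s where "poly q s = 0"
    using alg_closed_imp_poly_has_root by metis
  then have s: "(\<Prod>b\<in>B'. s - b) = c ^ n"
    by (simp add: q_def poly_prod)
  then have vs: "(\<Prod>b\<in>B'. v (s - b)) = v c ^ n"
    by (metis abs_prod abs_power)
  \<comment> \<open>The n factors have geometric mean \<open>v c\<close>. If \<open>v s\<close>
    exceeded it, every factor would be too large; otherwise no factor is larger, so none can be
    smaller.\<close>
  have le: "v s \<le> v c"
  proof (rule ccontr)
    assume "\<not> ?thesis"
    then have gt: "v c < v (s - b)" if "b \<in> B'" for b
      using small[OF that] abs_diff_eq_right[of b s] abs_diff_commute[of s b] by simp
    have zero: "0 \<in> B'" by (simp add: B'_def)
    have "(\<Prod>b\<in>B'. v c) < (\<Prod>b\<in>B'. v (s - b))"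
      using fin c zero gt gt[OF zero] less_trans[OF c gt]
      by (intro prod_mono_strict[where i = 0]) (auto intro: less_imp_le)
    then show False using vs by (simp add: n_def)
  qed
  have eq: "v c \<le> v (s - b)" if b: "b \<in> B'" for b
  proof (rule ccontr)
    assume less: "\<not> ?thesis"
    have "(\<Prod>b\<in>B'. v (s - b)) = v (s - b) * (\<Prod>b\<in>B' - {b}. v (s - b))"
      using fin b by (rule prod.remove)
    also have "\<dots> \<le> v (s - b) * (\<Prod>b\<in>B' - {b}. v c)"
    proof (intro mult_left_mono prod_mono conjI abs_nonneg)
      fix x assume "x \<in> B' - {b}"
      then show "v (s - x) \<le> v c"
        using abs_diff_le_max[of s x] small[of x] le by simp
    qed
    also have "\<dots> < v c * (\<Prod>b\<in>B' - {b}. v c)"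
      using less c by (intro mult_strict_right_mono) auto
    also have "\<dots> = v c ^ n"
      using fin b n by (auto simp: n_def power_eq_if[of _ "card B'"])
    finally show False using vs by simp
  qed
  have "v s = v c" using eq[of 0] le by (simp add: B'_def)
  moreover have "v c \<le> v (s - b)" if "b \<in> B" for b
  proof (cases "v b \<le> v c")
    case True
    then show ?thesis using eq[of b] that by (simp add: B'_def)
  next
    case False
    then show ?thesis using abs_diff_eq_right[of s b] le by simp
  qed
  ultimately show ?thesis by blast
qed

text \<open>Roots make a nontrivial value group dense: a root \<open>z\<close> of \<open>y\<close>
  of high order has absolute value just above 1, and its integer powers cannot jump over an interval
  whose endpoints have a larger ratio.\<close>

lemma value_between:
  assumes nontriv: "x0 \<noteq> 0" "v x0 \<noteq> 1" and "0 \<le> \<alpha>" "\<alpha> < \<beta>"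
  shows "\<exists>x. \<alpha> < v x \<and> v x < \<beta>"
proof -
  \<comment> \<open>\<open>\<alpha>\<close> may be 0, so a positive point of the interval serves as
    lower end for ratios and logarithms.\<close>
  define \<alpha>' where "\<alpha>' = (\<alpha> + \<beta>) / 2"
  have \<alpha>': "0 < \<alpha>'" "\<alpha> < \<alpha>'" "\<alpha>' < \<beta>" using assms by (auto simp: \<alpha>'_def)
  obtain y where y: "1 < v y"
  proof (cases "1 < v x0")
    case False
    then have "v x0 < 1" "0 < v x0" using nontriv by (auto simp: abs_pos_iff)
    then have "1 < v (inverse x0)" by (simp add: abs_inverse one_less_inverse)
    then show ?thesis using that by blast
  qed
  define \<gamma> where "\<gamma> = \<beta> / \<alpha>'"
  have \<gamma>: "1 < \<gamma>" using \<alpha>' by (simp add: \<gamma>_def)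
  obtain n where n: "v y < \<gamma> ^ n" using real_arch_pow[OF \<gamma>] by blast
  then have "n \<noteq> 0" using y by (intro notI) simp
  then obtain z where z: "z ^ n = y" using nth_root_exists[of n y] by auto
  have vz: "v z ^ n = v y" using z abs_power by metis
  have "v z < \<gamma>"
  proof (rule ccontr)
    assume "\<not> ?thesis"
    then have "\<gamma> ^ n \<le> v z ^ n" using \<gamma> by (intro power_mono) auto
    then show False using vz n by simp
  qed
  moreover have "1 < v z"
    using vz y abs_nonneg[of z] by (metis not_less power_le_one)
  ultimately have t: "1 < v z" "v z * \<alpha>' < \<beta>" using \<alpha>' by (simp_all add: \<gamma>_def field_simps)
  define k where "k = \<lfloor>log (v z) \<alpha>'\<rfloor> + 1"
  have *: "v (z powi k) = v z powr k"
    using t by (simp add: abs_power_int powr_real_of_int')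
  have "\<alpha>' = v z powr (log (v z) \<alpha>')" using t \<alpha>' by simp
  also have "\<dots> < v z powr k" using t by (intro powr_less_mono) (auto simp: k_def)
  finally have "\<alpha>' < v (z powi k)" using * by simp
  moreover have "v z powr k \<le> v z powr (1 + log (v z) \<alpha>')"
    using t by (intro powr_mono) (auto simp: k_def)
  then have "v (z powi k) \<le> v z * \<alpha>'"
    using t \<alpha>' * by (simp add: powr_add)
  ultimately show ?thesis using t \<alpha>' by (intro exI[of _ "z powi k"]) auto
qed

lemma value_between_avoiding:
  assumes nontriv: "x0 \<noteq> 0" "v x0 \<noteq> 1" and "0 \<le> \<alpha>" "\<alpha> < \<beta>" "finite F"
  shows "\<exists>x. \<alpha> < v x \<and> v x < \<beta> \<and> v x \<notin> F"
proof -
  have "open ({\<alpha><..<\<beta>} - F)" using \<open>finite F\<close> by (intro open_Diff finite_imp_closed) auto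
  moreover have "infinite ({\<alpha><..<\<beta>} - F)"
    using \<open>finite F\<close> \<open>\<alpha> < \<beta>\<close> by (simp add: infinite_Ioo)
  then obtain y where y: "y \<in> {\<alpha><..<\<beta>} - F" by (metis ex_in_conv infinite_imp_nonempty)
  ultimately obtain e where e: "e > 0" "ball y e \<subseteq> {\<alpha><..<\<beta>} - F"
    using openE by blast
  obtain x where x: "y < v x" "v x < y + e"
    using value_between[OF nontriv, of y "y + e"] y e \<open>0 \<le> \<alpha>\<close> by auto
  then have "v x \<in> {\<alpha><..<\<beta>} - F" using e by (intro subsetD[OF e(2)]) (simp add: dist_real_def)
  then show ?thesis by auto
qed

end

section \<open>Multiplicative seminorms\<close>

context nonarch_abs
begin

context
  fixes p :: "'a poly \<Rightarrow> real"
  assumes p: "mult_seminorm v p"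
begin

lemma seminorm_nonneg: "0 \<le> p h"
  and seminorm_const: "p [:c:] = v c"
  and seminorm_add_le: "p (h + k) \<le> p h + p k"
  and seminorm_mult: "p (h * k) = p h * p k"
  using p by (auto simp: mult_seminorm_def)

lemma seminorm_0: "p 0 = 0"
  using seminorm_const[of 0] by simp

lemma seminorm_1: "p 1 = 1"
  using seminorm_const[of 1] abs_one by (simp add: one_pCons)

lemma seminorm_smult: "p (Polynomial.smult c h) = v c * p h"
  using seminorm_mult[of "[:c:]" h] seminorm_const by simp

lemma seminorm_minus: "p (- h) = p h"
  using seminorm_smult[of "- 1" h] by (simp add: abs_minus abs_one)

lemma seminorm_power: "p (h ^ n) = p h ^ n"
  by (induction n) (simp_all add: seminorm_1 seminorm_mult)

lemma seminorm_sum_le: "p (\<Sum>i\<in>A. f i) \<le> (\<Sum>i\<in>A. p (f i))"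
proof (induction A rule: infinite_finite_induct)
  case (insert x A)
  then show ?case using seminorm_add_le[of "f x" "sum f A"] by simp
qed (simp_all add: seminorm_0)

lemma seminorm_of_nat_le: "p (of_nat n) \<le> 1"
  using abs_of_nat_le_one[of n] by (simp add: of_nat_poly seminorm_const)

text \<open>The ultrametric inequality is not part of the definition; it follows by expanding
  \<open>(h + k) ^ n\<close> and taking \<open>n\<close>-th roots.\<close>

lemma seminorm_add_le_max: "p (h + k) \<le> max (p h) (p k)"
proof (rule ccontr)
  define M where "M = max (p h) (p k)"
  assume "\<not> ?thesis"
  then have less: "M < p (h + k)" by (simp only: M_def not_le)
  have nn: "0 \<le> p h" "0 \<le> p k" by (rule seminorm_nonneg)+
  have M: "0 < M"
    using less nn seminorm_add_le[of h k] by (auto simp: M_def max_def split: if_splits)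
  have bound: "p (h + k) ^ n \<le> (real n + 1) * M ^ n" for n
  proof -
    have "p (h + k) ^ n = p (\<Sum>i\<le>n. of_nat (n choose i) * h ^ i * k ^ (n - i))"
      by (simp add: binomial_ring flip: seminorm_power)
    also have "\<dots> \<le> (\<Sum>i\<le>n. p (of_nat (n choose i) * h ^ i * k ^ (n - i)))"
      by (rule seminorm_sum_le)
    also have "\<dots> \<le> (\<Sum>i\<le>n. M ^ n)"
    proof (rule sum_mono)
      fix i assume "i \<in> {..n}"
      have "p (of_nat (n choose i) * h ^ i * k ^ (n - i)) = p (of_nat (n choose i)) * (p h ^ i * p k ^ (n - i))"
        by (simp add: seminorm_mult seminorm_power)
      also have "\<dots> \<le> 1 * (M ^ i * M ^ (n - i))"
        using nn by (intro mult_mono seminorm_of_nat_le power_mono) (auto simp: M_def)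
      also have "\<dots> = M ^ n" using \<open>i \<in> {..n}\<close> by (simp flip: power_add)
      finally show "p (of_nat (n choose i) * h ^ i * k ^ (n - i)) \<le> M ^ n" .
    qed
    finally show ?thesis by (simp add: algebra_simps)
  qed
  define \<gamma> where "\<gamma> = p (h + k) / M"
  have \<gamma>: "1 < \<gamma>" using less M by (simp add: \<gamma>_def)
  have "1 \<le> real n / \<gamma> ^ n + inverse \<gamma> ^ n" for n
  proof -
    have "\<gamma> ^ n \<le> real n + 1"
      using bound[of n] M by (simp add: \<gamma>_def power_divide divide_simps)
    then show ?thesis using \<gamma> by (simp add: power_inverse field_simps)
  qed
  moreover have "(\<lambda>n. real n / \<gamma> ^ n + inverse \<gamma> ^ n) \<longlonglongrightarrow> 0 + 0"
    using \<gamma> by (intro tendsto_add lim_n_over_pown LIMSEQ_power_zero) (auto simp: inverse_less_1_iff)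
  ultimately have "1 \<le> (0::real)" by (intro LIMSEQ_le_const[where X = "\<lambda>n. real n / \<gamma> ^ n + inverse \<gamma> ^ n"]) auto
  then show False by simp
qed

lemma seminorm_diff_le_max: "p (h - k) \<le> max (p h) (p k)"
  using seminorm_add_le_max[of h "- k"] by (simp add: seminorm_minus)

lemma seminorm_diff_eq_left: "p k < p h \<Longrightarrow> p (h - k) = p h"
  using seminorm_diff_le_max[of h k] seminorm_add_le_max[of "h - k" k] by simp

lemma seminorm_diff_commute: "p (h - k) = p (k - h)"
  using seminorm_minus[of "h - k"] by simp

lemma seminorm_abs_diff_le: "\<bar>p h - p k\<bar> \<le> p (h - k)"
  using seminorm_add_le[of "h - k" k] seminorm_add_le[of "k - h" h] seminorm_diff_commute[of h k] by simp

lemma seminorm_le_sum: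
  "p h \<le> (\<Sum>i\<le>Polynomial.degree h. v (Polynomial.coeff h i) * p [:0, 1:] ^ i)"
proof -
  have "p h = p (\<Sum>i\<le>Polynomial.degree h. Polynomial.smult (Polynomial.coeff h i) ([:0, 1:] ^ i))"
    by (subst poly_as_sum_of_monoms[of h, symmetric]) (simp add: monom_altdef)
  also have "\<dots> \<le> (\<Sum>i\<le>Polynomial.degree h. p (Polynomial.smult (Polynomial.coeff h i) ([:0, 1:] ^ i)))"
    by (rule seminorm_sum_le)
  finally show ?thesis by (simp add: seminorm_smult seminorm_power)
qed

end

text \<open>At t = 0 the convention 0 ^ 0 = 1 leaves the constant coefficient, so evaluation at a
  point becomes the case of radius 0 in \<open>disk_norm\<close>.\<close>

definition gauss_norm :: "real \<Rightarrow> 'a poly \<Rightarrow> real" where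
  "gauss_norm t h = Max ((\<lambda>i. v (Polynomial.coeff h i) * t ^ i) ` {..Polynomial.degree h})"

lemma gauss_norm_ge:
  assumes "0 \<le> t" shows "v (Polynomial.coeff h i) * t ^ i \<le> gauss_norm t h"
proof (cases "i \<le> Polynomial.degree h")
  case True
  then show ?thesis unfolding gauss_norm_def by (intro Max_ge) auto
next
  case False
  have "0 \<le> v (Polynomial.coeff h 0) * t ^ 0" by (simp add: abs_nonneg)
  also have "\<dots> \<le> gauss_norm t h" unfolding gauss_norm_def by (intro Max_ge imageI) auto
  finally show ?thesis using False by (simp add: coeff_eq_0)
qed

lemma gauss_norm_attained: "\<exists>i. gauss_norm t h = v (Polynomial.coeff h i) * t ^ i"
proof -
  have "gauss_norm t h \<in> (\<lambda>i. v (Polynomial.coeff h i) * t ^ i) ` {..Polynomial.degree h}"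
    unfolding gauss_norm_def by (intro Max_in) auto
  then show ?thesis by auto
qed

lemma gauss_norm_nonneg: "0 \<le> t \<Longrightarrow> 0 \<le> gauss_norm t h"
  using gauss_norm_ge[of t h 0] abs_nonneg[of "Polynomial.coeff h 0"] by simp

lemma gauss_norm_le_iff:
  assumes "0 \<le> t"
  shows "gauss_norm t h \<le> B \<longleftrightarrow> (\<forall>i. v (Polynomial.coeff h i) * t ^ i \<le> B)"
  using gauss_norm_ge[OF assms, of h] gauss_norm_attained[of t h] by (metis order_trans)

text \<open>Gauss's lemma: the product of the first terms that realize the two norms strictly
  dominates every other contribution to its coefficient.\<close>

lemma gauss_norm_mult:
  assumes t: "0 \<le> t" shows "gauss_norm t (h * k) = gauss_norm t h * gauss_norm t k"
proof (rule antisym)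
  let ?c = Polynomial.coeff
  have nn: "0 \<le> gauss_norm t h" "0 \<le> gauss_norm t k" using t by (auto intro: gauss_norm_nonneg)
  have trm: "v (?c h i * ?c k j) * t ^ (i + j) = (v (?c h i) * t ^ i) * (v (?c k j) * t ^ j)" for i j
    by (simp add: abs_mult power_add mult_ac)
  have nnt: "0 \<le> v x * t ^ i" for x i using abs_nonneg t by simp
  show "gauss_norm t (h * k) \<le> gauss_norm t h * gauss_norm t k"
    unfolding gauss_norm_le_iff[OF t]
  proof
    fix n
    obtain i where i: "i \<le> n" "v (\<Sum>i\<le>n. ?c h i * ?c k (n - i)) \<le> v (?c h i * ?c k (n - i))"
    proof -
      define M where "M = Max ((\<lambda>i. v (?c h i * ?c k (n - i))) ` {..n})"
      have "M \<in> (\<lambda>i. v (?c h i * ?c k (n - i))) ` {..n}" unfolding M_def by (intro Max_in) auto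
      moreover have "v (\<Sum>i\<le>n. ?c h i * ?c k (n - i)) \<le> M"
      proof (rule abs_sum_le)
        show "v (?c h i * ?c k (n - i)) \<le> M" if "i \<in> {..n}" for i
          unfolding M_def using that by (intro Max_ge) auto
        show "0 \<le> M" using calculation abs_nonneg by auto
      qed
      ultimately show ?thesis using that by auto
    qed
    have "v (?c (h * k) n) * t ^ n \<le> v (?c h i * ?c k (n - i)) * t ^ n"
      unfolding coeff_mult using i t by (intro mult_right_mono) auto
    also have "\<dots> = (v (?c h i) * t ^ i) * (v (?c k (n - i)) * t ^ (n - i))"
      using trm[of i "n - i"] i by simp
    also have "\<dots> \<le> gauss_norm t h * gauss_norm t k"
      using t nn nnt by (intro mult_mono gauss_norm_ge)
    finally show "v (?c (h * k) n) * t ^ n \<le> gauss_norm t h * gauss_norm t k" .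
  qed
  show "gauss_norm t h * gauss_norm t k \<le> gauss_norm t (h * k)"
  proof (cases "gauss_norm t h = 0 \<or> gauss_norm t k = 0")
    case True
    then show ?thesis using gauss_norm_nonneg[OF t, of "h * k"] by auto
  next
    case False
    then have pos: "0 < gauss_norm t h" "0 < gauss_norm t k" using nn by auto
    define a where "a = (LEAST i. v (?c h i) * t ^ i = gauss_norm t h)"
    define b where "b = (LEAST i. v (?c k i) * t ^ i = gauss_norm t k)"
    have a: "v (?c h a) * t ^ a = gauss_norm t h"
      unfolding a_def by (rule LeastI_ex) (metis gauss_norm_attained)
    have b: "v (?c k b) * t ^ b = gauss_norm t k"
      unfolding b_def by (rule LeastI_ex) (metis gauss_norm_attained)
    have la: "v (?c h i) * t ^ i < gauss_norm t h" if "i < a" for i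
      using not_less_Least[OF that[unfolded a_def]] gauss_norm_ge[OF t, of h i] by simp
    have lb: "v (?c k i) * t ^ i < gauss_norm t k" if "i < b" for i
      using not_less_Least[OF that[unfolded b_def]] gauss_norm_ge[OF t, of k i] by simp
    \<comment> \<open>For \<open>t\<close> = 0, positivity of the norms forces \<open>a\<close> =
      \<open>b\<close> = 0.\<close>
    have tab: "0 < t ^ (a + b)"
      using a b pos t by (cases "t = 0") (auto simp: power_0_left split: if_splits)
    have lead: "v (?c h a * ?c k b) * t ^ (a + b) = gauss_norm t h * gauss_norm t k"
      by (simp add: trm a b)
    have rest: "v (\<Sum>i\<in>{..a + b} - {a}. ?c h i * ?c k (a + b - i)) < v (?c h a * ?c k b)"
    proof (rule abs_sum_less)
      fix i assume "i \<in> {..a + b} - {a}"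
      then have i: "i \<le> a + b" "i \<noteq> a" by auto
      have "(v (?c h i) * t ^ i) * (v (?c k (a + b - i)) * t ^ (a + b - i)) < gauss_norm t h * gauss_norm t k"
      proof (cases "i < a")
        case True
        then show ?thesis
          by (intro le_less_trans[OF mult_left_mono[OF gauss_norm_ge[OF t] nnt]
                mult_strict_right_mono[OF la pos(2)]])
      next
        case False
        then have "a + b - i < b" using i by simp
        then show ?thesis
          by (intro le_less_trans[OF mult_right_mono[OF gauss_norm_ge[OF t] nnt]
                mult_strict_left_mono[OF lb pos(1)]])
      qed
      then have "v (?c h i * ?c k (a + b - i)) * t ^ (a + b) < v (?c h a * ?c k b) * t ^ (a + b)"
        using trm[of i "a + b - i"] i lead by simp
      then show "v (?c h i * ?c k (a + b - i)) < v (?c h a * ?c k b)"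
        using tab by simp
    next
      show "0 < v (?c h a * ?c k b)"
        using lead pos abs_nonneg[of "?c h a * ?c k b"] by (metis abs_pos_iff mult_eq_0_iff mult_pos_pos abs_zero less_irrefl)
    qed
    have "?c (h * k) (a + b) = (\<Sum>i\<in>{..a + b} - {a}. ?c h i * ?c k (a + b - i)) + ?c h a * ?c k b"
      unfolding coeff_mult by (subst sum.remove[of _ a]) (auto simp: add.commute)
    then have "v (?c (h * k) (a + b)) = v (?c h a * ?c k b)"
      using abs_add_eq_right[OF rest] by simp
    then show ?thesis using gauss_norm_ge[OF t, of "h * k" "a + b"] lead by simp
  qed
qed

lemma gauss_norm_add_le: "0 \<le> t \<Longrightarrow> gauss_norm t (h + k) \<le> gauss_norm t h + gauss_norm t k"
  unfolding gauss_norm_le_iff[of t "h + k"]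
proof
  fix i assume t: "0 \<le> t"
  have "v (Polynomial.coeff h i + Polynomial.coeff k i) \<le> v (Polynomial.coeff h i) + v (Polynomial.coeff k i)"
    using abs_add_le_max[of "Polynomial.coeff h i" "Polynomial.coeff k i"]
      abs_nonneg[of "Polynomial.coeff h i"] abs_nonneg[of "Polynomial.coeff k i"] by simp
  then have "v (Polynomial.coeff (h + k) i) * t ^ i
      \<le> v (Polynomial.coeff h i) * t ^ i + v (Polynomial.coeff k i) * t ^ i"
    using t by (simp add: mult_right_mono flip: distrib_right)
  also have "\<dots> \<le> gauss_norm t h + gauss_norm t k"
    using t by (intro add_mono gauss_norm_ge)
  finally show "v (Polynomial.coeff (h + k) i) * t ^ i \<le> gauss_norm t h + gauss_norm t k" .
qed

text \<open>The point \<zeta>(b, t) through recentred coefficients instead of a supremum. In this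
  form it is multiplicative and continuous in t for all real t \<ge> 0, as paths in the Berkovich
  line require.\<close>

definition disk_norm :: "'a \<Rightarrow> real \<Rightarrow> 'a poly \<Rightarrow> real" where
  "disk_norm b t h = gauss_norm t (h \<circ>\<^sub>p [:b, 1:])"

lemma mult_seminorm_disk_norm:
  assumes "0 \<le> t" shows "mult_seminorm v (disk_norm b t)"
  unfolding mult_seminorm_def disk_norm_def pcompose_mult pcompose_add
  using assms
  by (auto simp: gauss_norm_nonneg gauss_norm_mult gauss_norm_add_le pcompose_const)
    (simp add: gauss_norm_def)

lemma disk_norm_linear: "0 \<le> t \<Longrightarrow> disk_norm b t [:- x, 1:] = max (v (b - x)) t"
  by (simp add: disk_norm_def gauss_norm_def pcompose_pCons atMost_Suc abs_one max.commute)

lemma continuous_disk_norm: "continuous_on {0..} (\<lambda>t. disk_norm b t h)"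
proof -
  have "continuous_on {0..} (\<lambda>t. Max ((\<lambda>i. c i * t ^ i) ` {..n}))" for c :: "nat \<Rightarrow> real" and n
  proof (induction n)
    case (Suc n)
    have "Max ((\<lambda>i. c i * t ^ i) ` {..Suc n}) = max (c (Suc n) * t ^ Suc n) (Max ((\<lambda>i. c i * t ^ i) ` {..n}))" for t
      by (simp add: atMost_Suc)
    then show ?case using Suc by (simp only:) (intro continuous_intros)
  qed simp
  then show ?thesis by (simp add: disk_norm_def gauss_norm_def)
qed

lemma disk_norm_zero: "disk_norm b 0 h = v (poly h b)"
proof -
  have *: "gauss_norm 0 q = v (Polynomial.coeff q 0)" for q
    using gauss_norm_ge[of 0 q 0] gauss_norm_attained[of 0 q] abs_nonneg[of "Polynomial.coeff q 0"]
    by (auto simp: power_0_left split: if_splits)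
  show ?thesis by (simp add: disk_norm_def * flip: poly_0_coeff_0) (simp add: poly_pcompose)
qed

lemma mult_seminorm_eval: "mult_seminorm v (\<lambda>h. v (poly h b))"
  using mult_seminorm_disk_norm[of 0 b] by (simp add: disk_norm_zero[abs_def])

lemma topspace_A1_Berk [simp]: "topspace (A1_Berk v) = {p. mult_seminorm v p}"
  by (simp add: A1_Berk_def)

lemma topspace_P1_Berk: "topspace (P1_Berk v) = insert None (Some ` {p. mult_seminorm v p})"
  by (simp add: P1_Berk_def)

lemma continuous_map_A1_eval: "continuous_map (A1_Berk v) euclideanreal (\<lambda>p. p h)"
  unfolding A1_Berk_def
  by (intro continuous_map_from_subtopology continuous_map_product_projection) auto

lemma closed_mult_seminorm: "closed {p. mult_seminorm v p}"
proof -
  have [continuous_intros]: "continuous_on UNIV (\<lambda>p::'a poly \<Rightarrow> real. p h)" for h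
    by (rule continuous_on_product_coordinates)
  show ?thesis unfolding mult_seminorm_def
    by (intro closed_Collect_conj closed_Collect_all closed_Collect_le closed_Collect_eq continuous_intros)
qed

text \<open>Tychonoff: a bound at the variable bounds the value at every polynomial, which places
  this closed set in a product of compact intervals.\<close>

lemma compactin_A1_bounded: "compactin (A1_Berk v) {p. mult_seminorm v p \<and> p [:0, 1:] \<le> R}"
proof -
  define c where "c h = (\<Sum>i\<le>Polynomial.degree h. v (Polynomial.coeff h i) * R ^ i)" for h
  have "compactin (product_topology (\<lambda>_. euclideanreal) UNIV) (PiE UNIV (\<lambda>h. {0..c h}))"
    by (subst compactin_PiE) auto
  then have "compact (PiE UNIV (\<lambda>h. {0..c h}))"
    by (simp add: euclidean_product_topology)
  moreover have "closed {p. mult_seminorm v p \<and> p [:0, 1:] \<le> R}"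
    by (intro closed_Collect_conj closed_Collect_le closed_mult_seminorm continuous_on_product_coordinates continuous_on_const)
  ultimately have "compact (PiE UNIV (\<lambda>h. {0..c h}) \<inter> {p. mult_seminorm v p \<and> p [:0, 1:] \<le> R})"
    by (rule compact_Int_closed)
  moreover have "{p. mult_seminorm v p \<and> p [:0, 1:] \<le> R} \<subseteq> PiE UNIV (\<lambda>h. {0..c h})"
  proof clarify
    fix p assume p: "mult_seminorm v p" "p [:0, 1:] \<le> R"
    have "p h \<le> c h" for h
    proof -
      have "p h \<le> (\<Sum>i\<le>Polynomial.degree h. v (Polynomial.coeff h i) * p [:0, 1:] ^ i)"
        by (rule seminorm_le_sum[OF p(1)])
      also have "\<dots> \<le> c h" unfolding c_def
        using p by (intro sum_mono mult_left_mono power_mono) (auto simp: abs_nonneg seminorm_nonneg)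
      finally show ?thesis .
    qed
    then show "p \<in> PiE UNIV (\<lambda>h. {0..c h})"
      using seminorm_nonneg[OF p(1)] by (simp add: PiE_def)
  qed
  ultimately have "compact {p. mult_seminorm v p \<and> p [:0, 1:] \<le> R}"
    by (simp add: inf.absorb2)
  then show ?thesis
    by (auto simp: A1_Berk_def compactin_subtopology euclidean_product_topology)
qed

end

section \<open>The chordal distance of a disk\<close>

definition wedge :: "'b::field \<times> 'b \<Rightarrow> 'b \<times> 'b \<Rightarrow> 'b" where
  "wedge x y = fst x * snd y - snd x * fst y"

lemma wedge_commute: "wedge x y = - wedge y x"
  by (simp add: wedge_def)

text \<open>Joins estimates for the two components of the Pluecker relation into one for
  \<open>chart_norm\<close>, where \<open>r\<close> weights the second component.\<close>

lemma mult_max_le: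
  fixes A B W Q X0 X1 Y0 Y1 r :: real
  assumes "A * Y0 \<le> max (B * X0) (W * Q)" "r * A * Y1 \<le> max (r * B * X1) (W * Q)" "0 \<le> B"
  shows "A * max Y0 (r * Y1) \<le> max (W * Q) (B * max X0 (r * X1))"
proof -
  have "B * X0 \<le> B * max X0 (r * X1)" "B * (r * X1) \<le> B * max X0 (r * X1)"
    using assms(3) by (auto intro: mult_left_mono)
  then show ?thesis using assms by (auto simp: max_def mult_ac split: if_splits)
qed

text \<open>Center and radius are taken from the algebraically closed field and not from its
  completion, so that roots and residue classes can be chosen there; \<open>type_II_chart\<close>
  puts every type II point into this form.\<close>

locale berk_chart = nonarch_completion v w \<iota>
  for v :: "'b::alg_closed_field \<Rightarrow> real" and w :: "'c::field \<Rightarrow> real" and \<iota> :: "'b \<Rightarrow> 'c" +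
  fixes a :: 'b and r :: real
  assumes r: "r \<in> v ` (UNIV - {0})"
begin

sublocale base: nonarch_abs_ac v
  by unfold_locales

lemma r_pos: "0 < r"
  using r base.abs_pos_iff by auto

sublocale emb: field_hom \<iota>
  by unfold_locales (rule emb_one emb_add emb_mult)+

text \<open>Vectors \<open>x\<close> are homogeneous coordinates of points of the projective line, \<open>(0, 0)\<close> being junk.
  \<open>chart_norm\<close> is the norm attached to the disk of radius \<open>r\<close> about \<open>a\<close>; \<open>berk_chord P x\<close> extends
  the corresponding chordal distance to a Berkovich point \<open>P\<close>.\<close>

definition chart_norm :: "'b \<times> 'b \<Rightarrow> real" where
  "chart_norm x = max (v (fst x - a * snd x)) (r * v (snd x))"

definition point :: "'b \<times> 'b \<Rightarrow> 'b option" where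
  "point x = (if snd x = 0 then None else Some (fst x / snd x))"

definition berk_point :: "'b \<times> 'b \<Rightarrow> 'c berk" where
  "berk_point x = classical_point w (map_option \<iota> (point x))"

definition lin :: "'b \<times> 'b \<Rightarrow> 'c poly" where
  "lin x = [:- \<iota> (fst x), \<iota> (snd x):]"

text \<open>Infinity is represented by (1, 0), whose wedge with \<open>x\<close> has absolute value
  \<open>v (snd x)\<close> and whose \<open>chart_norm\<close> is 1; any other point by (z, 1), with
  z the polynomial variable. \<open>lin_norm\<close> is the \<open>chart_norm\<close> of the same
  representative.\<close>

definition lin_abs :: "'c berk \<Rightarrow> 'b \<times> 'b \<Rightarrow> real" where
  "lin_abs P x = (case P of None \<Rightarrow> v (snd x) | Some p \<Rightarrow> p (lin x))"

definition lin_norm :: "'c berk \<Rightarrow> real" where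
  "lin_norm P = (case P of None \<Rightarrow> 1 | Some p \<Rightarrow> max (p (lin (a, 1))) r)"

text \<open>The factor \<open>r\<close> makes 1 the largest value; it is attained by (1, 0) and (a,
  1).\<close>

definition chord :: "'b \<times> 'b \<Rightarrow> 'b \<times> 'b \<Rightarrow> real" where
  "chord x y = r * v (wedge x y) / (chart_norm x * chart_norm y)"

definition berk_chord :: "'c berk \<Rightarrow> 'b \<times> 'b \<Rightarrow> real" where
  "berk_chord P x = r * lin_abs P x / (lin_norm P * chart_norm x)"

abbreviation P1 :: "'c berk topology" where "P1 \<equiv> P1_Berk w"

lemma point_in_P1_cases:
  assumes "P \<in> topspace P1"
  obtains "P = None" | p where "P = Some p" "mult_seminorm w p"
  using assms compl.topspace_P1_Berk by auto

lemma chart_norm_pos: "x \<noteq> (0, 0) \<Longrightarrow> 0 < chart_norm x"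
  using r_pos base.abs_pos_iff[of "snd x"] base.abs_pos_iff[of "fst x"]
  by (cases "snd x = 0") (auto simp: chart_norm_def less_max_iff_disj prod_eq_iff)

lemma chart_norm_nonneg: "0 \<le> chart_norm x"
  using base.abs_nonneg by (simp add: chart_norm_def le_max_iff_disj)

lemma lin_norm_pos: "0 < lin_norm P"
  using r_pos by (auto simp: lin_norm_def less_max_iff_disj split: option.split)

lemma lin_abs_nonneg: "P \<in> topspace P1 \<Longrightarrow> 0 \<le> lin_abs P x"
  by (erule point_in_P1_cases) (auto simp: lin_abs_def base.abs_nonneg compl.seminorm_nonneg)

text \<open>With \<open>Z = (z, 1)\<close> the linear form \<open>lin x\<close> is \<open>x \<and> Z\<close> up to sign; these are two components of
  the Pluecker relation between \<open>x\<close>, \<open>y\<close> and \<open>Z\<close>.\<close>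

lemma lin_plucker:
  "Polynomial.smult (\<iota> (snd y)) (lin x) = Polynomial.smult (\<iota> (snd x)) (lin y) - [:\<iota> (wedge x y):]"
  "Polynomial.smult (\<iota> (fst y - a * snd y)) (lin x)
    = Polynomial.smult (\<iota> (fst x - a * snd x)) (lin y) - Polynomial.smult (\<iota> (wedge x y)) (lin (a, 1))"
  by (simp_all add: lin_def wedge_def emb.diff emb_mult emb_one algebra_simps)

text \<open>The ultrametric inequality of the seminorm, applied to each component of the Pluecker
  relation. Division by \<open>lin_norm\<close> and the two chart norms gives the triangle
  inequalities for \<open>berk_chord\<close>. Infinity is not a seminorm and is computed
  separately.\<close>

lemma plucker_bounds:
  assumes P: "P \<in> topspace P1"
  shows "lin_abs P x * chart_norm y \<le> max (v (wedge x y) * lin_norm P) (lin_abs P y * chart_norm x)"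
    and "v (wedge x y) * lin_norm P \<le> max (lin_abs P y * chart_norm x) (lin_abs P x * chart_norm y)"
proof -
  let ?N = "\<lambda>x. v (fst x - a * snd x)"
  have pos: "0 \<le> lin_abs P x" "0 \<le> lin_abs P y" using P by (auto intro: lin_abs_nonneg)
  have le: "lin_abs P x * ?N y \<le> lin_abs P x * chart_norm y"
    "lin_abs P x * (r * v (snd y)) \<le> lin_abs P x * chart_norm y"
    "lin_abs P y * ?N x \<le> lin_abs P y * chart_norm x"
    "lin_abs P y * (r * v (snd x)) \<le> lin_abs P y * chart_norm x"
    using pos by (auto simp: chart_norm_def intro!: mult_left_mono)
  have wpos: "0 \<le> v (wedge x y)" by (rule base.abs_nonneg)
  show "lin_abs P x * chart_norm y \<le> max (v (wedge x y) * lin_norm P) (lin_abs P y * chart_norm x)"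
    and "v (wedge x y) * lin_norm P \<le> max (lin_abs P y * chart_norm x) (lin_abs P x * chart_norm y)"
    using P
  proof (atomize (full), cases rule: point_in_P1_cases)
    case 1
    have eq: "snd x * (fst y - a * snd y) = snd y * (fst x - a * snd x) - wedge x y"
      by (simp add: wedge_def algebra_simps)
    then have eq': "snd y * (fst x - a * snd x) - snd x * (fst y - a * snd y) = wedge x y"
      by simp
    have "v (snd x) * ?N y \<le> max (v (snd y) * ?N x) (v (wedge x y) * 1)"
      using base.abs_diff_le_max[of "snd y * (fst x - a * snd x)" "wedge x y"]
      by (simp add: base.abs_mult flip: eq)
    moreover have "r * v (snd x) * v (snd y) \<le> max (r * v (snd y) * v (snd x)) (v (wedge x y) * 1)"
      by (simp add: mult_ac)
    moreover have "v (wedge x y) \<le> max (v (snd y) * ?N x) (v (snd x) * ?N y)"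
      using base.abs_diff_le_max[of "snd y * (fst x - a * snd x)" "snd x * (fst y - a * snd y)"]
      by (simp only: eq' base.abs_mult)
    ultimately show "lin_abs P x * chart_norm y \<le> max (v (wedge x y) * lin_norm P) (lin_abs P y * chart_norm x) \<and>
       v (wedge x y) * lin_norm P \<le> max (lin_abs P y * chart_norm x) (lin_abs P x * chart_norm y)"
      using mult_max_le[of "v (snd x)" "?N y" "v (snd y)" "?N x" "v (wedge x y)" 1 r "v (snd y)" "v (snd x)"] le
      by (simp add: 1 lin_abs_def lin_norm_def chart_norm_def[symmetric] base.abs_nonneg)
  next
    case (2 p)
    let ?A = "p (lin x)" let ?B = "p (lin y)" let ?W = "v (wedge x y)" let ?Z = "p (lin (a, 1))"
    note S = 2(2)
    have scale: "p (Polynomial.smult (\<iota> c) h) = v c * p h" for c h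
      by (simp add: compl.seminorm_smult[OF S] emb_abs)
    have const: "p [:\<iota> c:] = v c" for c
      by (simp add: compl.seminorm_const[OF S] emb_abs)
    have e1: "?A * v (snd y) \<le> max (?B * v (snd x)) ?W"
      using compl.seminorm_diff_le_max[OF S, of "Polynomial.smult (\<iota> (snd x)) (lin y)" "[:\<iota> (wedge x y):]"]
      by (simp add: scale const mult_ac flip: lin_plucker(1))
    have e2: "?A * ?N y \<le> max (?B * ?N x) (?W * ?Z)"
      using compl.seminorm_diff_le_max[OF S, of "Polynomial.smult (\<iota> (fst x - a * snd x)) (lin y)"
          "Polynomial.smult (\<iota> (wedge x y)) (lin (a, 1))"]
      by (simp add: scale mult_ac flip: lin_plucker(2))
    have "[:\<iota> (wedge x y):] = Polynomial.smult (\<iota> (snd x)) (lin y) - Polynomial.smult (\<iota> (snd y)) (lin x)"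
      using lin_plucker(1)[of y x] by (simp add: algebra_simps)
    then have e3: "?W \<le> max (?B * v (snd x)) (?A * v (snd y))"
      using compl.seminorm_diff_le_max[OF S, of "Polynomial.smult (\<iota> (snd x)) (lin y)" "Polynomial.smult (\<iota> (snd y)) (lin x)"]
      by (metis const scale mult.commute)
    have "Polynomial.smult (\<iota> (wedge x y)) (lin (a, 1)) = Polynomial.smult (\<iota> (fst x - a * snd x)) (lin y)
        - Polynomial.smult (\<iota> (fst y - a * snd y)) (lin x)"
      using lin_plucker(2)[of y x] by (simp add: algebra_simps)
    then have e4: "?W * ?Z \<le> max (?B * ?N x) (?A * ?N y)"
      using compl.seminorm_diff_le_max[OF S, of "Polynomial.smult (\<iota> (fst x - a * snd x)) (lin y)"
          "Polynomial.smult (\<iota> (fst y - a * snd y)) (lin x)"]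
      by (metis scale mult.commute)
    have eq: "lin_abs P = (\<lambda>x. p (lin x))" "lin_norm P = max ?Z r"
      by (auto simp: 2 lin_abs_def lin_norm_def)
    have W: "?W * ?Z \<le> ?W * max ?Z r" "?W * r \<le> ?W * max ?Z r"
      using wpos by (auto intro: mult_left_mono)
    have "?A * ?N y \<le> max (?B * ?N x) (?W * max ?Z r)"
      using e2 W by (auto simp: max_def split: if_splits)
    moreover have "r * ?A * v (snd y) \<le> max (r * ?B * v (snd x)) (?W * max ?Z r)"
    proof -
      have "r * (?A * v (snd y)) \<le> r * max (?B * v (snd x)) ?W"
        using r_pos e1 by (intro mult_left_mono) auto
      also have "\<dots> = max (r * (?B * v (snd x))) (r * ?W)"
        using r_pos by (simp add: max_mult_distrib_left)
      finally show ?thesis using W(2) by (auto simp: mult_ac max_def split: if_splits)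
    qed
    ultimately have one: "?A * chart_norm y \<le> max (?W * max ?Z r) (?B * chart_norm x)"
      unfolding chart_norm_def using compl.seminorm_nonneg[OF S] by (intro mult_max_le)
    have "?W * r \<le> max (r * (?B * v (snd x))) (r * (?A * v (snd y)))"
      using mult_left_mono[OF e3, of r] r_pos by (simp add: mult.commute[of _ r] max_mult_distrib_left)
    then have two: "?W * max ?Z r \<le> max (?B * chart_norm x) (?A * chart_norm y)"
      using e4 le unfolding eq by (auto simp: max_def mult_ac split: if_splits)
    show "lin_abs P x * chart_norm y \<le> max (v (wedge x y) * lin_norm P) (lin_abs P y * chart_norm x) \<and>
       v (wedge x y) * lin_norm P \<le> max (lin_abs P y * chart_norm x) (lin_abs P x * chart_norm y)"
      using one two by (simp add: eq)
  qed
qed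

lemma berk_chord_nonneg: "P \<in> topspace P1 \<Longrightarrow> 0 \<le> berk_chord P x"
  using r_pos lin_norm_pos[of P] by (simp add: berk_chord_def lin_abs_nonneg chart_norm_nonneg)

lemma chord_commute: "chord x y = chord y x"
  using base.abs_minus[of "wedge x y"] by (simp add: chord_def mult.commute wedge_commute[of y x])

lemma berk_chord_triangle:
  assumes P: "P \<in> topspace P1" and nz: "x \<noteq> (0, 0)" "y \<noteq> (0, 0)"
  shows "berk_chord P x \<le> max (berk_chord P y) (chord x y)"
    and "chord x y \<le> max (berk_chord P x) (berk_chord P y)"
proof -
  define K where "K = r / (lin_norm P * chart_norm x * chart_norm y)"
  have nz': "lin_norm P \<noteq> 0" "chart_norm x \<noteq> 0" "chart_norm y \<noteq> 0"
    using lin_norm_pos[of P] chart_norm_pos[OF nz(1)] chart_norm_pos[OF nz(2)] by auto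
  have K: "0 \<le> K"
    using r_pos lin_norm_pos[of P] chart_norm_nonneg by (simp add: K_def)
  have eq: "berk_chord P x = K * (lin_abs P x * chart_norm y)"
    "berk_chord P y = K * (lin_abs P y * chart_norm x)" "chord x y = K * (v (wedge x y) * lin_norm P)"
    using nz' by (simp_all add: K_def berk_chord_def chord_def)
  show "berk_chord P x \<le> max (berk_chord P y) (chord x y)"
    unfolding eq using mult_left_mono[OF plucker_bounds(1)[OF P, of x y] K] K
    by (simp add: max_mult_distrib_left max.commute)
  show "chord x y \<le> max (berk_chord P x) (berk_chord P y)"
    unfolding eq using mult_left_mono[OF plucker_bounds(2)[OF P, of x y] K] K
    by (simp add: max_mult_distrib_left max.commute)
qed

lemma berk_chord_le_one:
  assumes P: "P \<in> topspace P1" shows "berk_chord P x \<le> 1"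
proof (cases "x = (0, 0)")
  case False
  have "r * lin_abs P x \<le> lin_norm P * chart_norm x"
    using P
  proof (cases rule: point_in_P1_cases)
    case 1
    then show ?thesis by (simp add: lin_abs_def lin_norm_def chart_norm_def)
  next
    case (2 p)
    let ?Z = "p (lin (a, 1))"
    have "lin x = Polynomial.smult (\<iota> (snd x)) (lin (a, 1)) - [:\<iota> (fst x - a * snd x):]"
      by (simp add: lin_def emb.diff emb_mult emb_one)
    then have "p (lin x) \<le> max (v (snd x) * ?Z) (v (fst x - a * snd x))"
      using compl.seminorm_diff_le_max[OF 2(2), of "Polynomial.smult (\<iota> (snd x)) (lin (a, 1))" "[:\<iota> (fst x - a * snd x):]"]
      by (simp add: compl.seminorm_smult[OF 2(2)] compl.seminorm_const[OF 2(2)] emb_abs)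
    from mult_left_mono[OF this, of r]
    have "r * p (lin x) \<le> max (r * (v (snd x) * ?Z)) (r * v (fst x - a * snd x))"
      using r_pos by (simp add: max_mult_distrib_left)
    moreover have "?Z * (r * v (snd x)) \<le> max ?Z r * chart_norm x"
      using compl.seminorm_nonneg[OF 2(2)] base.abs_nonneg r_pos
      by (intro mult_mono) (auto simp: chart_norm_def le_max_iff_disj)
    moreover have "r * v (fst x - a * snd x) \<le> max ?Z r * chart_norm x"
      using compl.seminorm_nonneg[OF 2(2)] base.abs_nonneg r_pos
      by (intro mult_mono) (auto simp: chart_norm_def le_max_iff_disj)
    ultimately show ?thesis
      by (simp add: 2 lin_abs_def lin_norm_def mult_ac max_def split: if_splits)
  qed
  then show ?thesis
    using lin_norm_pos[of P] chart_norm_pos[OF False] by (simp add: berk_chord_def)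
\<comment> \<open>The junk vector has \<open>chart_norm\<close> 0, and division by 0 gives
  0.\<close>
qed (use r_pos base.abs_zero in \<open>simp add: berk_chord_def chart_norm_def\<close>)

lemma berk_point_in_P1: "berk_point x \<in> topspace P1"
  unfolding berk_point_def classical_point_def compl.topspace_P1_Berk
  by (cases "point x") (auto simp: compl.mult_seminorm_eval)

lemma berk_chord_berk_point:
  assumes "y \<noteq> (0, 0)" shows "berk_chord (berk_point y) x = chord x y"
proof (cases "snd y = 0")
  case True
  then have "v (fst y) \<noteq> 0" using assms base.abs_eq_0_iff[of "fst y"] by (simp add: prod_eq_iff)
  moreover have "lin_abs (berk_point y) x = v (snd x)" "lin_norm (berk_point y) = 1"
    using True by (simp_all add: berk_point_def point_def classical_point_def lin_abs_def lin_norm_def)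
  moreover have "chart_norm y = v (fst y)" "v (wedge x y) = v (snd x) * v (fst y)"
    using True base.abs_nonneg[of "fst y"]
    by (simp_all add: chart_norm_def wedge_def base.abs_minus base.abs_mult)
  ultimately show ?thesis by (simp add: berk_chord_def chord_def)
next
  case False
  define c where "c = v (snd y)"
  have c: "0 < c" using False by (simp add: c_def base.abs_pos_iff)
  define z where "z = fst y / snd y"
  have y: "fst y = z * snd y" using False by (simp add: z_def)
  have pt: "point y = Some z" using False by (simp add: point_def z_def)
  have "lin_abs (berk_point y) x = w (\<iota> (snd x * z - fst x))"
    by (simp add: berk_point_def pt classical_point_def lin_abs_def lin_def emb.diff emb_mult algebra_simps)
  moreover have "v (wedge x y) = v (snd x * z - fst x) * c"
    unfolding c_def base.abs_mult[symmetric] wedge_def y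
    by (subst base.abs_minus[symmetric]) (simp add: algebra_simps)
  moreover have "lin_norm (berk_point y) = max (w (\<iota> (z - a))) r"
    by (simp add: berk_point_def pt classical_point_def lin_norm_def lin_def emb.diff emb_one)
  moreover have "chart_norm y = max (v (z - a)) r * c"
  proof -
    have "v (z * snd y - a * snd y) = v (z - a) * c"
      by (simp add: c_def flip: base.abs_mult left_diff_distrib)
    then show ?thesis using c by (simp add: chart_norm_def y max_mult_distrib_right flip: c_def)
  qed
  ultimately show ?thesis using c by (simp add: berk_chord_def chord_def emb_abs)
qed

lemma chord_le_one: "y \<noteq> (0, 0) \<Longrightarrow> chord x y \<le> 1"
  using berk_chord_le_one[OF berk_point_in_P1, of y x] by (simp add: berk_chord_berk_point)

text \<open>Open neighborhoods of infinity are complements of closed compact sets. The limit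
  condition confines the points with values outside a neighborhood of \<open>f None\<close> to a
  bounded set, and \<open>compactin_A1_bounded\<close> applies.\<close>

lemma continuous_map_P1I:
  assumes cont: "continuous_map (A1_Berk w) euclideanreal (\<lambda>p. f (Some p))"
    and lim: "\<And>e. 0 < e \<Longrightarrow> \<exists>R. \<forall>p. mult_seminorm w p \<and> R < p [:0, 1:] \<longrightarrow> \<bar>f (Some p) - f None\<bar> < e"
  shows "continuous_map P1 euclideanreal f"
  unfolding continuous_map_def
proof (intro conjI allI impI)
  fix S :: "real set" assume "openin euclideanreal S"
  then have S: "open S" by simp
  let ?O = "{p \<in> topspace (A1_Berk w). f (Some p) \<in> S}"
  have O: "openin (A1_Berk w) ?O"
    using cont S by (auto simp: continuous_map_def)
  show "openin P1 {P \<in> topspace P1. f P \<in> S}"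
  proof (cases "f None \<in> S")
    case False
    then have "{P \<in> topspace P1. f P \<in> S} = Some ` ?O"
      by (auto simp: compl.topspace_P1_Berk)
    then show ?thesis using O by (auto simp: P1_Berk_def)
  next
    case True
    define C where "C = topspace (A1_Berk w) - ?O"
    obtain e where e: "0 < e" "ball (f None) e \<subseteq> S"
      using S True openE by blast
    obtain R where R: "\<And>p. mult_seminorm w p \<Longrightarrow> R < p [:0, 1:] \<Longrightarrow> \<bar>f (Some p) - f None\<bar> < e"
      using lim[OF e(1)] by blast
    have C: "closedin (A1_Berk w) C" unfolding C_def using O by blast
    have "C \<subseteq> {p. mult_seminorm w p \<and> p [:0, 1:] \<le> R}"
    proof
      fix p assume p: "p \<in> C"
      then have "f (Some p) \<notin> S" "mult_seminorm w p" by (auto simp: C_def)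
      then have "\<not> R < p [:0, 1:]"
        using R[of p] e(2) by (auto simp: dist_real_def abs_minus_commute subset_iff)
      then show "p \<in> {p. mult_seminorm w p \<and> p [:0, 1:] \<le> R}"
        using \<open>mult_seminorm w p\<close> by simp
    qed
    then have "compactin (A1_Berk w) C"
      using closed_compactin[OF compl.compactin_A1_bounded _ C] by blast
    moreover have "{P \<in> topspace P1. f P \<in> S} = insert None (Some ` (topspace (A1_Berk w) - C))"
      using True by (auto simp: compl.topspace_P1_Berk C_def)
    ultimately show ?thesis
      using C unfolding P1_Berk_def openin_Alexandroff_compactification by blast
  qed
qed simp

lemma lin_eq: "lin x = Polynomial.smult (\<iota> (snd x)) [:0, 1:] - [:\<iota> (fst x):]"
  by (simp add: lin_def)

lemma continuous_berk_chord:
  assumes nz: "x \<noteq> (0, 0)" shows "continuous_map P1 euclideanreal (\<lambda>P. berk_chord P x)"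
proof (rule continuous_map_P1I)
  have "max (p (lin (a, 1))) r * chart_norm x \<noteq> 0" for p
    using r_pos chart_norm_pos[OF nz] by (simp add: max_def)
  then show "continuous_map (A1_Berk w) euclideanreal (\<lambda>p. berk_chord (Some p) x)"
    unfolding berk_chord_def lin_abs_def lin_norm_def option.case
    by (intro continuous_intros continuous_map_real_mult continuous_map_real_max
        continuous_map_real_divide compl.continuous_map_A1_eval) auto
next
  fix e :: real assume e: "0 < e"
  \<comment> \<open>Beyond \<open>v a\<close> and \<open>r\<close> the variable determines
    \<open>lin_norm\<close>; beyond the root of \<open>lin x\<close> the distance equals its limit
    exactly. The entry r / e serves \<open>snd x\<close> = 0, where the distance is r divided by the
    value at the variable.\<close>
  define R where "R = Max {v a, r, r / e, v (fst x / snd x)}"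
  have R: "v a \<le> R" "r \<le> R" "r / e \<le> R" "v (fst x / snd x) \<le> R"
    by (simp_all add: R_def)
  have "\<bar>berk_chord (Some p) x - berk_chord None x\<bar> < e"
    if S: "mult_seminorm w p" and big: "R < p [:0, 1:]" for p
  proof -
    let ?t = "p [:0, 1:]"
    have eval: "p (lin y) = v (snd y) * ?t" if "v (fst y) < v (snd y) * ?t" for y
    proof -
      have "p [:\<iota> (fst y):] < p (Polynomial.smult (\<iota> (snd y)) [:0, 1:])"
        using that by (simp only: compl.seminorm_smult[OF S] compl.seminorm_const[OF S] emb_abs)
      from compl.seminorm_diff_eq_left[OF S this] show ?thesis
        by (simp only: lin_eq compl.seminorm_smult[OF S] emb_abs)
    qed
    have "p (lin (a, 1)) = ?t" using eval[of "(a, 1)"] R big by (simp add: base.abs_one)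
    then have norm: "lin_norm (Some p) = ?t" using R big by (simp add: lin_norm_def)
    have t: "0 < ?t" using R(2) r_pos big by linarith
    show ?thesis
    proof (cases "snd x = 0")
      case True
      then have "chart_norm x = v (fst x)" "v (fst x) \<noteq> 0"
        using nz base.abs_nonneg[of "fst x"] base.abs_eq_0_iff[of "fst x"]
        by (auto simp: chart_norm_def prod_eq_iff)
      moreover have "p (lin x) = v (fst x)"
        using True compl.seminorm_const[OF S, of "- \<iota> (fst x)"] by (simp add: lin_def compl.abs_minus emb_abs)
      ultimately have "berk_chord (Some p) x = r / ?t"
        by (simp add: berk_chord_def lin_abs_def norm)
      moreover have "berk_chord None x = 0" using True by (simp add: berk_chord_def lin_abs_def)
      moreover have "r / e < ?t" using R(3) big by linarith
      then have "r / ?t < e" using e t by (simp add: field_simps)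
      ultimately show ?thesis using r_pos t by simp
    next
      case False
      then have "0 < v (snd x)" by (simp add: base.abs_pos_iff)
      then have "v (fst x) \<le> R * v (snd x)"
        using R(4) by (simp add: base.abs_divide field_simps)
      also have "\<dots> < ?t * v (snd x)"
        using big \<open>0 < v (snd x)\<close> by (rule mult_strict_right_mono)
      finally have "p (lin x) = v (snd x) * ?t"
        by (intro eval) (simp add: mult.commute)
      then have "berk_chord (Some p) x = berk_chord None x"
        using t by (simp add: berk_chord_def lin_abs_def norm) (simp add: lin_norm_def)
      then show ?thesis using e by simp
    qed
  qed
  then show "\<exists>R. \<forall>p. mult_seminorm w p \<and> R < p [:0, 1:] \<longrightarrow> \<bar>berk_chord (Some p) x - berk_chord None x\<bar> < e"
    by blast
qed

end

text \<open>In an ultrametric triangle the two longest sides agree. For t = c the side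
  \<open>A\<close> could still be shorter, which the last hypothesis excludes.\<close>

lemma ultrametric_equality:
  fixes A c t :: real
  assumes "A \<le> max t c" "c \<le> max t A" "t \<le> max c A" "t \<noteq> c \<or> t \<le> A"
  shows "A = max t c"
  using assms by (auto simp: max_def split: if_splits)

section \<open>Chordal distances determine points and topology\<close>

context nonarch_completion
begin

lemma emb_approx: "0 < e \<Longrightarrow> \<exists>b. w (c - \<iota> b) < e"
proof -
  assume e: "0 < e"
  interpret M: Metric_space UNIV "\<lambda>x y. w (x - y)" by (rule compl.Metric_space_abs)
  have "c \<in> M.mtopology closure_of range \<iota>" using dense by simp
  then show ?thesis using e by (auto simp: M.metric_closure_of M.in_mball)
qed

end

context berk_chart
begin

abbreviation gauss_point :: "'c berk" ("\<xi>") where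
  "gauss_point \<equiv> disk_point w (\<iota> a) r"

lemma poly_approx:
  assumes e: "0 < e"
  shows "\<exists>h'. Polynomial.degree h' \<le> Polynomial.degree h \<and>
    (\<forall>i. w (Polynomial.coeff (h - map_poly \<iota> h') i) < e)"
proof -
  obtain b where b: "\<And>c. w (c - \<iota> (b c)) < e" using emb_approx[OF e] by metis
  define h' where "h' = (\<Sum>i\<le>Polynomial.degree h. Polynomial.monom (b (Polynomial.coeff h i)) i)"
  have c: "Polynomial.coeff h' i = (if i \<le> Polynomial.degree h then b (Polynomial.coeff h i) else 0)" for i
    by (simp add: h'_def coeff_sum)
  have "Polynomial.degree h' \<le> Polynomial.degree h" by (intro degree_le) (simp add: c)
  moreover have "w (Polynomial.coeff (h - map_poly \<iota> h') i) < e" for i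
    using b[of "Polynomial.coeff h i"] e by (simp add: coeff_map_poly c coeff_eq_0)
  ultimately show ?thesis by blast
qed

text \<open>Polynomials over the algebraically closed field split, so agreement on z - x passes to
  them by multiplicativity. The others are approximated coefficientwise; the common value
  \<open>T\<close> at the variable bounds both errors by \<open>d * S\<close>.\<close>

lemma seminorm_eqI:
  assumes p: "mult_seminorm w p" and q: "mult_seminorm w q"
    and eq: "\<And>x. p [:- \<iota> x, 1:] = q [:- \<iota> x, 1:]"
  shows "p = q"
proof
  fix h :: "'c poly"
  have base_eq: "p (map_poly \<iota> h') = q (map_poly \<iota> h')" for h'
  proof (induction "Polynomial.degree h'" arbitrary: h' rule: less_induct)
    case less
    show ?case
    proof (cases "Polynomial.degree h' = 0")
      case True
      then obtain c where "h' = [:c:]" by (elim degree_eq_zeroE)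
      then have "map_poly \<iota> h' = [:\<iota> c:]" by (simp add: map_poly_pCons)
      then show ?thesis by (simp add: compl.seminorm_const p q)
    next
      case False
      then obtain x where "poly h' x = 0" using alg_closed_imp_poly_has_root by blast
      then obtain k where k: "h' = [:- x, 1:] * k" by (metis dvd_def poly_eq_0_iff_dvd)
      then have "k \<noteq> 0" using False by auto
      then have "Polynomial.degree k < Polynomial.degree h'"
        unfolding k by (subst degree_mult_eq) auto
      from less[OF this] show ?thesis
        by (simp only: k emb.map_poly_mult compl.seminorm_mult[OF p] compl.seminorm_mult[OF q])
          (simp add: map_poly_pCons emb.minus emb_one eq)
    qed
  qed
  define T where "T = p [:0, 1:]"
  have T: "q [:0, 1:] = T" using eq[of 0] by (simp add: T_def)
  have T0: "0 \<le> T" using compl.seminorm_nonneg[OF p] by (simp add: T_def)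
  define S where "S = (\<Sum>i\<le>Polynomial.degree h. T ^ i)"
  have S0: "0 \<le> S" unfolding S_def using T0 by (intro sum_nonneg) auto
  have "\<bar>p h - q h\<bar> \<le> e" if e: "0 < e" for e
  proof -
    define d where "d = e / (2 * (S + 1))"
    have d: "0 < d" using e S0 by (simp add: d_def)
    obtain h' where h': "Polynomial.degree h' \<le> Polynomial.degree h"
      "\<And>i. w (Polynomial.coeff (h - map_poly \<iota> h') i) < d"
      using poly_approx[OF d, of h] by blast
    let ?D = "h - map_poly \<iota> h'"
    have "Polynomial.degree ?D \<le> Polynomial.degree h"
      using h'(1) by (intro degree_diff_le) (simp_all add: emb.degree_map_poly)
    have bound: "s ?D \<le> d * S" if s: "mult_seminorm w s" "s [:0, 1:] = T" for s
    proof -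
      have "s ?D \<le> (\<Sum>i\<le>Polynomial.degree ?D. w (Polynomial.coeff ?D i) * T ^ i)"
        using compl.seminorm_le_sum[OF s(1), of ?D] s(2) by simp
      also have "\<dots> \<le> (\<Sum>i\<le>Polynomial.degree h. w (Polynomial.coeff ?D i) * T ^ i)"
        using \<open>Polynomial.degree ?D \<le> _\<close> T0 by (intro sum_mono2) (auto simp: compl.abs_nonneg)
      also have "\<dots> \<le> (\<Sum>i\<le>Polynomial.degree h. d * T ^ i)"
        by (intro sum_mono mult_right_mono[OF less_imp_le[OF h'(2)]]) (use T0 in simp)
      finally show ?thesis by (simp add: S_def sum_distrib_left)
    qed
    have "\<bar>p h - p (map_poly \<iota> h')\<bar> \<le> d * S" "\<bar>q h - q (map_poly \<iota> h')\<bar> \<le> d * S"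
      using compl.seminorm_abs_diff_le[OF p, of h "map_poly \<iota> h'"] bound[OF p]
        compl.seminorm_abs_diff_le[OF q, of h "map_poly \<iota> h'"] bound[OF q T] by (auto simp: T_def)
    then have "\<bar>p h - q h\<bar> \<le> 2 * (d * S)" using base_eq[of h'] by linarith
    also have "\<dots> \<le> e" using e S0 by (simp add: d_def field_simps)
    finally show ?thesis .
  qed
  then have "\<bar>p h - q h\<bar> \<le> 0" by (rule field_le_epsilon) simp
  then show "p h = q h" by simp
qed

text \<open>The distance to (1, 0) vanishes only at infinity and otherwise reveals
  \<open>lin_norm\<close>; the distances to (x, 1) then reveal the seminorm on each z - x.\<close>

lemma berk_chord_separates:
  assumes P: "P \<in> topspace P1" and Q: "Q \<in> topspace P1"
    and eq: "\<And>x. x \<noteq> (0, 0) \<Longrightarrow> berk_chord P x = berk_chord Q x"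
  shows "P = Q"
proof -
  have one: "p (lin (1, 0)) = 1" if "mult_seminorm w p" for p
    using compl.seminorm_const[OF that, of "- 1"] by (simp add: lin_def emb_one compl.abs_minus compl.abs_one)
  have infty: "berk_chord None (1, 0) = 0" by (simp add: berk_chord_def lin_abs_def)
  have N: "chart_norm (1, 0) = 1" by (simp add: chart_norm_def base.abs_one)
  have fin: "berk_chord (Some p) (1, 0) = r / lin_norm (Some p)" if "mult_seminorm w p" for p
    using one[OF that] N by (simp add: berk_chord_def lin_abs_def)
  from P Q show ?thesis
  proof (elim point_in_P1_cases, simp_all, goal_cases)
    case (1 q)
    then show ?case using eq[of "(1, 0)"] infty fin[of q] lin_norm_pos[of "Some q"] r_pos by simp
  next
    case (2 p)
    then show ?case using eq[of "(1, 0)"] infty fin[of p] lin_norm_pos[of "Some p"] r_pos by simp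
  next
    case (3 p q)
    have "r / lin_norm P = r / lin_norm Q"
      using eq[of "(1, 0)"] fin 3 by simp
    then have ln: "lin_norm P = lin_norm Q" using r_pos lin_norm_pos[of P] lin_norm_pos[of Q] by simp
    show ?case
    proof (rule seminorm_eqI)
      fix x
      have "lin_abs P (x, 1) = lin_abs Q (x, 1)"
        using eq[of "(x, 1)"] ln r_pos lin_norm_pos[of Q] chart_norm_pos[of "(x, 1)"]
        by (simp add: berk_chord_def)
      then show "p [:- \<iota> x, 1:] = q [:- \<iota> x, 1:]"
        using 3 by (simp add: lin_abs_def lin_def emb_one)
    qed (use 3 in auto)
  qed
qed

text \<open>The larger of the values at \<iota> a and \<iota> a + \<iota> c with v c = r reaches the
  norm. Such a c exists because the radius is a value.\<close>

lemma gauss_point_lin: "(SUP z\<in>{z. w (z - \<iota> a) \<le> r}. w (poly (lin x) z)) = chart_norm x"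
proof (rule antisym)
  have *: "poly (lin x) (\<iota> a + z) = \<iota> (snd x) * z - \<iota> (fst x - a * snd x)" for z
    by (simp add: lin_def emb.diff emb_mult algebra_simps)
  have le: "w (poly (lin x) z) \<le> chart_norm x" if "w (z - \<iota> a) \<le> r" for z
  proof -
    have "w (poly (lin x) z) \<le> max (v (snd x) * w (z - \<iota> a)) (v (fst x - a * snd x))"
      using *[of "z - \<iota> a"] compl.abs_diff_le_max[of "\<iota> (snd x) * (z - \<iota> a)" "\<iota> (fst x - a * snd x)"]
      by (simp add: compl.abs_mult emb_abs)
    also have "\<dots> \<le> chart_norm x"
      using mult_left_mono[OF that base.abs_nonneg[of "snd x"]]
      by (auto simp: chart_norm_def mult.commute le_max_iff_disj)
    finally show ?thesis .
  qed
  show "(SUP z\<in>{z. w (z - \<iota> a) \<le> r}. w (poly (lin x) z)) \<le> chart_norm x"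
    using le r_pos by (intro cSUP_least) (auto intro!: exI[of _ "\<iota> a"])
  have bdd: "bdd_above ((\<lambda>z. w (poly (lin x) z)) ` {z. w (z - \<iota> a) \<le> r})"
    using le by (intro bdd_aboveI2) auto
  have up: "w (poly (lin x) z) \<le> (SUP z\<in>{z. w (z - \<iota> a) \<le> r}. w (poly (lin x) z))"
    if "w (z - \<iota> a) \<le> r" for z
    using bdd that by (intro cSUP_upper) auto
  obtain c where c: "r = v c" using r by auto
  have 1: "v (fst x - a * snd x) \<le> (SUP z\<in>{z. w (z - \<iota> a) \<le> r}. w (poly (lin x) z))"
    using up[of "\<iota> a"] *[of 0] r_pos by (simp add: compl.abs_minus emb_abs)
  have "w (\<iota> (snd x) * \<iota> c - \<iota> (fst x - a * snd x)) \<le> (SUP z\<in>{z. w (z - \<iota> a) \<le> r}. w (poly (lin x) z))"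
    using up[of "\<iota> a + \<iota> c"] *[of "\<iota> c"] by (simp add: c emb_abs)
  then have "w (\<iota> (snd x) * \<iota> c) \<le> (SUP z\<in>{z. w (z - \<iota> a) \<le> r}. w (poly (lin x) z))"
    using 1 compl.abs_add_le_max[of "\<iota> (snd x) * \<iota> c - \<iota> (fst x - a * snd x)" "\<iota> (fst x - a * snd x)"]
    by (simp add: emb_abs)
  then have "r * v (snd x) \<le> (SUP z\<in>{z. w (z - \<iota> a) \<le> r}. w (poly (lin x) z))"
    by (simp add: compl.abs_mult emb_abs c mult.commute)
  with 1 show "chart_norm x \<le> (SUP z\<in>{z. w (z - \<iota> a) \<le> r}. w (poly (lin x) z))"
    by (simp add: chart_norm_def)
qed

lemma gauss_point_chord: "x \<noteq> (0, 0) \<Longrightarrow> berk_chord \<xi> x = 1"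
proof -
  assume x: "x \<noteq> (0, 0)"
  have "lin_norm \<xi> = r"
    using gauss_point_lin[of "(a, 1)"] r_pos
    by (simp add: lin_norm_def disk_point_def chart_norm_def base.abs_one)
  moreover have "lin_abs \<xi> x = chart_norm x"
    using gauss_point_lin[of x] by (simp add: lin_abs_def disk_point_def)
  ultimately show ?thesis using r_pos chart_norm_pos[OF x] by (simp add: berk_chord_def)
qed

lemma gauss_pointI:
  assumes "\<xi> \<in> topspace P1" "P \<in> topspace P1" "\<And>x. x \<noteq> (0, 0) \<Longrightarrow> berk_chord P x = 1"
  shows "P = \<xi>"
  using berk_chord_separates[OF assms(2,1)] assms(3) gauss_point_chord by simp

lemma openin_chord_preimage:
  assumes "continuous_map P1 P1 \<Psi>" "x \<noteq> (0, 0)" "open S"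
  shows "openin P1 {P \<in> topspace P1. berk_chord (\<Psi> P) x \<in> S}"
  using continuous_map_compose[OF assms(1) continuous_berk_chord[OF assms(2)]] assms(3)
  by (auto simp: continuous_map_def o_def)

lemma closedin_chord_preimage:
  assumes "continuous_map P1 P1 \<Psi>" "x \<noteq> (0, 0)" "closed S"
  shows "closedin P1 {P \<in> topspace P1. berk_chord (\<Psi> P) x \<in> S}"
  using closedin_continuous_map_preimage[OF continuous_map_compose[OF assms(1) continuous_berk_chord[OF assms(2)]], of S] assms(3)
  by (simp add: o_def)

lemma compact_space_P1: "compact_space P1"
  by (simp add: P1_Berk_def)

text \<open>If \<open>\<xi>\<close> were not in \<open>\<Psi> ` C\<close>, then finitely many residue classes would cover the compact set
  \<open>\<Psi> ` C\<close>.\<close>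

lemma gauss_point_in_image:
  assumes \<xi>: "\<xi> \<in> topspace P1" and cont: "continuous_map P1 P1 \<Psi>" and C: "closedin P1 C"
    and gen: "\<And>Xs. finite Xs \<Longrightarrow> (0, 0) \<notin> Xs \<Longrightarrow> \<exists>z\<in>C. \<forall>x\<in>Xs. berk_chord (\<Psi> z) x = 1"
  shows "\<xi> \<in> \<Psi> ` C"
proof (rule ccontr)
  assume no: "\<not> ?thesis"
  define W where "W x = {P \<in> topspace P1. berk_chord (\<Psi> P) x \<in> {..<1}}" for x
  have comp: "compactin P1 C"
    by (rule closedin_compact_space[OF compact_space_P1 C])
  have "C \<subseteq> \<Union> (W ` (- {(0, 0)}))"
  proof
    fix P assume P: "P \<in> C"
    then have PX: "P \<in> topspace P1" using C closedin_subset by blast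
    then have "\<Psi> P \<in> topspace P1" using cont by (auto simp: continuous_map_def)
    then obtain x where "x \<noteq> (0, 0)" "berk_chord (\<Psi> P) x \<noteq> 1"
      using gauss_pointI[OF \<xi>, of "\<Psi> P"] no P by (metis image_eqI)
    with berk_chord_le_one[OF \<open>\<Psi> P \<in> topspace P1\<close>, of x] show "P \<in> \<Union> (W ` (- {(0, 0)}))"
      using PX by (force simp: W_def)
  qed
  moreover have "\<forall>U\<in>W ` (- {(0, 0)}). openin P1 U"
    using openin_chord_preimage[OF cont, of _ "{..<1}"] by (auto simp: W_def)
  ultimately obtain F where F: "finite F" "F \<subseteq> W ` (- {(0, 0)})" "C \<subseteq> \<Union> F"
    using comp unfolding compactin_def by meson
  obtain Xs where Xs: "Xs \<subseteq> - {(0, 0)}" "finite Xs" "F = W ` Xs"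
    using finite_subset_image[OF F(1,2)] by blast
  obtain z where "z \<in> C" "\<forall>x\<in>Xs. berk_chord (\<Psi> z) x = 1"
    using gen[OF Xs(2)] Xs(1) by blast
  with F(3) Xs(3) show False by (auto simp: W_def)
qed

text \<open>The chordal distances are continuous and separate the points of a compact space, so they
  generate its topology.\<close>

lemma chord_basis:
  assumes P: "P \<in> U" and U: "openin P1 U"
  shows "\<exists>Xs e. finite Xs \<and> (0, 0) \<notin> Xs \<and> 0 < e \<and>
    (\<forall>Q\<in>topspace P1. (\<forall>x\<in>Xs. \<bar>berk_chord Q x - berk_chord P x\<bar> < e) \<longrightarrow> Q \<in> U)"
proof -
  have PX: "P \<in> topspace P1" using P U openin_subset by blast
  define C where "C = topspace P1 - U"
  define W where "W = (\<lambda>(x, n::nat). {Q \<in> topspace P1. berk_chord Q x \<in> {t. 1 / (real n + 1) < \<bar>t - berk_chord P x\<bar>}})"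
  have "closedin P1 C" using U by (auto simp: C_def)
  then have comp: "compactin P1 C"
    by (rule closedin_compact_space[OF compact_space_P1])
  have "C \<subseteq> \<Union> (W ` ((- {(0, 0)}) \<times> UNIV))"
  proof
    fix Q assume Q: "Q \<in> C"
    then have "Q \<in> topspace P1" "Q \<noteq> P" using P by (auto simp: C_def)
    then obtain x where x: "x \<noteq> (0, 0)" "berk_chord Q x \<noteq> berk_chord P x"
      using berk_chord_separates[OF _ PX] by blast
    then obtain n where "inverse (real (Suc n)) < \<bar>berk_chord Q x - berk_chord P x\<bar>"
      using reals_Archimedean[of "\<bar>berk_chord Q x - berk_chord P x\<bar>"] by auto
    then have "Q \<in> W (x, n)" using \<open>Q \<in> topspace P1\<close> by (simp add: W_def inverse_eq_divide add.commute)
    then show "Q \<in> \<Union> (W ` ((- {(0, 0)}) \<times> UNIV))" using x by blast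
  qed
  moreover have "openin P1 (W (x, n))" if "x \<noteq> (0, 0)" for x n
  proof -
    have "open {t. 1 / (real n + 1) < \<bar>t - berk_chord P x\<bar>}"
      by (intro open_Collect_less continuous_intros)
    from openin_chord_preimage[OF continuous_map_id[unfolded id_def] that this]
    show ?thesis by (simp add: W_def)
  qed
  then have "\<forall>V\<in>W ` ((- {(0, 0)}) \<times> UNIV). openin P1 V" by auto
  ultimately obtain F where F: "finite F" "F \<subseteq> W ` ((- {(0, 0)}) \<times> UNIV)" "C \<subseteq> \<Union> F"
    using comp unfolding compactin_def by meson
  obtain Y where Y: "Y \<subseteq> (- {(0, 0)}) \<times> UNIV" "finite Y" "F = W ` Y"
    using finite_subset_image[OF F(1,2)] by blast
  define e where "e = Min (insert 1 ((\<lambda>(x, n). 1 / (real n + 1)) ` Y))"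
  have "0 < e" using Y(2) by (auto simp: e_def)
  have e: "e \<le> 1 / (real n + 1)" if "(x, n) \<in> Y" for x n
    unfolding e_def using Y(2) that by (intro Min_le) (auto intro!: rev_image_eqI[of "(x, n)"])
  have "Q \<in> U" if Q: "Q \<in> topspace P1" "\<forall>x\<in>fst ` Y. \<bar>berk_chord Q x - berk_chord P x\<bar> < e" for Q
  proof (rule ccontr)
    assume "Q \<notin> U"
    then have "Q \<in> C" using Q by (simp add: C_def)
    then obtain x n where xn: "(x, n) \<in> Y" "Q \<in> W (x, n)" using F(3) Y(3) by auto
    then have "1 / (real n + 1) < \<bar>berk_chord Q x - berk_chord P x\<bar>" by (simp add: W_def)
    moreover have "\<bar>berk_chord Q x - berk_chord P x\<bar> < e" using Q(2) xn(1) by force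
    ultimately show False using e[OF xn(1)] by linarith
  qed
  moreover have "finite (fst ` Y)" "(0, 0) \<notin> fst ` Y" using Y by auto
  ultimately show ?thesis using \<open>0 < e\<close> by blast
qed

section \<open>Orthogonal bases and density of classical points\<close>

lemma chord_triangle:
  assumes "x \<noteq> (0, 0)" "y \<noteq> (0, 0)" "z \<noteq> (0, 0)"
  shows "chord x z \<le> max (chord x y) (chord y z)"
  using berk_chord_triangle(1)[OF berk_point_in_P1 assms(1,2), of z] assms
  by (simp add: berk_chord_berk_point max.commute)

text \<open>The upper bound is the ultrametric inequality. For the lower one, wedging with
  \<open>x\<close> and \<open>y\<close> isolates \<open>t\<close> and \<open>s\<close>, and chordal
  distances are at most 1.\<close>

lemma orthogonal_norm:
  assumes nz: "x \<noteq> (0, 0)" "y \<noteq> (0, 0)" and orth: "chord x y = 1"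
  shows "chart_norm (s * fst x + t * fst y, s * snd x + t * snd y) = max (v s * chart_norm x) (v t * chart_norm y)"
proof (rule antisym)
  let ?z = "(s * fst x + t * fst y, s * snd x + t * snd y)"
  have pos: "0 < chart_norm x" "0 < chart_norm y" using nz chart_norm_pos by auto
  have rw: "r * v (wedge x y) = chart_norm x * chart_norm y"
    using orth pos by (simp add: chord_def field_simps)
  have "fst ?z - a * snd ?z = s * (fst x - a * snd x) + t * (fst y - a * snd y)"
    by (simp add: algebra_simps)
  then have "v (fst ?z - a * snd ?z) \<le> max (v s * v (fst x - a * snd x)) (v t * v (fst y - a * snd y))"
    using base.abs_add_le_max[of "s * (fst x - a * snd x)" "t * (fst y - a * snd y)"] by (simp add: base.abs_mult)
  moreover have "r * v (snd ?z) \<le> r * max (v s * v (snd x)) (v t * v (snd y))"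
    using base.abs_add_le_max[of "s * snd x" "t * snd y"] r_pos by (simp add: base.abs_mult)
  moreover have "v s * v (fst x - a * snd x) \<le> v s * chart_norm x" "v t * v (fst y - a * snd y) \<le> v t * chart_norm y"
    "v s * (r * v (snd x)) \<le> v s * chart_norm x" "v t * (r * v (snd y)) \<le> v t * chart_norm y"
    by (auto simp: chart_norm_def base.abs_nonneg intro!: mult_left_mono)
  ultimately show "chart_norm ?z \<le> max (v s * chart_norm x) (v t * chart_norm y)"
    unfolding chart_norm_def[of ?z] by (auto simp: max_def mult_ac split: if_splits)
  have 1: "r * v (wedge x z) \<le> chart_norm x * chart_norm z" if "z \<noteq> (0, 0)" "x \<noteq> (0, 0)" for x z
    using chord_le_one[OF that(1), of x] chart_norm_pos[OF that(1)] chart_norm_pos[OF that(2)]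
    by (simp add: chord_def field_simps)
  have wz: "wedge x ?z = t * wedge x y" "wedge y ?z = - s * wedge x y"
    by (simp_all add: wedge_def algebra_simps)
  show "max (v s * chart_norm x) (v t * chart_norm y) \<le> chart_norm ?z"
  proof (cases "?z = (0, 0)")
    case True
    have "t * wedge x y = 0" "s * wedge x y = 0"
      using wz unfolding True by (simp_all add: wedge_def)
    moreover have "wedge x y \<noteq> 0" using rw pos by auto
    ultimately have "s = 0" "t = 0" by auto
    then show ?thesis by (simp add: chart_norm_nonneg)
  next
    case False
    have "r * (v t * v (wedge x y)) \<le> chart_norm x * chart_norm ?z"
      "r * (v s * v (wedge x y)) \<le> chart_norm y * chart_norm ?z"
      using 1[OF False nz(1)] 1[OF False nz(2)] unfolding wz by (simp_all add: base.abs_mult base.abs_minus)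
    then have "chart_norm x * (v t * chart_norm y) \<le> chart_norm x * chart_norm ?z"
      "chart_norm y * (v s * chart_norm x) \<le> chart_norm y * chart_norm ?z"
      using rw by (metis mult.left_commute, metis mult.left_commute mult.commute)
    then show ?thesis using pos by simp
  qed
qed

text \<open>(1, 0) and (a, 1) are at distance 1 from one another, so no vector is closer than 1 to
  both.\<close>

lemma exists_orthogonal:
  assumes "x \<noteq> (0, 0)" shows "\<exists>y. y \<noteq> (0, 0) \<and> chord x y = 1"
proof -
  have "chord (1, 0) (a, 1) = 1"
    using r_pos by (simp add: chord_def chart_norm_def wedge_def base.abs_one)
  then have "chord x (1, 0) = 1 \<or> chord x (a, 1) = 1"
    using chord_triangle[of "(1, 0)" x "(a, 1)"] assms chord_le_one[of "(1, 0)" x] chord_le_one[of "(a, 1)" x]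
    by (auto simp: chord_commute[of "(1, 0)" x])
  then show ?thesis by (metis prod.inject zero_neq_one)
qed

text \<open>A neighborhood prescribes finitely many distances up to \<open>e\<close>. If
  \<open>x1\<close> is among the nearest of these vectors to \<open>P\<close>, at distance
  \<open>s\<close>, then the distance of \<open>P\<close> to each of them is
  \<open>max s (chord x1 x)\<close>. A classical \<open>y\<close> at distance \<open>\<tau>\<close>
  from \<open>x1\<close>, with \<open>\<tau>\<close> close to \<open>s\<close>, reproduces them;
  nontriviality supplies such a \<open>\<tau>\<close>.\<close>

lemma berk_points_dense:
  assumes nontriv: "x0 \<noteq> 0" "v x0 \<noteq> 1" and U: "openin P1 U" "P \<in> U"
  shows "\<exists>y. y \<noteq> (0, 0) \<and> berk_point y \<in> U"
proof -
  have P: "P \<in> topspace P1" using U openin_subset by blast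
  obtain Xs e where Xs: "finite Xs" "(0, 0) \<notin> Xs" "0 < e"
    and "\<forall>Q\<in>topspace P1. (\<forall>x\<in>Xs. \<bar>berk_chord Q x - berk_chord P x\<bar> < e) \<longrightarrow> Q \<in> U"
    using chord_basis[OF U(2,1)] by (elim exE conjE)
  then have XU: "Q \<in> U" if "Q \<in> topspace P1" "\<And>x. x \<in> Xs \<Longrightarrow> \<bar>berk_chord Q x - berk_chord P x\<bar> < e" for Q
    using that by simp
  show ?thesis
  proof (cases "Xs = {}")
    case True
    then have "berk_point (1, 0) \<in> U" using XU[OF berk_point_in_P1] by blast
    then show ?thesis by (metis prod.inject zero_neq_one)
  next
    case False
    define s where "s = Min (berk_chord P ` Xs)"
    have "s \<in> berk_chord P ` Xs" unfolding s_def using Xs(1) False by (intro Min_in) auto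
    then obtain x1 where x1: "x1 \<in> Xs" "berk_chord P x1 = s" by auto
    have s: "s \<le> berk_chord P x" if "x \<in> Xs" for x unfolding s_def using Xs(1) that by simp
    have x1nz: "x1 \<noteq> (0, 0)" using x1 Xs(2) by metis
    have s01: "0 \<le> s" "s \<le> 1"
      using berk_chord_nonneg[OF P, of x1] berk_chord_le_one[OF P, of x1] x1 by auto
    obtain x2 where x2: "x2 \<noteq> (0, 0)" "chord x1 x2 = 1" using exists_orthogonal[OF x1nz] by blast
    define \<kappa> where "\<kappa> = chart_norm x1 / chart_norm x2"
    have N: "0 < chart_norm x1" "0 < chart_norm x2" using x1nz x2 chart_norm_pos by auto
    then have \<kappa>: "0 < \<kappa>" by (simp add: \<kappa>_def)
    \<comment> \<open>Distances never exceed 1, so the window for \<open>\<tau>\<close> lies above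
      \<open>s\<close> unless \<open>s\<close> = 1, when it ends at 1.\<close>
    obtain \<alpha> \<beta> where ab: "0 \<le> \<alpha>" "\<alpha> < \<beta>" "\<beta> \<le> 1" "s - e \<le> \<alpha>" "\<beta> \<le> s + e"
    proof (cases "s < 1")
      case True
      show ?thesis by (rule that[of s "min 1 (s + e)"]) (use True s01 Xs(3) in auto)
    next
      case False
      show ?thesis by (rule that[of "max 0 (1 - e)" 1]) (use False s01 Xs(3) in auto)
    qed
    \<comment> \<open>Avoiding these values keeps \<open>\<tau>\<close> different from each
      \<open>chord x1 x\<close>, so the third side of the triangle is determined. The factor
      \<open>\<kappa>\<close> converts distances from \<open>x1\<close> into absolute values of the
      coordinate \<open>t\<close>.\<close>
    obtain t where t: "\<alpha> * \<kappa> < v t" "v t < \<beta> * \<kappa>" "v t \<notin> (\<lambda>x. chord x1 x * \<kappa>) ` Xs"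
      using base.value_between_avoiding[OF nontriv, of "\<alpha> * \<kappa>" "\<beta> * \<kappa>" "(\<lambda>x. chord x1 x * \<kappa>) ` Xs"] ab \<kappa> Xs(1)
      by auto
    define \<tau> where "\<tau> = v t / \<kappa>"
    have \<tau>: "\<alpha> < \<tau>" "\<tau> < \<beta>" using t \<kappa> by (simp_all add: \<tau>_def field_simps)
    have \<tau>ne: "\<tau> \<noteq> chord x1 x" if "x \<in> Xs" for x
    proof
      assume "\<tau> = chord x1 x"
      then have "v t = chord x1 x * \<kappa>" using \<kappa> by (simp add: \<tau>_def field_simps)
      then show False using t(3) that by blast
    qed
    define y where "y = (1 * fst x1 + t * fst x2, 1 * snd x1 + t * snd x2)"
    have vt: "v t * chart_norm x2 = \<tau> * chart_norm x1" using N by (simp add: \<tau>_def \<kappa>_def)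
    have Ny: "chart_norm y = chart_norm x1"
      unfolding y_def orthogonal_norm[OF x1nz x2]
      using \<tau> ab N by (simp add: vt base.abs_one max_def)
    then have ynz: "y \<noteq> (0, 0)" using N by (auto simp: chart_norm_def)
    have "wedge x1 y = t * wedge x1 x2" by (simp add: y_def wedge_def algebra_simps)
    moreover have "r * v (wedge x1 x2) = chart_norm x1 * chart_norm x2"
      using x2(2) N by (simp add: chord_def field_simps)
    ultimately have "chord x1 y = v t * chart_norm x2 / chart_norm x1"
      using N by (simp add: chord_def Ny base.abs_mult field_simps)
    then have cy: "chord x1 y = \<tau>" using vt N by simp
    have "\<bar>berk_chord (berk_point y) x - berk_chord P x\<bar> < e" if x: "x \<in> Xs" for x
    proof -
      have xnz: "x \<noteq> (0, 0)" using x Xs(2) by metis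
      have P1': "berk_chord P x = max s (chord x1 x)"
        using berk_chord_triangle[OF P xnz x1nz] s[OF x] x1(2) chord_commute[of x x1]
        by (intro ultrametric_equality) (auto simp: max.commute)
      have "berk_chord (berk_point y) x = max \<tau> (chord x1 x)"
        unfolding berk_chord_berk_point[OF ynz]
        using chord_triangle[OF xnz x1nz ynz] chord_triangle[OF x1nz ynz xnz] chord_triangle[OF x1nz xnz ynz]
          cy \<tau>ne[OF x] chord_commute[of x x1] chord_commute[of x y]
        by (intro ultrametric_equality) (simp_all add: max.commute)
      moreover have "\<bar>\<tau> - s\<bar> < e" using \<tau> ab by linarith
      ultimately show ?thesis using Xs(3) unfolding P1' by (auto simp: max_def)
    qed
    then have "berk_point y \<in> U" using XU[OF berk_point_in_P1] by blast
    then show ?thesis using ynz by blast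
  qed
qed

end

section \<open>Components of the complement of the Gauss point\<close>

context berk_chart
begin

text \<open>The class of \<open>u\<close> is open and closed in the complement of \<xi>: any other
  point there has distance below 1 to some \<open>x\<close>, and the open class of that
  \<open>x\<close> is disjoint from the class of \<open>u\<close>.\<close>

lemma components_off_subset_class:
  assumes \<xi>: "\<xi> \<in> topspace P1" and U: "U \<in> components_off w \<xi>"
    and u: "u \<noteq> (0, 0)" "berk_point u \<in> U"
  shows "U \<subseteq> {P \<in> topspace P1. berk_chord P u < 1}"
proof -
  define Y where "Y = subtopology P1 (topspace P1 - {\<xi>})"
  define T where "T = {P \<in> topspace P1. berk_chord P u \<in> {..<1}}"
  have top: "topspace Y = topspace P1 - {\<xi>}" by (auto simp: Y_def)
  have op: "openin P1 {P \<in> topspace P1. berk_chord P x \<in> {..<1}}" if "x \<noteq> (0, 0)" for x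
    using openin_chord_preimage[OF continuous_map_id[unfolded id_def] that, of "{..<1}"] by simp
  have T\<xi>: "T \<subseteq> topspace P1 - {\<xi>}" using gauss_point_chord[OF u(1)] by (auto simp: T_def)
  have "openin Y T"
    using op[OF u(1)] T\<xi> unfolding Y_def T_def[symmetric] openin_subtopology by blast
  moreover have "openin Y (topspace Y - T)"
  proof (subst openin_subopen, intro ballI)
    fix P assume "P \<in> topspace Y - T"
    then have P: "P \<in> topspace P1" "P \<noteq> \<xi>" "\<not> berk_chord P u < 1" by (auto simp: top T_def)
    then obtain x where x: "x \<noteq> (0, 0)" "berk_chord P x \<noteq> 1" using gauss_pointI[OF \<xi> P(1)] by blast
    define S where "S = {Q \<in> topspace P1. berk_chord Q x \<in> {..<1}}"
    have PS: "P \<in> S" using P(1) x berk_chord_le_one[OF P(1), of x] by (auto simp: S_def)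
    have xu: "\<not> chord x u < 1"
      using berk_chord_triangle(1)[OF P(1) u(1) x(1)] P(3) PS chord_commute[of x u] by (auto simp: S_def)
    have "S \<subseteq> topspace P1 - {\<xi>}" using gauss_point_chord[OF x(1)] by (auto simp: S_def)
    moreover have "S \<inter> T = {}"
      using berk_chord_triangle(2)[OF _ x(1) u(1)] xu by (force simp: S_def T_def)
    moreover have "openin Y S"
      using op[OF x(1)] \<open>S \<subseteq> _\<close> unfolding Y_def S_def[symmetric] openin_subtopology by blast
    ultimately show "\<exists>S. openin Y S \<and> P \<in> S \<and> S \<subseteq> topspace Y - T"
      using PS by (intro exI[of _ S]) (auto simp: top)
  qed
  then have "closedin Y T" using T\<xi> top by (auto simp: closedin_def)
  moreover have "connectedin Y U"
    using U unfolding components_off_def Y_def[symmetric] by (rule connectedin_connected_components_of)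
  ultimately have "U \<subseteq> T \<or> disjnt U T" using connectedin_clopen_cases by blast
  moreover have "berk_point u \<in> T"
    using u r_pos chart_norm_pos[OF u(1)] by (simp add: T_def berk_point_in_P1 berk_chord_berk_point chord_def wedge_def)
  ultimately show ?thesis using u(2) by (auto simp: T_def disjnt_iff)
qed

definition disk_arc :: "'b \<Rightarrow> real set \<Rightarrow> 'c berk set" where
  "disk_arc b I = (\<lambda>t. Some (compl.disk_norm (\<iota> b) t)) ` I"

lemma connectedin_disk_arc:
  assumes "connected I" "I \<subseteq> {0..}" shows "connectedin P1 (disk_arc b I)"
proof -
  have "continuous_map (top_of_set I) (A1_Berk w) (compl.disk_norm (\<iota> b))"
    unfolding A1_Berk_def
  proof (rule continuous_map_into_subtopology)
    show "continuous_map (top_of_set I) (product_topology (\<lambda>_. euclideanreal) UNIV) (compl.disk_norm (\<iota> b))"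
      using continuous_on_subset[OF compl.continuous_disk_norm assms(2)]
      by (auto simp: continuous_map_componentwise_UNIV)
    show "compl.disk_norm (\<iota> b) \<in> topspace (top_of_set I) \<rightarrow> {p. mult_seminorm w p}"
      using assms(2) by (auto intro: compl.mult_seminorm_disk_norm)
  qed
  then have "continuous_map (top_of_set I) P1 (\<lambda>t. Some (compl.disk_norm (\<iota> b) t))"
    using continuous_map_compose[OF _ continuous_map_Some] by (simp add: P1_Berk_def o_def)
  moreover have "connectedin (top_of_set I) I"
    using assms(1) by (simp add: connectedin_subtopology)
  ultimately show ?thesis unfolding disk_arc_def by (rule connectedin_continuous_map_image)
qed

lemma berk_point_finite: "snd x \<noteq> 0 \<Longrightarrow> berk_point x = Some (compl.disk_norm (\<iota> (fst x / snd x)) 0)"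
  by (simp add: berk_point_def point_def classical_point_def compl.disk_norm_zero[abs_def])

lemma disk_norm_lin:
  assumes "0 \<le> t" shows "compl.disk_norm (\<iota> b) t (lin (x, 1)) = max (v (b - x)) t"
  using compl.disk_norm_linear[OF assms, of "\<iota> b" "\<iota> x"] by (simp add: lin_def emb_one emb_abs flip: emb.diff)

lemma disk_norm_eq_gauss_point:
  assumes "Some (compl.disk_norm (\<iota> b) t) = \<xi>" "0 \<le> t"
  shows "t = r" "v (b - a) \<le> r"
proof -
  have "compl.disk_norm (\<iota> b) t (lin x) = chart_norm x" for x
    using gauss_point_lin[of x] fun_cong[OF option.inject[THEN iffD1, OF assms(1)[unfolded disk_point_def]], of "lin x"]
    by simp
  then have *: "max (v (b - x)) t = max (v (x - a)) r" for x
    using disk_norm_lin[OF assms(2), of b x] by (simp add: chart_norm_def base.abs_one)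
  show "t = r" "v (b - a) \<le> r"
    using *[of a] *[of b] assms(2) r_pos by (auto simp: max_def split: if_splits)
qed

text \<open>The disks of radius v (b - c) about \<open>b\<close> and \<open>c\<close> coincide; here
  the two arcs of growing disks meet.\<close>

lemma disk_norm_join:
  assumes "t = v (b - c)" shows "compl.disk_norm (\<iota> b) t = compl.disk_norm (\<iota> c) t"
proof (rule seminorm_eqI)
  have t: "0 \<le> t" using assms base.abs_nonneg by simp
  show "mult_seminorm w (compl.disk_norm (\<iota> b) t)" "mult_seminorm w (compl.disk_norm (\<iota> c) t)"
    using t by (auto intro: compl.mult_seminorm_disk_norm)
  fix x
  have "v (b - x) \<le> max (v (b - c)) (v (c - x))" "v (c - x) \<le> max (v (b - x)) (v (b - c))"
    using base.abs_add_le_max[of "b - c" "c - x"] base.abs_diff_le_max[of "b - x" "b - c"] by simp_all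
  then have "max (v (b - x)) t = max (v (c - x)) t" using assms by auto
  then show "compl.disk_norm (\<iota> b) t [:- \<iota> x, 1:] = compl.disk_norm (\<iota> c) t [:- \<iota> x, 1:]"
    using disk_norm_lin[OF t, of b x] disk_norm_lin[OF t, of c x] by (simp add: lin_def emb_one)
qed

lemma None_in_closure_disk_arc: "None \<in> P1 closure_of disk_arc b {0..}"
  unfolding in_closure_of
proof (intro conjI allI impI)
  show "None \<in> topspace P1" by (simp add: compl.topspace_P1_Berk)
  fix T :: "'c berk set" assume "None \<in> T \<and> openin P1 T"
  then obtain C where C: "compactin (A1_Berk w) C" "T = insert None (Some ` (topspace (A1_Berk w) - C))"
    unfolding P1_Berk_def openin_Alexandroff_compactification by auto
  have "compactin euclideanreal ((\<lambda>p. p (lin (0, 1))) ` C)"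
    using image_compactin[OF C(1) compl.continuous_map_A1_eval] .
  then have "bdd_above ((\<lambda>p. p (lin (0, 1))) ` C)"
    by (simp add: compact_imp_bounded bounded_imp_bdd_above)
  then obtain B where B: "\<And>p. p \<in> C \<Longrightarrow> p (lin (0, 1)) \<le> B" by (auto simp: bdd_above_def)
  define t where "t = max 0 (B + 1)"
  have "compl.disk_norm (\<iota> b) t \<notin> C"
    using B[of "compl.disk_norm (\<iota> b) t"] disk_norm_lin[of t b 0] by (auto simp: t_def)
  moreover have "mult_seminorm w (compl.disk_norm (\<iota> b) t)"
    by (rule compl.mult_seminorm_disk_norm) (simp add: t_def)
  ultimately have "Some (compl.disk_norm (\<iota> b) t) \<in> T" using C(2) by simp
  moreover have "Some (compl.disk_norm (\<iota> b) t) \<in> disk_arc b {0..}"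
    by (auto simp: disk_arc_def t_def)
  ultimately show "\<exists>y. y \<in> disk_arc b {0..} \<and> y \<in> T" by blast
qed

lemma chord_finite:
  assumes "snd x \<noteq> 0" "snd y \<noteq> 0"
  shows "chord x y = r * v (fst x / snd x - fst y / snd y)
    / (max (v (fst x / snd x - a)) r * max (v (fst y / snd y - a)) r)"
proof -
  have N: "chart_norm x = v (snd x) * max (v (fst x / snd x - a)) r" if "snd x \<noteq> 0" for x
  proof -
    have "fst x - a * snd x = snd x * (fst x / snd x - a)" using that by (simp add: field_simps)
    then show ?thesis
      by (simp add: chart_norm_def base.abs_mult base.abs_nonneg max_mult_distrib_left mult.commute)
  qed
  have "wedge x y = snd x * snd y * (fst x / snd x - fst y / snd y)"
    using assms by (simp add: wedge_def field_simps)
  then show ?thesis using assms base.abs_pos_iff[of "snd x"] base.abs_pos_iff[of "snd y"]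
    by (simp add: chord_def N base.abs_mult)
qed

text \<open>The path enlarges a disk about one point until it contains the other and then shrinks it
  to the latter; towards infinity it enlarges forever. Meeting \<xi> on the way would make the
  chordal distance 1.\<close>

lemma class_connected:
  assumes nz: "x \<noteq> (0, 0)" "y \<noteq> (0, 0)" and less: "chord x y < 1"
  shows "\<exists>S. connectedin P1 S \<and> berk_point x \<in> S \<and> berk_point y \<in> S \<and> \<xi> \<notin> S"
proof -
  have ray: "\<exists>S. connectedin P1 S \<and> berk_point x \<in> S \<and> berk_point y \<in> S \<and> \<xi> \<notin> S"
    if x: "snd x = 0" and y: "snd y \<noteq> 0" and nz: "x \<noteq> (0, 0)" and less: "chord x y < 1" for x y
  proof -
    define b where "b = fst y / snd y"
    define S where "S = insert None (disk_arc b {0..})"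
    have "connectedin P1 S"
    proof (rule connectedin_intermediate_closure_of)
      show "connectedin P1 (disk_arc b {0..})" by (rule connectedin_disk_arc) auto
      then have "disk_arc b {0..} \<subseteq> P1 closure_of disk_arc b {0..}"
        by (intro closure_of_subset connectedin_subset_topspace)
      then show "S \<subseteq> P1 closure_of disk_arc b {0..}"
        using None_in_closure_disk_arc by (simp add: S_def)
    qed (auto simp: S_def)
    moreover have "berk_point x \<in> S" using x by (simp add: S_def berk_point_def point_def classical_point_def)
    moreover have "berk_point y \<in> S" using y by (auto simp: S_def disk_arc_def berk_point_finite b_def)
    moreover have "\<xi> \<notin> S"
    proof
      assume "\<xi> \<in> S"
      moreover have "\<xi> \<noteq> None" by (simp add: disk_point_def)
      ultimately obtain t where "0 \<le> t" "Some (compl.disk_norm (\<iota> b) t) = \<xi>"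
        by (auto simp: S_def disk_arc_def)
      then have b: "v (b - a) \<le> r" using disk_norm_eq_gauss_point by blast
      have "fst y - a * snd y = snd y * (b - a)" using y by (simp add: b_def field_simps)
      then have "v (fst y - a * snd y) \<le> r * v (snd y)"
        using mult_right_mono[OF b base.abs_nonneg[of "snd y"]] by (simp add: base.abs_mult mult.commute)
      then have Ny: "chart_norm y = r * v (snd y)" by (simp add: chart_norm_def)
      have fx: "0 < v (fst x)" using nz x by (simp add: base.abs_pos_iff prod_eq_iff)
      have "chord x y = r * (v (fst x) * v (snd y)) / (v (fst x) * (r * v (snd y)))"
        using x fx by (simp add: chord_def wedge_def base.abs_mult Ny) (simp add: chart_norm_def)
      also have "\<dots> = 1" using fx r_pos base.abs_pos_iff[of "snd y"] y by simp
      finally show False using less by simp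
    qed
    ultimately show ?thesis by blast
  qed
  consider "snd x = 0" "snd y = 0" | "snd x = 0" "snd y \<noteq> 0" | "snd x \<noteq> 0" "snd y = 0"
    | "snd x \<noteq> 0" "snd y \<noteq> 0" by blast
  then show ?thesis
  proof cases
    case 1
    have "connectedin P1 {None}" by (simp add: compl.topspace_P1_Berk)
    moreover have "\<xi> \<noteq> None" by (simp add: disk_point_def)
    ultimately show ?thesis
      using 1 by (intro exI[of _ "{None}"]) (auto simp: berk_point_def point_def classical_point_def)
  next
    case 2
    then show ?thesis using ray nz less by blast
  next
    case 3
    then show ?thesis using ray[of y x] nz less chord_commute by metis
  next
    case 4
    define b c R where "b = fst x / snd x" and "c = fst y / snd y" and "R = v (b - c)"
    define S where "S = disk_arc b {0..R} \<union> disk_arc c {0..R}"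
    have R: "0 \<le> R" by (simp add: R_def base.abs_nonneg)
    have "connectedin P1 S" unfolding S_def
    proof (rule connectedin_Un)
      show "connectedin P1 (disk_arc b {0..R})" "connectedin P1 (disk_arc c {0..R})"
        by (auto intro!: connectedin_disk_arc)
      have "Some (compl.disk_norm (\<iota> b) R) \<in> disk_arc b {0..R} \<inter> disk_arc c {0..R}"
        using R disk_norm_join[OF R_def] by (auto simp: disk_arc_def intro!: image_eqI[of _ _ R])
      then show "disk_arc b {0..R} \<inter> disk_arc c {0..R} \<noteq> {}" by blast
    qed
    moreover have "berk_point x \<in> S" "berk_point y \<in> S"
      using 4 R by (auto simp: S_def disk_arc_def berk_point_finite b_def c_def)
    moreover have "\<xi> \<notin> S"
    proof
      assume "\<xi> \<in> S"
      then consider t where "t \<in> {0..R}" "\<xi> = Some (compl.disk_norm (\<iota> b) t)"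
        | t where "t \<in> {0..R}" "\<xi> = Some (compl.disk_norm (\<iota> c) t)"
        unfolding S_def disk_arc_def by blast
      then have "(r \<le> R \<and> v (b - a) \<le> r) \<or> (r \<le> R \<and> v (c - a) \<le> r)"
      proof cases
        case (1 t)
        then show ?thesis using disk_norm_eq_gauss_point[OF 1(2)[symmetric]] by simp
      next
        case (2 t)
        then show ?thesis using disk_norm_eq_gauss_point[OF 2(2)[symmetric]] by simp
      qed
      moreover have "R \<le> max (v (b - a)) (v (c - a))" "v (b - a) \<le> max R (v (c - a))" "v (c - a) \<le> max R (v (b - a))"
        using base.abs_diff_le_max[of "b - a" "c - a"] base.abs_add_le_max[of "b - c" "c - a"]
          base.abs_diff_le_max[of "b - a" "b - c"] by (auto simp: R_def max.commute)
      \<comment> \<open>One of the two centers is in the disk of \<xi> and contributes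
        \<open>r\<close>; as \<open>r \<le> R\<close>, the other contributes
        \<open>R\<close>.\<close>
      ultimately have "max (v (b - a)) r * max (v (c - a)) r = r * R"
        by (auto simp: max_def mult.commute split: if_splits)
      moreover have "0 < max (v (b - a)) r * max (v (c - a)) r" using r_pos by (simp add: less_max_iff_disj)
      ultimately have "chord x y = 1"
        using chord_finite[OF 4] by (auto simp: b_def c_def R_def zero_less_mult_iff)
      then show False using less by simp
    qed
    ultimately show ?thesis by blast
  qed
qed

lemma chord_distinct_components:
  assumes \<xi>: "\<xi> \<in> topspace P1" and UV: "U \<in> components_off w \<xi>" "V \<in> components_off w \<xi>" "U \<noteq> V"
    and nz: "x \<noteq> (0, 0)" "y \<noteq> (0, 0)" and xy: "berk_point x \<in> U" "berk_point y \<in> V"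
  shows "chord x y = 1"
proof (rule ccontr)
  assume "chord x y \<noteq> 1"
  then have "chord x y < 1" using chord_le_one[OF nz(2), of x] by simp
  then obtain S where S: "connectedin P1 S" "berk_point x \<in> S" "berk_point y \<in> S" "\<xi> \<notin> S"
    using class_connected[OF nz] by blast
  define Y where "Y = subtopology P1 (topspace P1 - {\<xi>})"
  have "connectedin Y S"
    using S connectedin_subset_topspace[OF S(1)] by (auto simp: Y_def connectedin_subtopology)
  then have "S \<subseteq> U" "S \<subseteq> V"
    using UV(1,2) S(2,3) xy unfolding components_off_def Y_def[symmetric]
    by (meson connected_components_of_maximal disjnt_iff)+
  then have "\<not> disjnt U V" using S(2) by (auto simp: disjnt_iff)
  moreover have "pairwise disjnt (connected_components_of Y)" by (rule pairwise_disjoint_connected_components_of)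
  ultimately show False using UV unfolding components_off_def Y_def[symmetric] pairwise_def by blast
qed

end

section \<open>Totally invariant Gauss points\<close>

definition binary_form :: "nat \<Rightarrow> (nat \<Rightarrow> 'b::field) \<Rightarrow> 'b \<Rightarrow> 'b \<Rightarrow> 'b" where
  "binary_form d c s t = (\<Sum>i\<le>d. c i * s ^ i * t ^ (d - i))"

lemma binary_form_swap: "binary_form d (\<lambda>i. c (d - i)) s t = binary_form d c t s"
  unfolding binary_form_def
  by (rule sum.reindex_bij_witness[of _ "\<lambda>i. d - i" "\<lambda>i. d - i"]) (auto simp: mult_ac)

lemma binary_form_1_0: "binary_form d c 1 0 = c d"
  unfolding binary_form_def by (subst sum.remove[of _ d]) (auto simp: power_0_left)

lemma binary_form_0_1: "binary_form d c 0 1 = c 0"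
  unfolding binary_form_def by (subst sum.remove[of _ 0]) (auto simp: power_0_left)

definition form_poly :: "nat \<Rightarrow> (nat \<Rightarrow> 'b::field) \<Rightarrow> 'b poly" where
  "form_poly d c = (\<Sum>i\<le>d. Polynomial.monom (c i) i)"

lemma coeff_form_poly: "Polynomial.coeff (form_poly d c) i = (if i \<le> d then c i else 0)"
  by (simp add: form_poly_def coeff_sum)

lemma poly_form_poly: "poly (form_poly d c) s = binary_form d c s 1"
  by (simp add: form_poly_def binary_form_def poly_sum poly_monom)

locale chart_basis = berk_chart v w \<iota> a r
  for v :: "'b::alg_closed_field \<Rightarrow> real" and w :: "'c::field \<Rightarrow> real" and \<iota> a r +
  fixes u u' :: "'b \<times> 'b"
  assumes nz: "u \<noteq> (0, 0)" "u' \<noteq> (0, 0)" and orth: "chord u u' = 1"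
begin

definition comb :: "'b \<Rightarrow> 'b \<Rightarrow> 'b \<times> 'b" where
  "comb s t = (s * fst u + t * fst u', s * snd u + t * snd u')"

definition \<rho> :: real where "\<rho> = chart_norm u' / chart_norm u"

lemma norms_pos: "0 < chart_norm u" "0 < chart_norm u'"
  using nz chart_norm_pos by auto

lemma \<rho>_pos: "0 < \<rho>"
  using norms_pos by (simp add: \<rho>_def)

lemma norm_u': "chart_norm u' = \<rho> * chart_norm u"
  using norms_pos by (simp add: \<rho>_def)

lemma comb_1_0: "comb 1 0 = u" and comb_0_1: "comb 0 1 = u'"
  by (simp_all add: comb_def)

lemma wedge_basis: "r * v (wedge u u') = \<rho> * chart_norm u ^ 2" "wedge u u' \<noteq> 0"
proof -
  show "r * v (wedge u u') = \<rho> * chart_norm u ^ 2"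
    using orth norms_pos by (simp add: chord_def norm_u' field_simps power2_eq_square)
  with \<rho>_pos norms_pos show "wedge u u' \<noteq> 0" by auto
qed

lemma norm_comb: "chart_norm (comb s t) = chart_norm u * max (v s) (\<rho> * v t)"
  using norms_pos unfolding comb_def orthogonal_norm[OF nz orth]
  by (simp add: norm_u' max_mult_distrib_left mult_ac)

lemma comb_nz: "s \<noteq> 0 \<or> t \<noteq> 0 \<Longrightarrow> comb s t \<noteq> (0, 0)"
proof
  assume st: "s \<noteq> 0 \<or> t \<noteq> 0" and "comb s t = (0, 0)"
  then have "chart_norm (comb s t) = 0" by (simp add: chart_norm_def)
  moreover have "0 < max (v s) (\<rho> * v t)"
    using st \<rho>_pos base.abs_pos_iff by (auto simp: less_max_iff_disj)
  ultimately show False using norms_pos by (simp add: norm_comb)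
qed

lemma comb_exists: "\<exists>s t. x = comb s t"
proof -
  have "x = comb (wedge x u' / wedge u u') (wedge u x / wedge u u')"
    using wedge_basis(2) by (simp add: comb_def prod_eq_iff divide_simps) (simp add: wedge_def algebra_simps)
  then show ?thesis by blast
qed

lemma chord_comb:
  "chord (comb s t) (comb s' t') = \<rho> * v (s * t' - t * s') / (max (v s) (\<rho> * v t) * max (v s') (\<rho> * v t'))"
proof -
  have "wedge (comb s t) (comb s' t') = (s * t' - t * s') * wedge u u'"
    by (simp add: comb_def wedge_def algebra_simps)
  then have "r * v (wedge (comb s t) (comb s' t')) = v (s * t' - t * s') * (r * v (wedge u u'))"
    by (simp add: base.abs_mult)
  then show ?thesis
    using norms_pos by (simp add: chord_def norm_comb wedge_basis(1) field_simps power2_eq_square)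
qed

lemma chord_comb_u: "chord (comb s t) u = \<rho> * v t / max (v s) (\<rho> * v t)"
  using chord_comb[of s t 1 0] base.abs_minus[of t] by (simp add: comb_1_0 base.abs_one)

lemma chord_comb_u': "chord (comb s t) u' = v s / max (v s) (\<rho> * v t)"
  using chord_comb[of s t 0 1] \<rho>_pos by (simp add: comb_0_1 base.abs_one)

lemma comb_scale:
  assumes "c \<noteq> 0" shows "berk_point (comb (c * s) (c * t)) = berk_point (comb s t)"
proof -
  have "fst (comb (c * s) (c * t)) = c * fst (comb s t)" "snd (comb (c * s) (c * t)) = c * snd (comb s t)"
    by (simp_all add: comb_def algebra_simps)
  then show ?thesis using assms by (simp add: berk_point_def point_def)
qed

lemma \<rho>_value: "\<exists>c. c \<noteq> 0 \<and> v c = \<rho>"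
proof -
  obtain e where e: "r = v e" using r by auto
  have N: "\<exists>c. chart_norm x = v c" for x
  proof (cases "v (fst x - a * snd x) \<le> v (e * snd x)")
    case True
    then show ?thesis
      by (intro exI[of _ "e * snd x"]) (simp add: chart_norm_def e[symmetric] base.abs_mult)
  next
    case False
    then show ?thesis
      by (intro exI[of _ "fst x - a * snd x"]) (simp add: chart_norm_def e[symmetric] base.abs_mult)
  qed
  obtain c c' where "chart_norm u = v c" "chart_norm u' = v c'" using N[of u] N[of u'] by blast
  then have "v (c' / c) = \<rho>" by (simp add: \<rho>_def base.abs_divide)
  then show ?thesis using \<rho>_pos by (intro exI[of _ "c' / c"]) auto
qed

text \<open>When v s = \<rho>, \<open>comb s 1\<close> is at distance 1 from a vector as soon as
  \<open>s\<close> is at least \<rho> away from its affine coordinate. Finitely many classes, and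
  the extra points \<open>B\<close>, are avoided at once.\<close>

lemma exists_generic_comb:
  assumes "finite Xs" "(0, 0) \<notin> Xs" "finite B"
  shows "\<exists>s. v s = \<rho> \<and> (\<forall>b\<in>B. \<rho> \<le> v (s - b)) \<and> (\<forall>x\<in>Xs. chord (comb s 1) x = 1)"
proof -
  obtain c where c: "c \<noteq> 0" "v c = \<rho>" using \<rho>_value by blast
  obtain S T where ST: "\<And>x. x = comb (S x) (T x)" using comb_exists by metis
  \<comment> \<open>A vector with \<open>T x\<close> = 0 has no affine coordinate; the quotient is
    then 0, and v s = \<rho> alone gives distance 1.\<close>
  obtain s where s: "v s = \<rho>" "\<forall>b\<in>B \<union> (\<lambda>x. S x / T x) ` Xs. \<rho> \<le> v (s - b)"
    using base.exists_generic[of "B \<union> (\<lambda>x. S x / T x) ` Xs" c] assms c by auto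
  have "chord (comb s 1) x = 1" if x: "x \<in> Xs" for x
  proof -
    define s' t' where "s' = S x" and "t' = T x"
    have xc: "x = comb s' t'" unfolding s'_def t'_def by (rule ST)
    have ne: "s' \<noteq> 0 \<or> t' \<noteq> 0" using xc x assms(2) by (auto simp: comb_def)
    have eq: "chord (comb s 1) x = v (s * t' - s') / max (v s') (\<rho> * v t')"
      using \<rho>_pos unfolding xc chord_comb by (simp add: s(1) base.abs_one)
    show ?thesis
    proof (cases "t' = 0")
      case True
      then show ?thesis using ne base.abs_pos_iff[of s'] by (simp add: eq base.abs_minus)
    next
      case False
      define b where "b = s' / t'"
      have "\<rho> \<le> v (s - b)" using s(2) x by (auto simp: b_def s'_def t'_def)
      then have sb: "v (s - b) = max (v b) \<rho>"
        using base.abs_diff_le_max[of s b] base.abs_diff_le_max[of s "s - b"] s(1) by simp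
      have s': "s' = b * t'" using False by (simp add: b_def)
      have "v (s * t' - s') = max (v b) \<rho> * v t'"
        unfolding s' sb[symmetric] by (simp flip: base.abs_mult left_diff_distrib)
      moreover have "max (v s') (\<rho> * v t') = max (v b) \<rho> * v t'"
        by (simp add: s' base.abs_mult base.abs_nonneg max_mult_distrib_right)
      moreover have "0 < max (v b) \<rho> * v t'"
        using False \<rho>_pos by (simp add: base.abs_pos_iff less_max_iff_disj)
      ultimately show ?thesis unfolding eq by (metis divide_self_if less_irrefl)
    qed
  qed
  then show ?thesis using s by blast
qed

end

locale berk_forms = chart_basis v w \<iota> a r u u'
  for v :: "'b::alg_closed_field \<Rightarrow> real" and w :: "'c::field \<Rightarrow> real" and \<iota> a r u u' +
  fixes \<phi> :: "'b \<times> 'b \<Rightarrow> 'b \<times> 'b" and \<Phi> :: "'c berk \<Rightarrow> 'c berk"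
    and d :: nat and P Q :: "nat \<Rightarrow> 'b"
  assumes gauss_in_P1: "\<xi> \<in> topspace P1"
    and cont: "continuous_map P1 P1 \<Phi>"
    and total: "totally_invariant w \<Phi> \<xi>"
    and \<Phi>_berk_point: "\<And>x. x \<noteq> (0, 0) \<Longrightarrow> \<Phi> (berk_point x) = berk_point (\<phi> x)"
    and \<phi>_nz: "\<And>x. x \<noteq> (0, 0) \<Longrightarrow> \<phi> x \<noteq> (0, 0)"
    and \<phi>_comb: "\<And>s t. \<phi> (comb s t) = comb (binary_form d P s t) (binary_form d Q s t)"
begin

text \<open>Exchanging the basis vectors reverses the coefficients and exchanges \<open>P\<close>
  with \<open>Q\<close>, so results about \<open>u\<close> transfer to \<open>u'\<close>.\<close>

lemma swapped: "berk_forms v w \<iota> a r u' u \<phi> \<Phi> d (\<lambda>i. Q (d - i)) (\<lambda>i. P (d - i))"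
proof -
  interpret S: chart_basis v w \<iota> a r u' u
    by unfold_locales (use nz orth chord_commute in auto)
  have "S.comb s t = comb t s" for s t by (simp add: S.comb_def comb_def add.commute)
  then show ?thesis
    by unfold_locales (use gauss_in_P1 cont total \<Phi>_berk_point \<phi>_nz \<phi>_comb in \<open>auto simp: binary_form_swap\<close>)
qed

lemma \<Phi>_gauss: "\<Phi> \<xi> = \<xi>"
  using total by (auto simp: totally_invariant_def)

lemma \<Phi>_gauss_iff: "p \<in> topspace P1 \<Longrightarrow> \<Phi> p = \<xi> \<Longrightarrow> p = \<xi>"
  using total by (auto simp: totally_invariant_def)

text \<open>Up to a common factor, these are the absolute values of the coefficients of the map in the
  coordinate that turns \<open>\<xi>\<close> into the Gauss point of the unit disk.\<close>

definition Pw :: "nat \<Rightarrow> real" where "Pw i = v (P i) * \<rho> ^ i"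
definition Qw :: "nat \<Rightarrow> real" where "Qw i = \<rho> * v (Q i) * \<rho> ^ i"

lemma weights_nonneg: "0 \<le> Pw i" "0 \<le> Qw i"
  using \<rho>_pos base.abs_nonneg by (simp_all add: Pw_def Qw_def)

text \<open>Otherwise the reduction would be the constant \<open>u\<close>, and \<open>\<Phi> \<xi>\<close> would be in the class of \<open>u\<close>.\<close>

lemma Qw_dominates: "\<exists>j\<le>d. \<forall>i\<le>d. Pw i \<le> Qw j \<and> Qw i \<le> Qw j"
proof (rule ccontr)
  assume no: "\<not> ?thesis"
  have "Max (Pw ` {..d}) \<in> Pw ` {..d}" by (rule Max_in) auto
  then obtain i0 where i0: "Max (Pw ` {..d}) = Pw i0" "i0 \<in> {..d}" by (rule imageE)
  have "Max (Qw ` {..d}) \<in> Qw ` {..d}" by (rule Max_in) auto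
  then obtain j0 where j0: "Max (Qw ` {..d}) = Qw j0" "j0 \<in> {..d}" by (rule imageE)
  have P0: "Pw i \<le> Pw i0" and Q0: "Qw i \<le> Qw j0" if "i \<le> d" for i
    using that i0 j0 by (metis Max_ge atMost_iff finite_atMost finite_imageI imageI)+
  have less: "Qw j0 < Pw i0"
  proof (rule ccontr)
    assume "\<not> ?thesis"
    then have "\<forall>i\<le>d. Pw i \<le> Qw j0 \<and> Qw i \<le> Qw j0" using P0 Q0 by force
    then show False using no j0(2) by blast
  qed
  define \<sigma> where "\<sigma> = Qw j0 / Pw i0"
  have P_pos: "0 < Pw i0" using less weights_nonneg(2)[of j0] by linarith
  have \<sigma>: "\<sigma> < 1" using less P_pos by (simp add: \<sigma>_def)
  define C where "C = {p \<in> topspace P1. berk_chord (\<Phi> p) u \<in> {..\<sigma>}}"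
  \<comment> \<open>The map is the identity here: generic classical points lie in the closed set
    \<open>C\<close>, hence so does \<xi>, although \<xi> is fixed and at distance 1 from
    \<open>u\<close>.\<close>
  have "\<xi> \<in> (\<lambda>p. p) ` C"
  proof (rule gauss_point_in_image)
    show "closedin P1 C" unfolding C_def by (rule closedin_chord_preimage[OF cont nz(1)]) simp
  next
    fix Xs :: "('b \<times> 'b) set" assume Xs: "finite Xs" "(0, 0) \<notin> Xs"
    let ?p = "form_poly d P"
    have "P i0 \<noteq> 0" using P_pos by (auto simp: Pw_def)
    then have p: "?p \<noteq> 0" using i0(2) by (metis atMost_iff coeff_form_poly coeff_0)
    \<comment> \<open>Keeping \<open>s\<close> off the classes of the roots of the first form makes
      its value at \<open>s\<close> at least \<open>Pw i0\<close>.\<close>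
    obtain s where s: "v s = \<rho>" "\<forall>b\<in>{z. poly ?p z = 0}. \<rho> \<le> v (s - b)" "\<forall>x\<in>Xs. chord (comb s 1) x = 1"
      using exists_generic_comb[OF Xs, of "{z. poly ?p z = 0}"] poly_roots_finite[OF p] by blast
    define S T where "S = binary_form d P s 1" and "T = binary_form d Q s 1"
    have "v (Polynomial.coeff ?p i0) * v s ^ i0 \<le> v (poly ?p s)"
      by (rule base.abs_coeff_le_poly[OF p]) (use s in auto)
    then have S: "Pw i0 \<le> v S"
      using i0(2) by (simp add: coeff_form_poly poly_form_poly s(1) Pw_def S_def)
    have "v T \<le> Qw j0 / \<rho>" unfolding T_def binary_form_def
    proof (rule base.abs_sum_le)
      fix i assume "i \<in> {..d}"
      then show "v (Q i * s ^ i * 1 ^ (d - i)) \<le> Qw j0 / \<rho>"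
        using Q0[of i] \<rho>_pos by (simp add: base.abs_mult base.abs_power s(1) Qw_def field_simps)
    qed (use weights_nonneg \<rho>_pos in simp)
    then have T: "\<rho> * v T \<le> Qw j0" using \<rho>_pos by (simp add: field_simps)
    have st: "comb s 1 \<noteq> (0, 0)" by (rule comb_nz) simp
    have "berk_chord (\<Phi> (berk_point (comb s 1))) u = chord (comb S T) u"
      using \<Phi>_berk_point[OF st] berk_chord_berk_point[OF \<phi>_nz[OF st]] chord_commute
      by (simp add: \<phi>_comb S_def T_def)
    also have "\<dots> = \<rho> * v T / v S" using S T less by (simp add: chord_comb_u)
    also have "\<dots> \<le> \<sigma>" unfolding \<sigma>_def using S T P_pos \<rho>_pos base.abs_nonneg
      by (intro frac_le) (auto intro: weights_nonneg)
    finally have "berk_point (comb s 1) \<in> C" by (simp add: C_def berk_point_in_P1)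
    moreover have "berk_chord (berk_point (comb s 1)) x = 1" if "x \<in> Xs" for x
      using s(3) that chord_commute by (simp add: berk_chord_berk_point[OF st])
    ultimately show "\<exists>z\<in>C. \<forall>x\<in>Xs. berk_chord z x = 1" by blast
  qed (use gauss_in_P1 in auto)
  then show False using \<sigma> gauss_point_chord[OF nz(1)] by (auto simp: C_def \<Phi>_gauss)
qed

text \<open>Otherwise generic values \<open>e\<close> are taken near \<open>u\<close>: the leading coefficient of \<open>P - e Q\<close> is small
  compared with another one, so \<open>P - e Q\<close> has a root of absolute value at least \<open>\<rho> \<tau>\<close>, with \<open>\<tau> > 1\<close>
  independent of \<open>e\<close>.\<close>

lemma top_weight_dominates:
  assumes top: "Qw d < Pw d"
  shows "\<forall>i\<le>d. Pw i \<le> Pw d \<and> Qw i \<le> Pw d"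
proof -
  obtain j where j: "j \<le> d" "\<And>i. i \<le> d \<Longrightarrow> Pw i \<le> Qw j \<and> Qw i \<le> Qw j"
    using Qw_dominates by blast
  have "Qw j \<le> Pw d"
  proof (rule ccontr)
    assume "\<not> ?thesis"
    then have less: "Pw d < Qw j" by simp
    have P_pos: "0 < Pw d" using top weights_nonneg(2)[of d] by linarith
    define y where "y = Qw j / Pw d"
    have y: "1 < y" using less P_pos by (simp add: y_def)
    \<comment> \<open>The exponent 1 / (d + 1) keeps \<tau>^d below \<open>y\<close>, hence
      \<open>\<tau> ^ d * Pw d\<close> below \<open>Qw j\<close>.\<close>
    define \<tau> where "\<tau> = y powr (1 / (real d + 1))"
    have \<tau>: "1 < \<tau>" using y by (simp add: \<tau>_def)
    have "\<tau> ^ d = y powr (real d / (real d + 1))"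
      using y by (simp add: \<tau>_def powr_powr flip: powr_realpow)
    also have "\<dots> < y powr 1" using y by (intro powr_less_mono) auto
    finally have \<tau>d: "\<tau> ^ d * Pw d < Qw j" using y P_pos by (simp add: y_def field_simps)
    define C where "C = {p \<in> topspace P1. berk_chord p u \<in> {..1 / \<tau>}}"
    have "\<xi> \<in> \<Phi> ` C"
    proof (rule gauss_point_in_image[OF gauss_in_P1 cont])
      show "closedin P1 C" unfolding C_def
        using closedin_chord_preimage[OF continuous_map_id[unfolded id_def] nz(1), of "{..1 / \<tau>}"] by simp
    next
      fix Xs :: "('b \<times> 'b) set" assume Xs: "finite Xs" "(0, 0) \<notin> Xs"
      \<comment> \<open>The class of P j / Q j is avoided so that no cancellation makes coefficient
        \<open>j\<close> of P - e Q small. Coefficient \<open>d\<close> keeps the size of P d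
        because \<open>Qw d < Pw d\<close>.\<close>
      obtain e where e: "v e = \<rho>" "\<rho> \<le> v (e - P j / Q j)" "\<forall>x\<in>Xs. chord (comb e 1) x = 1"
        using exists_generic_comb[OF Xs, of "{P j / Q j}"] by auto
      define H where "H = form_poly d (\<lambda>i. P i - e * Q i)"
      have "0 < Qw j" using P_pos less by linarith
      then have Qj: "Q j \<noteq> 0" by (auto simp: Qw_def)
      have Hd: "v (P d - e * Q d) = v (P d)"
      proof -
        have "v (e * Q d) < v (P d)"
          using top \<rho>_pos by (simp add: Pw_def Qw_def base.abs_mult e(1))
        then show ?thesis
          using base.abs_diff_eq_right[of "e * Q d" "P d"] base.abs_diff_commute[of "e * Q d"] by simp
      qed
      have Hj: "Qw j \<le> v (P j - e * Q j) * \<rho> ^ j"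
      proof -
        have "P j - e * Q j = - (Q j * (e - P j / Q j))" using Qj by (simp add: field_simps)
        then have "v (P j - e * Q j) = v (Q j) * v (e - P j / Q j)"
          by (simp only: base.abs_minus base.abs_mult)
        then have "\<rho> * v (Q j) \<le> v (P j - e * Q j)"
          using mult_left_mono[OF e(2) base.abs_nonneg[of "Q j"]] by (simp add: mult.commute)
        then show ?thesis using \<rho>_pos by (simp add: Qw_def mult_right_mono)
      qed
      have "P d - e * Q d \<noteq> 0" using Hd P_pos by (auto simp: Pw_def)
      then have degH: "Polynomial.degree H = d" "H \<noteq> 0"
        by (auto simp: H_def coeff_form_poly intro!: antisym degree_le le_degree dest: arg_cong[of _ _ "\<lambda>p. Polynomial.coeff p d"])
      obtain z where z: "poly H z = 0" "\<rho> * \<tau> < v z"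
      proof (rule ccontr)
        assume "\<not> thesis"
        with that have small: "v z \<le> \<rho> * \<tau>" if "poly H z = 0" for z using \<open>poly H z = 0\<close> by force
        have "v (Polynomial.coeff H j) * (\<rho> * \<tau>) ^ j \<le> v (Polynomial.coeff H d) * (\<rho> * \<tau>) ^ d"
          using base.abs_coeff_le_lead_coeff[OF degH(2), of "\<rho> * \<tau>" j] small \<rho>_pos \<tau> degH(1) by simp
        then have *: "(v (P j - e * Q j) * \<rho> ^ j) * \<tau> ^ j \<le> Pw d * \<tau> ^ d"
          using j(1) Hd by (simp add: H_def coeff_form_poly power_mult_distrib Pw_def mult_ac)
        have "Qw j \<le> v (P j - e * Q j) * \<rho> ^ j" by (rule Hj)
        also have "\<dots> \<le> (v (P j - e * Q j) * \<rho> ^ j) * \<tau> ^ j"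
          using mult_left_mono[OF one_le_power[OF less_imp_le[OF \<tau>], of j], of "v (P j - e * Q j) * \<rho> ^ j"]
            \<rho>_pos base.abs_nonneg[of "P j - e * Q j"] by simp
        also note *
        finally show False using \<tau>d by (simp add: mult.commute)
      qed
      define T where "T = binary_form d Q z 1"
      have "binary_form d P z 1 - e * T = 0"
        using z(1) by (simp add: H_def poly_form_poly T_def binary_form_def left_diff_distrib sum_subtractf
          sum_distrib_left mult.assoc)
      then have Pz: "binary_form d P z 1 = T * e" by (simp add: mult.commute)
      have zn: "comb z 1 \<noteq> (0, 0)" by (rule comb_nz) simp
      have "T \<noteq> 0" using \<phi>_nz[OF zn] Pz unfolding \<phi>_comb by (auto simp: comb_def T_def)
      have "\<Phi> (berk_point (comb z 1)) = berk_point (comb (T * e) (T * 1))"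
        using \<Phi>_berk_point[OF zn] Pz by (simp add: \<phi>_comb T_def)
      also have "\<dots> = berk_point (comb e 1)" by (rule comb_scale[OF \<open>T \<noteq> 0\<close>])
      finally have "berk_chord (\<Phi> (berk_point (comb z 1))) x = 1" if "x \<in> Xs" for x
        using e(3) that chord_commute comb_nz[of e 1] by (simp add: berk_chord_berk_point)
      moreover have "berk_point (comb z 1) \<in> C"
      proof -
        have "\<rho> \<le> \<rho> * \<tau>" using \<rho>_pos \<tau> by simp
        then have vz: "\<rho> < v z" using z(2) by linarith
        have "chord (comb z 1) u = \<rho> / v z" using vz by (simp add: chord_comb_u base.abs_one)
        also have "\<dots> \<le> 1 / \<tau>" using z(2) vz \<rho>_pos \<tau> by (simp add: field_simps)
        finally show ?thesis
          using chord_commute by (simp add: C_def berk_point_in_P1 berk_chord_berk_point[OF zn])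
      qed
      ultimately show "\<exists>z\<in>C. \<forall>x\<in>Xs. berk_chord (\<Phi> z) x = 1" by blast
    qed
    then obtain p where "p \<in> C" "\<Phi> p = \<xi>" by auto
    \<comment> \<open>The uniqueness of the preimage is used here: a preimage of \<xi> in
      \<open>C\<close> must be \<xi>, whose distance to \<open>u\<close> is 1 and not at most 1 /
      \<tau>.\<close>
    then have "\<xi> \<in> C" using \<Phi>_gauss_iff by (auto simp: C_def)
    then show False using \<tau> gauss_point_chord[OF nz(1)] by (simp add: C_def)
  qed
  then show ?thesis using j(2) by force
qed

text \<open>The mirror image of \<open>top_weight_dominates\<close>: exchanging the basis inverts
  \<rho>, and the weights in the two normalizations differ by the factor \<rho>^(d+1).\<close>

lemma bottom_weight_dominates:
  assumes "Pw 0 < Qw 0"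
  shows "\<forall>i\<le>d. Pw i \<le> Qw 0 \<and> Qw i \<le> Qw 0"
proof -
  interpret S: berk_forms v w \<iota> a r u' u \<phi> \<Phi> d "\<lambda>i. Q (d - i)" "\<lambda>i. P (d - i)"
    by (rule swapped)
  have \<rho>: "S.\<rho> = inverse \<rho>" by (simp add: S.\<rho>_def \<rho>_def)
  have k: "0 < \<rho> ^ (d + 1)" using \<rho>_pos by simp
  have split: "\<rho> ^ d = \<rho> ^ i * \<rho> ^ (d - i)" if "i \<le> d" for i
    using that by (simp flip: power_add)
  have S: "Qw (d - i) = \<rho> ^ (d + 1) * S.Pw i" "Pw (d - i) = \<rho> ^ (d + 1) * S.Qw i" if "i \<le> d" for i
    using \<rho>_pos by (simp_all add: Pw_def Qw_def S.Pw_def S.Qw_def \<rho> split[OF that] power_inverse field_simps)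
  have "\<rho> ^ (d + 1) * S.Qw d < \<rho> ^ (d + 1) * S.Pw d" using assms S[of d] by simp
  then have "S.Qw d < S.Pw d" by (simp only: mult_less_cancel_left_pos[OF k])
  from S.top_weight_dominates[OF this]
  have *: "S.Pw i \<le> S.Pw d" "S.Qw i \<le> S.Pw d" if "i \<le> d" for i using that by auto
  have "Pw (d - i) \<le> Qw (d - d)" "Qw (d - i) \<le> Qw (d - d)" if "i \<le> d" for i
    using mult_left_mono[OF *(1)[OF that], of "\<rho> ^ (d + 1)"] mult_left_mono[OF *(2)[OF that], of "\<rho> ^ (d + 1)"]
      S[OF that] S[of d] k by simp_all
  then show ?thesis by (metis diff_diff_cancel diff_le_self diff_self_eq_0)
qed

lemma fixed_class_weight:
  assumes "chord (\<phi> u) u < 1" shows "Qw d < Pw d"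
proof -
  have eq: "\<phi> u = comb (P d) (Q d)"
    using \<phi>_comb[of 1 0] by (simp add: comb_1_0 binary_form_1_0)
  have "\<rho> * v (Q d) < v (P d)"
  proof (rule ccontr)
    assume "\<not> ?thesis"
    moreover have "P d \<noteq> 0 \<or> Q d \<noteq> 0" using \<phi>_nz[OF nz(1)] eq by (auto simp: comb_def)
    then have "0 < v (P d) \<or> 0 < \<rho> * v (Q d)" using \<rho>_pos base.abs_pos_iff by auto
    ultimately have "chord (\<phi> u) u = 1" by (auto simp: eq chord_comb_u)
    then show False using assms by simp
  qed
  then show ?thesis using \<rho>_pos by (simp add: Pw_def Qw_def)
qed

lemma fixed_class_weight':
  assumes "chord (\<phi> u') u' < 1" shows "Pw 0 < Qw 0"
proof -
  have eq: "\<phi> u' = comb (P 0) (Q 0)"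
    using \<phi>_comb[of 0 1] by (simp add: comb_0_1 binary_form_0_1)
  have "v (P 0) < \<rho> * v (Q 0)"
  proof (rule ccontr)
    assume "\<not> ?thesis"
    moreover have "P 0 \<noteq> 0 \<or> Q 0 \<noteq> 0" using \<phi>_nz[OF nz(2)] eq by (auto simp: comb_def)
    then have "0 < v (P 0) \<or> 0 < \<rho> * v (Q 0)" using \<rho>_pos base.abs_pos_iff by auto
    ultimately have "chord (\<phi> u') u' = 1" by (auto simp: eq chord_comb_u')
    then show False using assms by simp
  qed
  then show ?thesis by (simp add: Pw_def Qw_def)
qed

end

section \<open>Isometry and injectivity on a class of local degree one\<close>

context nonarch_abs
begin

text \<open>In s^k - t^k = (s - t) S each term of S is at most R^(1-k) in absolute value when R >
  0.\<close>

lemma abs_power_diff_le: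
  assumes "R * v s \<le> 1" "R * v t \<le> 1" "0 \<le> R"
  shows "R ^ k * v (s ^ k - t ^ k) \<le> R * v (s - t)"
proof (cases k)
  case 0
  then show ?thesis using assms(3) by (simp add: abs_nonneg)
next
  case (Suc n)
  have pw: "R ^ i * v x ^ i \<le> 1" "0 \<le> R ^ i * v x ^ i" if "R * v x \<le> 1" for x i
    using that assms(3) power_le_one[of "R * v x" i] by (simp_all add: abs_nonneg power_mult_distrib)
  define S where "S = (\<Sum>i<k. t ^ (k - Suc i) * s ^ i)"
  have "R ^ n * v S \<le> 1"
  proof (cases "R = 0")
    case True
    have "v S \<le> 1" if "n = 0" using that by (simp add: S_def Suc abs_one)
    then show ?thesis using True by (cases n) auto
  next
    case False
    then have R: "0 < R ^ n" using assms(3) by simp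
    have "v S \<le> 1 / R ^ n" unfolding S_def
    proof (rule abs_sum_le)
      fix i assume i: "i \<in> {..<k}"
      then have split: "R ^ n = R ^ (k - Suc i) * R ^ i" using Suc by (simp flip: power_add)
      have "R ^ n * v (t ^ (k - Suc i) * s ^ i) = (R ^ (k - Suc i) * v t ^ (k - Suc i)) * (R ^ i * v s ^ i)"
        by (simp add: abs_mult abs_power split mult_ac)
      also have "\<dots> \<le> 1 * 1" by (intro mult_mono pw assms) auto
      finally show "v (t ^ (k - Suc i) * s ^ i) \<le> 1 / R ^ n" using R by (simp add: field_simps)
    qed (use R in simp)
    then show ?thesis using R by (simp add: field_simps)
  qed
  then have "(R * v (s - t)) * (R ^ n * v S) \<le> (R * v (s - t)) * 1"
    using assms(3) abs_nonneg by (intro mult_left_mono) auto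
  moreover have "v (s ^ k - t ^ k) = v (s - t) * v S"
    using power_diff_sumr2[of s k t] by (simp add: S_def abs_mult)
  ultimately show ?thesis by (simp add: Suc mult_ac)
qed

text \<open>On the disk \<open>R * v x < 1\<close> the polynomial \<open>F\<close> has constant absolute value and \<open>G\<close> is dominated
  by its linear term, so \<open>G / F\<close> is an isometry there.\<close>

lemma cross_difference_abs:
  assumes R: "0 < R" "R * v s < 1" "R * v t < 1" and m: "0 < m" and n: "1 \<le> (n::nat)"
    and f0: "v (f 0) = m" and f: "\<And>k. k \<le> n \<Longrightarrow> v (f k) \<le> m * R ^ k"
    and g0: "R * v (g 0) < m" and g1: "v (g 1) = m"
    and g: "\<And>k. 2 \<le> k \<Longrightarrow> k \<le> n \<Longrightarrow> R * v (g k) < m * R ^ k"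
  defines "F \<equiv> \<lambda>x. \<Sum>k\<le>n. f k * x ^ k" and "G \<equiv> \<lambda>x. \<Sum>k\<le>n. g k * x ^ k"
  shows "v (F s) = m" and "R * v (G s) < m"
    and "v (F s * G t - G s * F t) = m\<^sup>2 * v (s - t)"
proof -
  have f_eq: "v (F x) = m" if x: "R * v x < 1" for x
  proof -
    have "v (\<Sum>k\<in>{..n} - {0}. f k * x ^ k) < v (f 0 * x ^ 0)"
    proof (rule abs_sum_less)
      fix k assume k: "k \<in> {..n} - {0}"
      have "v (f k * x ^ k) \<le> m * R ^ k * v x ^ k"
        using f[of k] k by (simp add: abs_mult abs_power mult_right_mono abs_nonneg)
      also have "\<dots> = m * (R * v x) ^ k" by (simp add: power_mult_distrib)
      also have "\<dots> < m * 1"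
        using m R k x abs_nonneg[of x] power_Suc_less_one[of "R * v x" "k - 1"]
        by (intro mult_strict_left_mono) (auto simp: power_less_one_iff)
      finally show "v (f k * x ^ k) < v (f 0 * x ^ 0)" by (simp add: f0)
    qed (simp add: f0 m)
    moreover have "F x = (\<Sum>k\<in>{..n} - {0}. f k * x ^ k) + f 0 * x ^ 0"
      unfolding F_def by (subst sum.remove[of _ 0]) auto
    ultimately show ?thesis using abs_add_eq_right f0 by simp
  qed
  have g_less: "R * v (G x) < m" if x: "R * v x < 1" for x
  proof -
    have "v (G x) < m / R" unfolding G_def
    proof (rule abs_sum_less)
      fix k assume k: "k \<in> {..n}"
      have "R * v (g k * x ^ k) < m"
      proof (cases "k = 0")
        case True
        then show ?thesis using g0 by simp
      next
        case False
        have "R * v (g k) \<le> m * R ^ k"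
          using g[of k] k False g1 by (cases "k = 1") (auto simp: less_imp_le mult.commute)
        then have "R * v (g k) * v x ^ k \<le> m * R ^ k * v x ^ k"
          by (rule mult_right_mono) (simp add: abs_nonneg)
        also have "\<dots> = m * (R * v x) ^ k" by (simp add: power_mult_distrib)
        also have "\<dots> < m * 1"
          using m R False x abs_nonneg[of x]
          by (intro mult_strict_left_mono) (auto simp: power_less_one_iff)
        finally show ?thesis by (simp add: abs_mult abs_power mult_ac)
      qed
      then show "v (g k * x ^ k) < m / R" using R by (simp add: field_simps)
    qed (use m R in simp)
    then show ?thesis using R by (simp add: field_simps)
  qed
  show "v (F s) = m" "R * v (G s) < m" using f_eq g_less R by auto
  show "v (F s * G t - G s * F t) = m\<^sup>2 * v (s - t)"
  proof (cases "s = t")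
    case False
    then have st: "0 < v (s - t)" by (simp add: abs_pos_iff)
    have pd: "R ^ k * v (s ^ k - t ^ k) \<le> R * v (s - t)" for k
      by (rule abs_power_diff_le) (use R in auto)
    have fd: "v (F s - F t) \<le> m * R * v (s - t)"
      unfolding F_def sum_subtractf[symmetric]
    proof (rule abs_sum_le)
      fix k assume "k \<in> {..n}"
      then have "v (f k) * v (s ^ k - t ^ k) \<le> m * R ^ k * v (s ^ k - t ^ k)"
        using f[of k] by (intro mult_right_mono) (auto simp: abs_nonneg)
      also have "\<dots> \<le> m * (R * v (s - t))"
        using mult_left_mono[OF pd[of k], of m] m by (simp add: mult.assoc)
      finally show "v (f k * s ^ k - f k * t ^ k) \<le> m * R * v (s - t)"
        by (simp add: abs_mult mult.assoc flip: right_diff_distrib)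
    qed (use m R st in simp)
    have "v (\<Sum>k\<in>{..n} - {1}. g k * s ^ k - g k * t ^ k) < v (g 1 * (s - t))"
    proof (rule abs_sum_less)
      fix k assume k: "k \<in> {..n} - {1}"
      have "v (g k * (s ^ k - t ^ k)) < m * v (s - t)"
      proof (cases "s ^ k - t ^ k = 0")
        case True
        then show ?thesis using m st by simp
      next
        case False
        then have "2 \<le> k" using k by (cases "k = 0") auto
        then have "R * v (g k) * v (s ^ k - t ^ k) < m * R ^ k * v (s ^ k - t ^ k)"
          using g[of k] k False by (intro mult_strict_right_mono) (auto simp: abs_pos_iff)
        also have "\<dots> \<le> m * (R * v (s - t))"
          using mult_left_mono[OF pd[of k], of m] m by (simp add: mult.assoc)
        finally have "R * (v (g k) * v (s ^ k - t ^ k)) < R * (m * v (s - t))" by (simp add: mult_ac)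
        then show ?thesis using R by (simp add: abs_mult)
      qed
      then show "v (g k * s ^ k - g k * t ^ k) < v (g 1 * (s - t))"
        by (simp add: abs_mult g1[unfolded One_nat_def] flip: right_diff_distrib)
    qed (simp add: abs_mult g1[unfolded One_nat_def] m st)
    moreover have "G s - G t = (\<Sum>k\<in>{..n} - {1}. g k * s ^ k - g k * t ^ k) + g 1 * (s - t)"
      unfolding G_def sum_subtractf[symmetric] using n
      by (subst sum.remove[of _ 1]) (auto simp: algebra_simps)
    ultimately have gd: "v (G s - G t) = m * v (s - t)"
      using abs_add_eq_right by (simp add: abs_mult g1[unfolded One_nat_def])
    \<comment> \<open>The cross difference equals G s (F s - F t) - F s (G s - G t), and the second
      product dominates.\<close>
    have "v (G s * (F s - F t)) < v (F s * (G s - G t))"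
    proof -
      have "v (G s) * v (F s - F t) \<le> v (G s) * (m * R * v (s - t))"
        using fd by (rule mult_left_mono) (rule abs_nonneg)
      also have "\<dots> = (R * v (G s)) * (m * v (s - t))" by (simp add: mult_ac)
      also have "\<dots> < m * (m * v (s - t))"
        using g_less R m st by (intro mult_strict_right_mono) auto
      finally show ?thesis using f_eq R by (simp add: abs_mult gd)
    qed
    then have "v (G s * (F s - F t) - F s * (G s - G t)) = v (F s * (G s - G t))"
      by (rule abs_diff_eq_right)
    moreover have "G s * (F s - F t) - F s * (G s - G t) = F s * G t - G s * F t"
      by (simp add: algebra_simps)
    ultimately show ?thesis using f_eq R by (simp add: abs_mult gd power2_eq_square)
  qed (simp add: mult.commute)
qed

end

context chart_basis
begin

lemma chord_comb_u_less:
  assumes "comb s t \<noteq> (0, 0)" "chord (comb s t) u < 1" shows "\<rho> * v t < v s"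
proof (rule ccontr)
  assume no: "\<not> ?thesis"
  have "s \<noteq> 0 \<or> t \<noteq> 0" using assms(1) by (auto simp: comb_def)
  then have "0 < v s \<or> 0 < \<rho> * v t"
    using \<rho>_pos base.abs_pos_iff[of s] base.abs_pos_iff[of t] by auto
  then have "chord (comb s t) u = 1" using no by (auto simp: chord_comb_u)
  then show False using assms(2) by simp
qed

end

context berk_forms
begin

text \<open>Near \<open>u\<close> the coordinate is t in \<open>comb 1 t\<close>, so coefficients
  are read in reverse order. The hypotheses say that Q reduces to its linear term while P keeps a
  nonzero constant term; \<open>cross_difference_abs\<close> then computes the wedge of two
  images.\<close>

lemma class_isometry:
  assumes d: "1 \<le> d" and top: "Qw d < Pw d" and lin: "Qw (d - 1) = Pw d"
    and rest: "\<And>j. j + 2 \<le> d \<Longrightarrow> Qw j < Pw d"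
    and st: "\<rho> * v s < 1" "\<rho> * v t < 1"
  shows "chord (\<phi> (comb 1 s)) (\<phi> (comb 1 t)) = chord (comb 1 s) (comb 1 t)"
proof -
  define m where "m = v (P d)"
  define f g where "f k = P (d - k)" and "g k = Q (d - k)" for k
  have dom: "Pw i \<le> Pw d" if "i \<le> d" for i using top_weight_dominates[OF top] that by blast
  have pw: "\<rho> ^ d = \<rho> ^ k * \<rho> ^ (d - k)" if "k \<le> d" for k
    using that by (simp flip: power_add)
  have m: "0 < m"
    using top weights_nonneg(2)[of d] base.abs_nonneg[of "P d"] \<rho>_pos
    by (cases "m = 0") (auto simp: m_def Pw_def)
  have f: "v (f k) \<le> m * \<rho> ^ k" if "k \<le> d" for k
    using dom[of "d - k"] \<rho>_pos by (simp add: Pw_def pw[OF that] f_def m_def mult.assoc[symmetric])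
  have g: "\<rho> * v (g k) < m * \<rho> ^ k" if "2 \<le> k" "k \<le> d" for k
  proof -
    have "Qw (d - k) < Pw d" by (rule rest) (use that in auto)
    then show ?thesis using \<rho>_pos by (simp add: Pw_def Qw_def pw[OF that(2)] g_def m_def mult.assoc[symmetric])
  qed
  have g0: "\<rho> * v (g 0) < m" using top \<rho>_pos by (simp add: Pw_def Qw_def g_def m_def)
  have g1: "v (g 1) = m" using lin \<rho>_pos by (simp add: Pw_def Qw_def pw[OF d] g_def m_def)
  have f0: "v (f 0) = m" by (simp add: f_def m_def)
  have form: "binary_form d P 1 x = (\<Sum>k\<le>d. f k * x ^ k)" "binary_form d Q 1 x = (\<Sum>k\<le>d. g k * x ^ k)" for x
    using binary_form_swap[of d P x 1] binary_form_swap[of d Q x 1] by (simp_all add: binary_form_def f_def g_def)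
  note C = base.cross_difference_abs[OF \<rho>_pos _ _ m d f0 f g0 g1 g]
  have N: "v (binary_form d P 1 x) = m" "\<rho> * v (binary_form d Q 1 x) < m" if "\<rho> * v x < 1" for x
    using C(1)[OF that that] C(2)[OF that that] by (simp_all add: form)
  have D: "v (binary_form d P 1 s * binary_form d Q 1 t - binary_form d Q 1 s * binary_form d P 1 t) = m\<^sup>2 * v (s - t)"
    using C(3)[OF st] by (simp add: form)
  show ?thesis
    unfolding \<phi>_comb chord_comb D using N[OF st(1)] N[OF st(2)] m st
    by (simp add: base.abs_one power2_eq_square max_def base.abs_diff_commute[of t])
qed

text \<open>Both sides are continuous in \<open>p\<close> and agree at the classical points of the
  open class, which are dense in it when the absolute value is nontrivial.\<close>

lemma berk_class_isometry:
  assumes d: "1 \<le> d" and top: "Qw d < Pw d" and lin: "Qw (d - 1) = Pw d"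
    and rest: "\<And>j. j + 2 \<le> d \<Longrightarrow> Qw j < Pw d"
    and nontriv: "x0 \<noteq> 0" "v x0 \<noteq> 1"
    and t: "\<rho> * v t < 1" and p: "p \<in> topspace P1" "berk_chord p u < 1"
  shows "berk_chord (\<Phi> p) (\<phi> (comb 1 t)) = berk_chord p (comb 1 t)"
proof (rule ccontr)
  let ?x = "comb 1 t"
  assume ne: "\<not> ?thesis"
  define e where "e = \<bar>berk_chord (\<Phi> p) (\<phi> ?x) - berk_chord p ?x\<bar> / 2"
  have e: "0 < e" using ne by (simp add: e_def)
  have xnz: "?x \<noteq> (0, 0)" by (rule comb_nz) simp
  note id = continuous_map_id[unfolded id_def]
  define U where "U = {q \<in> topspace P1. berk_chord q u \<in> {..<1}}
    \<inter> {q \<in> topspace P1. berk_chord q ?x \<in> ball (berk_chord p ?x) e}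
    \<inter> {q \<in> topspace P1. berk_chord (\<Phi> q) (\<phi> ?x) \<in> ball (berk_chord (\<Phi> p) (\<phi> ?x)) e}"
  have "openin P1 U" unfolding U_def
    by (intro openin_Int openin_chord_preimage[OF id nz(1)] openin_chord_preimage[OF id xnz]
        openin_chord_preimage[OF cont \<phi>_nz[OF xnz]]) auto
  moreover have "p \<in> U" using p e by (simp add: U_def)
  ultimately obtain y where y: "y \<noteq> (0, 0)" "berk_point y \<in> U"
    using berk_points_dense[OF nontriv] by blast
  obtain s' t' where st: "y = comb s' t'" using comb_exists by blast
  have "chord y u < 1" using y by (simp add: U_def berk_chord_berk_point chord_commute)
  then have less: "\<rho> * v t' < v s'"
    using y(1) chord_comb_u_less by (simp add: st)
  have "0 \<le> \<rho> * v t'" using \<rho>_pos base.abs_nonneg by simp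
  with less have "0 < v s'" by linarith
  then have s': "s' \<noteq> 0" "0 < v s'" by auto
  define z where "z = comb 1 (t' / s')"
  have znz: "z \<noteq> (0, 0)" unfolding z_def by (rule comb_nz) simp
  have yz: "berk_point y = berk_point z"
    using comb_scale[OF s'(1), of 1 "t' / s'"] s' by (simp add: st z_def)
  have "\<rho> * v (t' / s') < 1" using less s' by (simp add: base.abs_divide)
  from class_isometry[OF d top lin rest this t]
  have "chord (\<phi> z) (\<phi> ?x) = chord z ?x" by (simp add: z_def)
  then have "berk_chord (\<Phi> (berk_point z)) (\<phi> ?x) = berk_chord (berk_point z) ?x"
    using \<Phi>_berk_point[OF znz] by (simp add: berk_chord_berk_point znz \<phi>_nz chord_commute)
  moreover have "\<bar>berk_chord p ?x - berk_chord (berk_point z) ?x\<bar> < e"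
    "\<bar>berk_chord (\<Phi> p) (\<phi> ?x) - berk_chord (\<Phi> (berk_point z)) (\<phi> ?x)\<bar> < e"
    using y(2) by (simp_all add: U_def yz dist_real_def)
  ultimately show False unfolding e_def by (simp add: abs_if split: if_splits)
qed

text \<open>Equal images have equal distances to each image of \<open>comb 1 t\<close>, so the two
  points have equal distances to the classical points of the class. Classical points outside it are
  at distance 1 from both.\<close>

lemma inj_on_class:
  assumes d: "1 \<le> d" and top: "Qw d < Pw d" and lin: "Qw (d - 1) = Pw d"
    and rest: "\<And>j. j + 2 \<le> d \<Longrightarrow> Qw j < Pw d"
    and nontriv: "x0 \<noteq> 0" "v x0 \<noteq> 1"
  shows "inj_on \<Phi> {p \<in> topspace P1. berk_chord p u < 1}"
proof (rule inj_onI)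
  fix p q assume p: "p \<in> {p \<in> topspace P1. berk_chord p u < 1}"
    and q: "q \<in> {p \<in> topspace P1. berk_chord p u < 1}" and eq: "\<Phi> p = \<Phi> q"
  show "p = q"
  proof (rule berk_chord_separates)
    fix x :: "'b \<times> 'b" assume x: "x \<noteq> (0, 0)"
    show "berk_chord p x = berk_chord q x"
    proof (cases "chord x u < 1")
      case False
      then have "berk_chord p' x = 1" if "p' \<in> topspace P1" "berk_chord p' u < 1" for p'
        using berk_chord_triangle(2)[OF that(1) x nz(1)] that(2) berk_chord_le_one[OF that(1), of x] by auto
      then show ?thesis using p q by simp
    next
      case True
      obtain s t where st: "x = comb s t" using comb_exists by blast
      have less: "\<rho> * v t < v s"
        using True x chord_comb_u_less by (simp add: st)
      then have s: "0 < v s" using \<rho>_pos base.abs_nonneg[of t] by (auto intro: le_less_trans[rotated])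
      define z where "z = comb 1 (t / s)"
      have znz: "z \<noteq> (0, 0)" unfolding z_def by (rule comb_nz) simp
      have "chord x z = 0"
        using s base.abs_pos_iff[of s] by (simp add: st z_def chord_comb)
      then have "berk_chord p' x = berk_chord p' z" if "p' \<in> topspace P1" for p'
        using berk_chord_triangle(1)[OF that x znz] berk_chord_triangle(1)[OF that znz x] chord_commute[of z x]
          berk_chord_nonneg[OF that, of x] berk_chord_nonneg[OF that, of z] by auto
      moreover have "\<rho> * v (t / s) < 1" using less s by (simp add: base.abs_divide)
      then have "berk_chord p' z = berk_chord (\<Phi> p') (\<phi> z)" if "p' \<in> topspace P1" "berk_chord p' u < 1" for p'
        using berk_class_isometry[OF d top lin rest nontriv _ that] by (simp add: z_def)
      ultimately show ?thesis using p q eq by simp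
    qed
  qed (use p q in auto)
qed

lemma \<rho>_trivial:
  assumes "\<And>x. x \<noteq> 0 \<Longrightarrow> v x = 1" shows "\<rho> = 1"
  using \<rho>_value assms by auto

text \<open>For \<open>P d\<close> \<noteq> 0, equality of \<open>Qw k\<close> and
  \<open>Pw d\<close> means v (Q k / P d) = \<rho>^(d-1-k); the condition k + 2 \<le> d makes this
  exponent positive.\<close>

theorem exists_weight_relation:
  assumes d: "2 \<le> d" and u: "chord (\<phi> u) u < 1"
    and alt: "chord (\<phi> u') u' < 1 \<or> \<not> inj_on \<Phi> {p \<in> topspace P1. berk_chord p u < 1}"
  shows "\<rho> = 1 \<or> (\<exists>k. k + 2 \<le> d \<and> P d \<noteq> 0 \<and> Q k \<noteq> 0 \<and> v (Q k / P d) = \<rho> ^ (d - 1 - k))"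
proof -
  have top: "Qw d < Pw d" by (rule fixed_class_weight[OF u])
  then have pos: "0 < Pw d" using weights_nonneg(2)[of d] by linarith
  have rel: "P d \<noteq> 0 \<and> Q k \<noteq> 0 \<and> v (Q k / P d) = \<rho> ^ (d - 1 - k)" if k: "k + 1 \<le> d" "Qw k = Pw d" for k
  proof -
    have "0 < Qw k" using pos k(2) by simp
    then have "P d \<noteq> 0" "Q k \<noteq> 0" using pos by (auto simp: Pw_def Qw_def)
    moreover have "\<rho> ^ d = \<rho> ^ Suc k * \<rho> ^ (d - 1 - k)"
      using k(1) by (simp flip: power_add power_Suc)
    then have "v (Q k) = v (P d) * \<rho> ^ (d - 1 - k)"
      using k(2) \<rho>_pos by (simp add: Pw_def Qw_def)
    ultimately show ?thesis by (simp add: base.abs_divide base.abs_eq_0_iff)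
  qed
  show ?thesis
  proof (cases "chord (\<phi> u') u' < 1")
    case True
    \<comment> \<open>With both classes fixed, each of the two weights dominates the other. This
      pair has the largest exponent, d - 1.\<close>
    have "Qw 0 = Pw d"
      using top_weight_dominates[OF top] bottom_weight_dominates[OF fixed_class_weight'[OF True]]
      by (intro antisym) auto
    then show ?thesis using rel[of 0] d by (intro disjI2 exI[of _ 0]) auto
  next
    case False
    with alt have ninj: "\<not> inj_on \<Phi> {p \<in> topspace P1. berk_chord p u < 1}" by blast
    show ?thesis
    proof (cases "\<exists>k. k + 2 \<le> d \<and> Qw k = Pw d")
      case True
      then obtain k where "k + 2 \<le> d" "Qw k = Pw d" by blast
      then show ?thesis using rel[of k] by auto
    next
      case no: False
      have dom: "Qw i \<le> Pw d" if "i \<le> d" for i using top_weight_dominates[OF top] that by blast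
      have rest: "Qw j < Pw d" if "j + 2 \<le> d" for j
        using no dom[of j] that by (metis add_leD1 order_less_le)
      \<comment> \<open>The dominant Q-weight equals the top weight. Index d is excluded by
        \<open>top\<close> and smaller ones by \<open>rest\<close>, which leaves j = d - 1, the
        isometric case.\<close>
      obtain j where j: "j \<le> d" "\<forall>i\<le>d. Pw i \<le> Qw j \<and> Qw i \<le> Qw j" using Qw_dominates by blast
      then have "Qw j = Pw d" using dom by (intro antisym) auto
      then have "j = d - 1" using j(1) rest[of j] top by (cases "j = d"; cases "j + 2 \<le> d") auto
      then have lin: "Qw (d - 1) = Pw d" using \<open>Qw j = Pw d\<close> by simp
      have "v x = 1" if "x \<noteq> 0" for x
        using inj_on_class[OF _ top lin rest that] ninj d by fastforce
      then show ?thesis using \<rho>_trivial by blast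
    qed
  qed
qed

end

section \<open>Rational maps over the base field\<close>

interpretation to_ac: field_hom to_ac
  by unfold_locales simp_all

text \<open>A nonzero polynomial over K of least degree vanishing at \<open>z\<close> divides every
  polynomial over K that vanishes there, so a common root yields a common divisor over K.\<close>

lemma coprime_no_common_root:
  fixes f g :: "'k::field poly"
  assumes "coprime f g" "poly (map_poly to_ac f) z = 0" "poly (map_poly to_ac g) z = 0"
  shows False
proof -
  define A where "A p \<longleftrightarrow> p \<noteq> 0 \<and> poly (map_poly to_ac p) z = 0" for p :: "'k poly"
  obtain p0 where "A p0" unfolding A_def using alg_closure_algebraic[of z] by metis
  then obtain p where p: "A p" "\<And>q. A q \<Longrightarrow> Polynomial.degree p \<le> Polynomial.degree q"
    using ex_has_least_nat[of A p0 Polynomial.degree] by blast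
  have dvd: "p dvd q" if q: "poly (map_poly to_ac q) z = 0" for q
  proof (rule ccontr)
    assume "\<not> p dvd q"
    then have nz: "q mod p \<noteq> 0" by (simp add: dvd_eq_mod_eq_0)
    have "q mod p = q - q div p * p" by (simp add: minus_div_mult_eq_mod)
    then have "poly (map_poly to_ac (q mod p)) z = 0"
      using q p(1) by (simp add: to_ac.map_poly_diff to_ac.map_poly_mult A_def)
    then have "Polynomial.degree p \<le> Polynomial.degree (q mod p)"
      using nz by (intro p(2)) (simp add: A_def)
    moreover have "Polynomial.degree (q mod p) < Polynomial.degree p"
      using nz p(1) degree_mod_less[of p q] by (simp add: A_def)
    ultimately show False by simp
  qed
  have "is_unit p" using assms dvd by (meson coprime_def)
  then have "Polynomial.degree p = 0" using p(1) by (simp add: A_def is_unit_iff_degree)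
  then obtain c where "p = [:c:]" by (elim degree_eq_zeroE)
  then show False using p(1) by (simp add: A_def map_poly_pCons)
qed

section \<open>Binary forms with coefficients in K\<close>

lemma binary_form_dehomogenize:
  assumes "t \<noteq> 0" shows "binary_form d c s t = t ^ d * poly (form_poly d c) (s / t)"
proof -
  have *: "c i * s ^ i * t ^ (d - i) = t ^ d * (c i * (s / t) ^ i)" if "i \<le> d" for i
  proof -
    have "t ^ d = t ^ i * t ^ (d - i)" using that by (simp flip: power_add)
    then show ?thesis using assms by (simp add: power_divide)
  qed
  show ?thesis
    unfolding poly_form_poly binary_form_def sum_distrib_left
    by (intro sum.cong refl) (simp only: * atMost_iff power_one mult_1_right)
qed

text \<open>A predicate on functions: closure under sums, scaling and linear factors then gives
  rationality over K after a change of basis without explicit coefficients.\<close>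

definition base_form :: "nat \<Rightarrow> ('k::field alg_closure \<Rightarrow> 'k alg_closure \<Rightarrow> 'k alg_closure) \<Rightarrow> bool" where
  "base_form n G \<longleftrightarrow> (\<exists>c. \<forall>s t. G s t = binary_form n (\<lambda>i. to_ac (c i)) s t)"

lemma base_form_linear_mult:
  assumes "base_form n G"
  shows "base_form (Suc n) (\<lambda>s t. (s * to_ac a + t * to_ac b) * G s t)"
proof -
  obtain c where c: "\<And>s t. G s t = binary_form n (\<lambda>i. to_ac (c i)) s t"
    using assms by (auto simp: base_form_def)
  define c' where "c' i = (if i = 0 then 0 else a * c (i - 1)) + (if i \<le> n then b * c i else 0)" for i
  have "(s * to_ac a + t * to_ac b) * G s t = binary_form (Suc n) (\<lambda>i. to_ac (c' i)) s t" for s t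
  proof -
    have "binary_form (Suc n) (\<lambda>i. to_ac (c' i)) s t
      = (\<Sum>i\<le>Suc n. to_ac (if i = 0 then 0 else a * c (i - 1)) * s ^ i * t ^ (Suc n - i))
        + (\<Sum>i\<le>Suc n. to_ac (if i \<le> n then b * c i else 0) * s ^ i * t ^ (Suc n - i))"
      by (simp only: binary_form_def c'_def to_ac_add distrib_right sum.distrib)
    also have "(\<Sum>i\<le>Suc n. to_ac (if i = 0 then 0 else a * c (i - 1)) * s ^ i * t ^ (Suc n - i))
      = s * to_ac a * G s t"
      unfolding sum.atMost_Suc_shift c binary_form_def by (simp add: sum_distrib_left mult_ac)
    also have "(\<Sum>i\<le>Suc n. to_ac (if i \<le> n then b * c i else 0) * s ^ i * t ^ (Suc n - i))
      = t * to_ac b * G s t"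
      unfolding c binary_form_def by (simp add: sum_distrib_left mult_ac Suc_diff_le)
    finally show ?thesis by (simp add: algebra_simps)
  qed
  then show ?thesis unfolding base_form_def by blast
qed

lemma base_form_linear_power_mult:
  assumes "base_form n G"
  shows "base_form (n + k) (\<lambda>s t. (s * to_ac a + t * to_ac b) ^ k * G s t)"
proof (induction k)
  case (Suc k)
  from base_form_linear_mult[OF this, of a b] show ?case by (simp add: mult.assoc)
qed (simp add: assms)

lemma base_form_scale: "base_form n G \<Longrightarrow> base_form n (\<lambda>s t. to_ac a * G s t)"
  unfolding base_form_def binary_form_def
  by (elim exE, rule_tac x = "\<lambda>i. a * c i" in exI) (simp add: sum_distrib_left mult.assoc)

lemma base_form_add: "base_form n G \<Longrightarrow> base_form n H \<Longrightarrow> base_form n (\<lambda>s t. G s t + H s t)"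
  unfolding base_form_def binary_form_def
  by (elim exE, rule_tac x = "\<lambda>i. c i + ca i" in exI) (simp add: sum.distrib distrib_right)

lemma base_form_sum:
  "finite A \<Longrightarrow> (\<And>i. i \<in> A \<Longrightarrow> base_form n (G i)) \<Longrightarrow> base_form n (\<lambda>s t. \<Sum>i\<in>A. G i s t)"
proof (induction A rule: finite_induct)
  case empty
  show ?case unfolding base_form_def binary_form_def by (rule exI[of _ "\<lambda>_. 0"]) simp
qed (auto intro: base_form_add)

lemma base_form_substitute:
  "base_form d (\<lambda>s t. binary_form d (\<lambda>i. to_ac (c i))
    (s * to_ac a0 + t * to_ac b0) (s * to_ac a1 + t * to_ac b1))"
proof -
  have "base_form d (\<lambda>s t. to_ac (c i) * (s * to_ac a0 + t * to_ac b0) ^ i * (s * to_ac a1 + t * to_ac b1) ^ (d - i))"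
    if "i \<le> d" for i
  proof -
    have "base_form 0 (\<lambda>s t. to_ac (c i))"
      unfolding base_form_def by (rule exI[of _ "\<lambda>_. c i"]) (simp add: binary_form_def)
    from base_form_linear_power_mult[OF base_form_linear_power_mult[OF this, of "d - i" a1 b1], of i a0 b0]
    show ?thesis using that by (simp add: mult_ac)
  qed
  then show ?thesis unfolding binary_form_def by (intro base_form_sum) auto
qed

text \<open>Solving \<open>z\<close> for \<open>s\<close> turns \<open>s ^ n = c\<close> into a polynomial equation for \<open>z\<close> of degree at most \<open>n\<close>.\<close>

lemma point_degree_mobius:
  fixes c u0 u1 v0 v1 :: "'k::field"
  assumes s: "s ^ n = to_ac c" and c: "c \<noteq> 0" and n: "1 \<le> n" and det: "u0 * v1 - u1 * v0 \<noteq> 0"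
    and z: "z * (s * to_ac u1 + to_ac v1) = s * to_ac u0 + to_ac v0"
  shows "point_degree (Some z) \<le> n"
proof -
  define p where "p = [:v0, - v1:] ^ n - Polynomial.smult c ([:- u0, u1:] ^ n)"
  \<comment> \<open>By \<open>det\<close> the two linear polynomials have no common zero. At a zero
    of one of them only the power of the other survives.\<close>
  have "poly p (if u1 = 0 then v0 / v1 else u0 / u1) \<noteq> 0"
  proof (cases "u1 = 0")
    case True
    then show ?thesis using det c by (simp add: p_def poly_power zero_power) (use n in \<open>simp add: zero_power\<close>)
  next
    case False
    then have "v0 - v1 * (u0 / u1) \<noteq> 0" using det by (simp add: field_simps)
    then show ?thesis using False n by (simp add: p_def poly_power zero_power mult.commute)
  qed
  then have "p \<noteq> 0" by auto
  moreover have "poly (map_poly to_ac p) z = 0"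
  proof -
    have "to_ac v0 - z * to_ac v1 = s * (z * to_ac u1 - to_ac u0)"
      using z by (simp add: algebra_simps)
    then have "(to_ac v0 - z * to_ac v1) ^ n = to_ac c * (z * to_ac u1 - to_ac u0) ^ n"
      by (simp add: power_mult_distrib s)
    then show ?thesis
      by (simp add: p_def to_ac.map_poly_diff to_ac.map_poly_power to_ac.map_poly_smult map_poly_pCons poly_power)
  qed
  ultimately have "point_degree (Some z) \<le> Polynomial.degree p" by (rule point_degree_le)
  also have "\<dots> \<le> n" unfolding p_def
  proof (rule degree_diff_le)
    have "Polynomial.degree ([:a, b:] ^ n) \<le> n" for a b :: 'k
      using degree_power_le[of "[:a, b:]" n] by (rule order_trans) (simp split: if_splits)
    then show "Polynomial.degree ([:v0, - v1:] ^ n) \<le> n" "Polynomial.degree (Polynomial.smult c ([:- u0, u1:] ^ n)) \<le> n"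
      by (auto intro: order_trans[OF degree_smult_le])
  qed
  finally show ?thesis .
qed

text \<open>Every point of a disk is a center, and an element closer to e than \<open>w e\<close>
  has the same absolute value; density thus moves center and radius into the algebraically closed
  field.\<close>

lemma (in nonarch_completion) type_II_chart:
  assumes "type_II w \<xi>"
  shows "\<exists>a r. r \<in> v ` (UNIV - {0}) \<and> \<xi> = disk_point w (\<iota> a) r"
proof -
  obtain c e where e: "e \<noteq> 0" "\<xi> = disk_point w c (w e)" using assms by (auto simp: type_II_def)
  then have pos: "0 < w e" by (simp add: compl.abs_pos_iff)
  obtain b where b: "w (e - \<iota> b) < w e" using emb_approx[OF pos] by blast
  have "v b = w e"
    using compl.abs_diff_eq_right[OF b] compl.abs_minus[of "\<iota> b"] by (simp add: emb_abs)
  then have r: "w e \<in> v ` (UNIV - {0})" using pos base.abs_zero by (intro image_eqI[of _ _ b]) auto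
  obtain a where a: "w (c - \<iota> a) < w e" using emb_approx[OF pos] by blast
  have "w (z - c) \<le> w e \<longleftrightarrow> w (z - \<iota> a) \<le> w e" for z
    using compl.abs_add_le_max[of "z - c" "c - \<iota> a"] compl.abs_diff_le_max[of "z - \<iota> a" "c - \<iota> a"] a
    by (auto simp: max_def split: if_splits)
  then have "\<xi> = disk_point w (\<iota> a) (w e)" by (simp add: e(2) disk_point_def)
  then show ?thesis using r by blast
qed

lemma (in berk_chart) rat_map_point:
  assumes nz: "x \<noteq> (0, 0)" and cop: "\<And>z. poly f z \<noteq> 0 \<or> poly g z \<noteq> 0"
    and d: "d = max (Polynomial.degree f) (Polynomial.degree g)" "0 < d"
  defines "y \<equiv> (binary_form d (Polynomial.coeff f) (fst x) (snd x), binary_form d (Polynomial.coeff g) (fst x) (snd x))"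
  shows "rat_map (map_poly \<iota> f) (map_poly \<iota> g) (map_option \<iota> (point x)) = map_option \<iota> (point y)" (is ?eq)
    and "y \<noteq> (0, 0)"
proof -
  have lead: "Polynomial.coeff f d \<noteq> 0 \<or> Polynomial.coeff g d \<noteq> 0"
    using d by (metis degree_0 leading_coeff_0_iff max_def less_irrefl)
  have form: "form_poly d (Polynomial.coeff h) = h" if "Polynomial.degree h \<le> d" for h :: "'b poly"
    using that by (intro poly_eqI) (auto simp: coeff_form_poly coeff_eq_0)
  show ?eq "y \<noteq> (0, 0)"
  proof (atomize (full), cases "snd x = 0")
    case True
    then have "fst x \<noteq> 0" using nz by (simp add: prod_eq_iff)
    have top: "binary_form d c s 0 = c d * s ^ d" for c :: "nat \<Rightarrow> 'b" and s
      unfolding binary_form_def by (subst sum.remove[of _ d]) (auto simp: power_0_left)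
    have y: "y = (Polynomial.coeff f d * fst x ^ d, Polynomial.coeff g d * fst x ^ d)"
      using True by (simp add: y_def top)
    then have "y \<noteq> (0, 0)" using lead \<open>fst x \<noteq> 0\<close> by auto
    moreover have ?eq
    proof (cases "Polynomial.degree g < Polynomial.degree f")
      case less: True
      then have "Polynomial.coeff g d = 0" using d by (simp add: coeff_eq_0)
      then show ?thesis using True less by (simp add: rat_map_def point_def y emb.degree_map_poly)
    next
      case False
      then have dg: "d = Polynomial.degree g" using d by simp
      then have "Polynomial.coeff g d \<noteq> 0" using d(2) by (metis degree_0 leading_coeff_0_iff less_irrefl)
      then show ?thesis using True False \<open>fst x \<noteq> 0\<close>
        by (simp add: rat_map_def point_def y emb.degree_map_poly coeff_map_poly emb.divide flip: dg)
    qed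
    ultimately show "?eq \<and> y \<noteq> (0, 0)" by blast
  next
    case False
    define z where "z = fst x / snd x"
    have y: "y = (snd x ^ d * poly f z, snd x ^ d * poly g z)"
      using False form[of f] form[of g] d(1) by (simp add: y_def binary_form_dehomogenize z_def)
    then have "y \<noteq> (0, 0)" using cop[of z] False by auto
    moreover have ?eq
    proof -
      have "point x = Some z" using False by (simp add: point_def z_def)
      then show ?thesis using False
        by (simp add: rat_map_def y point_def emb.poly_map_poly emb.divide)
    qed
    ultimately show "?eq \<and> y \<noteq> (0, 0)" by blast
  qed
qed

theorem theorem3p4:
  fixes v :: "'k::field alg_closure \<Rightarrow> real"
    and w :: "'c::field \<Rightarrow> real"
    and \<iota> :: "'k alg_closure \<Rightarrow> 'c"
    and f g :: "'k poly"
    and d :: nat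
    and \<Phi> :: "'c berk \<Rightarrow> 'c berk"
    and \<xi> :: "'c berk"
    and U V :: "'c berk set"
  assumes "nonarch_completion v w \<iota>"
    and "coprime f g"
    and "d = max (Polynomial.degree f) (Polynomial.degree g)"
    and "d \<ge> 2"
    and "berk_extension w
           (rat_map (map_poly (\<lambda>c. \<iota> (to_ac c)) f) (map_poly (\<lambda>c. \<iota> (to_ac c)) g)) \<Phi>"
    and "type_II w \<xi>"
    and "totally_invariant w \<Phi> \<xi>"
    and "U \<in> components_off w \<xi>"
    and "V \<in> components_off w \<xi>"
    and "U \<noteq> V"
    and "\<exists>a :: 'k option. classical_point w (map_option (\<lambda>c. \<iota> (to_ac c)) a) \<in> U"
    and "\<exists>b :: 'k option. classical_point w (map_option (\<lambda>c. \<iota> (to_ac c)) b) \<in> V"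
    and "(fixed_component \<Phi> U \<and> fixed_component \<Phi> V) \<or> attracting_component \<Phi> U"
  shows "\<exists>\<alpha> :: 'k alg_closure option.
           classical_point w (map_option \<iota> \<alpha>) \<notin> U \<union> V \<and> point_degree \<alpha> \<le> d - 1"
proof -
  interpret nonarch_completion v w \<iota> by (rule assms(1))
  obtain a r where r: "r \<in> v ` (UNIV - {0})" and \<xi>: "\<xi> = disk_point w (\<iota> a) r"
    using type_II_chart[OF assms(6)] by blast
  interpret C: berk_chart v w \<iota> a r by unfold_locales (rule r)
  define f' g' where "f' = map_poly to_ac f" and "g' = map_poly to_ac g"
  have f'c: "Polynomial.coeff f' = (\<lambda>i. to_ac (Polynomial.coeff f i))"
    and g'c: "Polynomial.coeff g' = (\<lambda>i. to_ac (Polynomial.coeff g i))"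
    by (auto simp: f'_def g'_def coeff_map_poly)
  have d': "d = max (Polynomial.degree f') (Polynomial.degree g')" "0 < d"
    using assms(3,4) by (simp_all add: f'_def g'_def to_ac.degree_map_poly)
  have cop: "poly f' z \<noteq> 0 \<or> poly g' z \<noteq> 0" for z
    using coprime_no_common_root[OF assms(2)] by (auto simp: f'_def g'_def)
  define \<phi> where "\<phi> x = (binary_form d (Polynomial.coeff f') (fst x) (snd x),
    binary_form d (Polynomial.coeff g') (fst x) (snd x))" for x
  have \<phi>nz: "\<phi> x \<noteq> (0, 0)" if "x \<noteq> (0, 0)" for x
    unfolding \<phi>_def by (rule C.rat_map_point(2)[OF that cop d'])
  have cont: "continuous_map C.P1 C.P1 \<Phi>" using assms(5) by (simp add: berk_extension_def)
  have ext: "\<Phi> (C.berk_point x) = C.berk_point (\<phi> x)" if "x \<noteq> (0, 0)" for x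
  proof -
    have "map_poly (\<lambda>c. \<iota> (to_ac c)) h = map_poly \<iota> (map_poly to_ac h)" for h
      by (rule poly_eqI) (simp add: coeff_map_poly)
    then have "\<Phi> (C.berk_point x) = classical_point w (rat_map (map_poly \<iota> f') (map_poly \<iota> g') (map_option \<iota> (C.point x)))"
      using assms(5) by (simp add: berk_extension_def C.berk_point_def f'_def g'_def)
    also have "\<dots> = C.berk_point (\<phi> x)"
      unfolding C.rat_map_point(1)[OF that cop d'] \<phi>_def C.berk_point_def ..
    finally show ?thesis .
  qed
  \<comment> \<open>Total invariance supplies this: \<xi> belongs to its own fibre, which consists
    of points of the Berkovich line.\<close>
  have gauss: "disk_point w (\<iota> a) r \<in> topspace C.P1" using assms(7) by (auto simp: totally_invariant_def \<xi>)
  have rep: "\<exists>u0 u1. (u0 \<noteq> 0 \<or> u1 \<noteq> 0) \<and>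
      classical_point w (map_option (\<lambda>c. \<iota> (to_ac c)) b) = C.berk_point (to_ac u0, to_ac u1)" for b :: "'k option"
  proof (cases b)
    case None
    then show ?thesis by (intro exI[of _ 1] exI[of _ 0]) (simp add: C.berk_point_def C.point_def)
  next
    case (Some c)
    then show ?thesis by (intro exI[of _ c] exI[of _ 1]) (simp add: C.berk_point_def C.point_def)
  qed
  obtain u0 u1 :: 'k where u: "u0 \<noteq> 0 \<or> u1 \<noteq> 0" "C.berk_point (to_ac u0, to_ac u1) \<in> U"
    using assms(11) rep by metis
  obtain v0 v1 :: 'k where v: "v0 \<noteq> 0 \<or> v1 \<noteq> 0" "C.berk_point (to_ac v0, to_ac v1) \<in> V"
    using assms(12) rep by metis
  define x where "x = (to_ac u0, to_ac u1)"
  define y where "y = (to_ac v0, to_ac v1)"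
  have xnz: "x \<noteq> (0, 0)" and ynz: "y \<noteq> (0, 0)" using u v by (auto simp: x_def y_def)
  have xU: "C.berk_point x \<in> U" and yV: "C.berk_point y \<in> V" using u v by (auto simp: x_def y_def)
  have UV: "U \<in> components_off w (disk_point w (\<iota> a) r)" "V \<in> components_off w (disk_point w (\<iota> a) r)"
    using assms(8,9) by (auto simp: \<xi>)
  have orth: "C.chord x y = 1"
    by (rule C.chord_distinct_components[OF gauss UV assms(10) xnz ynz xU yV])
  note Usub = C.components_off_subset_class[OF gauss UV(1) xnz xU]
    and Vsub = C.components_off_subset_class[OF gauss UV(2) ynz yV]
  interpret B: chart_basis v w \<iota> a r x y by unfold_locales (fact xnz ynz orth)+
  \<comment> \<open>Cramer's rule: the determinant of the basis lies in K, so \<open>P\<close> and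
    \<open>Q\<close> below have coefficients in K.\<close>
  define \<Delta> where "\<Delta> = u0 * v1 - u1 * v0"
  have \<Delta>: "to_ac \<Delta> = wedge x y" by (simp add: \<Delta>_def wedge_def x_def y_def)
  then have \<Delta>0: "\<Delta> \<noteq> 0" using B.wedge_basis(2) by auto
  have comb: "fst (B.comb s t) = s * to_ac u0 + t * to_ac v0" "snd (B.comb s t) = s * to_ac u1 + t * to_ac v1" for s t
    unfolding B.comb_def by (simp_all add: x_def y_def)
  have forms: "base_form d (\<lambda>s t. fst (\<phi> (B.comb s t)))" "base_form d (\<lambda>s t. snd (\<phi> (B.comb s t)))"
    unfolding \<phi>_def fst_conv snd_conv comb f'c g'c by (rule base_form_substitute)+
  have "base_form d (\<lambda>s t. to_ac (v1 / \<Delta>) * fst (\<phi> (B.comb s t)) + to_ac (- v0 / \<Delta>) * snd (\<phi> (B.comb s t)))"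
    by (intro base_form_add base_form_scale forms)
  then obtain P where P: "\<And>s t. to_ac (v1 / \<Delta>) * fst (\<phi> (B.comb s t)) + to_ac (- v0 / \<Delta>) * snd (\<phi> (B.comb s t))
      = binary_form d (\<lambda>i. to_ac (P i)) s t" unfolding base_form_def by blast
  have "base_form d (\<lambda>s t. to_ac (u0 / \<Delta>) * snd (\<phi> (B.comb s t)) + to_ac (- u1 / \<Delta>) * fst (\<phi> (B.comb s t)))"
    by (intro base_form_add base_form_scale forms)
  then obtain Q where Q: "\<And>s t. to_ac (u0 / \<Delta>) * snd (\<phi> (B.comb s t)) + to_ac (- u1 / \<Delta>) * fst (\<phi> (B.comb s t))
      = binary_form d (\<lambda>i. to_ac (Q i)) s t" unfolding base_form_def by blast
  have \<phi>comb: "\<phi> (B.comb s t) = B.comb (binary_form d (\<lambda>i. to_ac (P i)) s t) (binary_form d (\<lambda>i. to_ac (Q i)) s t)" for s t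
  proof -
    define D where "D = to_ac \<Delta>"
    have D: "D \<noteq> 0" "D = to_ac u0 * to_ac v1 - to_ac u1 * to_ac v0" using \<Delta>0 by (simp add: D_def, simp add: D_def \<Delta>_def)
    have "(p, q) = B.comb (to_ac (v1 / \<Delta>) * p + to_ac (- v0 / \<Delta>) * q)
        (to_ac (u0 / \<Delta>) * q + to_ac (- u1 / \<Delta>) * p)" for p q
      unfolding prod_eq_iff comb to_ac_divide to_ac_minus D_def[symmetric]
      using D(1) by (simp add: field_simps) (simp add: D(2) algebra_simps)
    from this[of "fst (\<phi> (B.comb s t))" "snd (\<phi> (B.comb s t))"] show ?thesis
      by (simp only: P Q prod.collapse)
  qed
  interpret F: berk_forms v w \<iota> a r x y \<phi> \<Phi> d "\<lambda>i. to_ac (P i)" "\<lambda>i. to_ac (Q i)"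
    by unfold_locales (use gauss cont assms(7) ext \<phi>nz \<phi>comb \<xi> in auto)
  have fixed: "C.chord (\<phi> z) z < 1"
    if "fixed_component \<Phi> W" "C.berk_point z \<in> W" "z \<noteq> (0, 0)" "W \<subseteq> {p \<in> topspace C.P1. C.berk_chord p z < 1}" for W z
  proof -
    have "C.berk_point (\<phi> z) \<in> W" using that ext[of z] by (auto simp: fixed_component_def)
    then have "C.berk_chord (C.berk_point (\<phi> z)) z < 1" using that(4) by blast
    then show ?thesis using \<phi>nz[OF that(3)] by (simp add: C.berk_chord_berk_point C.chord_commute)
  qed
  have fixU: "C.chord (\<phi> x) x < 1"
    using assms(13) fixed[OF _ xU xnz Usub] by (auto simp: attracting_component_def)
  \<comment> \<open>An attracting component carries a map that is not injective on \<open>U\<close>,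
    hence not injective on the class containing \<open>U\<close>.\<close>
  have "C.chord (\<phi> y) y < 1 \<or> \<not> inj_on \<Phi> {p \<in> topspace C.P1. C.berk_chord p x < 1}"
    using assms(13) fixed[OF _ yV ynz Vsub] inj_on_subset[OF _ Usub]
    by (auto simp: attracting_component_def indifferent_component_def)
  from F.exists_weight_relation[OF assms(4) fixU this]
  have "\<exists>n c. 1 \<le> n \<and> n \<le> d - 1 \<and> c \<noteq> 0 \<and> v (to_ac c) = B.\<rho> ^ n"
  proof (elim disjE exE conjE)
    assume "B.\<rho> = 1"
    then show ?thesis using assms(4) base.abs_one by (intro exI[of _ 1] exI[of _ 1]) auto
  next
    fix k assume "k + 2 \<le> d" "to_ac (P d) \<noteq> 0" "to_ac (Q k) \<noteq> 0" "v (to_ac (Q k) / to_ac (P d)) = B.\<rho> ^ (d - 1 - k)"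
    then show ?thesis by (intro exI[of _ "d - 1 - k"] exI[of _ "Q k / P d"]) auto
  qed
  then obtain n c where nc: "1 \<le> n" "n \<le> d - 1" "c \<noteq> 0" "v (to_ac c) = B.\<rho> ^ n" by blast
  obtain s where s: "s ^ n = to_ac c" using nth_root_exists[of n "to_ac c"] nc(1) by auto
  have "v s ^ n = B.\<rho> ^ n" using nc(4) s base.abs_power by metis
  then have vs: "v s = B.\<rho>"
    using nc(1) B.\<rho>_pos base.abs_nonneg[of s] by (simp add: power_eq_iff_eq_base)
  define \<alpha> where "\<alpha> = C.point (B.comb s 1)"
  have cnz: "B.comb s 1 \<noteq> (0, 0)" by (rule B.comb_nz) simp
  have "C.chord x (B.comb s 1) = 1" "C.chord y (B.comb s 1) = 1"
    using B.chord_comb_u[of s 1] B.chord_comb_u'[of s 1] B.\<rho>_pos vs base.abs_one C.chord_commute by auto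
  then have "\<not> C.berk_chord (C.berk_point (B.comb s 1)) x < 1" "\<not> C.berk_chord (C.berk_point (B.comb s 1)) y < 1"
    by (simp_all add: C.berk_chord_berk_point[OF cnz])
  then have "C.berk_point (B.comb s 1) \<notin> U \<union> V"
    using Usub Vsub by blast
  then have "classical_point w (map_option \<iota> \<alpha>) \<notin> U \<union> V" by (simp add: C.berk_point_def \<alpha>_def)
  moreover have "point_degree \<alpha> \<le> d - 1"
  proof (cases "snd (B.comb s 1) = 0")
    case True
    \<comment> \<open>Infinity has degree 1, which is at most d - 1 since d \<ge> 2.\<close>
    then show ?thesis using assms(4) by (simp add: \<alpha>_def C.point_def point_degree_infinity)
  next
    case False
    have "point_degree (Some (fst (B.comb s 1) / snd (B.comb s 1))) \<le> n"
      using False by (intro point_degree_mobius[OF s nc(3,1) \<Delta>0[unfolded \<Delta>_def]]) (simp add: comb)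
    then show ?thesis using False nc(2) by (simp add: \<alpha>_def C.point_def)
  qed
  ultimately show ?thesis by blast
qed

end
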